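(* Let $G$ be a graph on $n$ vertices, $D\subseteq V(G)$, and $\varphi$ a $q$-expression for $G-D$. There is an $O(2^{|D|}\cdot n^{2q+1}\cdot q^3)$-time algorithm that computes an optimal (minimum cut size) bisection of $G$.
   Context: A bisection of $G$ is a partition $\{A,B\}$ of $V(G)$ with $|A|,|B|\le\lceil n/2\rceil$; its cut size is the number of edges between $A$ and $B$. A $q$-labeled graph is a pair $(H,\lambda)$ with $\lambda\colon V(H)\to\{1,\dots,q\}$. A $q$-expression is a well-formed expression built from: constants $\bullet_i$ (a single vertex labeled $i$); for distinct $i,j$ the operator $\eta_{i,j}$ adding all edges between label-$i$ and label-$j$ vertices; for distinct $i,j$ the operator $\rho_{i\to j}$ relabeling label $i$ to $j$; and $\oplus$, disjoint union keeping labels. Its value is the resulting labeled graph, and $\varphi$ is a $q$-expression for $H$ if its value is $(H,\lambda)$ for some $\lambda$. The cliquewidth of $H$ is the minimum $q$ such that a $q$-expression for $H$ exists.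
   Formalization: The time bound carries an extra additive term linear in the length of φ, because q-expressions may contain arbitrarily many idle operations and reading them takes time; for φ of length O(nq²) the bound is the stated one. Time is counted on a unit-cost RAM with unbounded cells. *)

theory Defs
  imports Complex_Main
begin

section \<open>Graphs and bisections\<close>

type_synonym 'a graph = "'a set \<times> 'a set set"

abbreviation verts :: "'a graph \<Rightarrow> 'a set" where "verts G \<equiv> fst G"
abbreviation edges :: "'a graph \<Rightarrow> 'a set set" where "edges G \<equiv> snd G"

definition finite_graph :: "'a graph \<Rightarrow> bool" where
  "finite_graph G \<longleftrightarrow> finite (verts G) \<and> (\<forall>e \<in> edges G. e \<subseteq> verts G \<and> card e = 2)"

definition delete_verts :: "'a graph \<Rightarrow> 'a set \<Rightarrow> 'a graph" where
  "delete_verts G D = (verts G - D, {e \<in> edges G. e \<inter> D = {}})"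

text \<open>A part may be empty: otherwise the one-vertex graph would have no bisection.\<close>

definition bisection :: "'a graph \<Rightarrow> 'a set \<Rightarrow> 'a set \<Rightarrow> bool" where
  "bisection G A B \<longleftrightarrow> A \<union> B = verts G \<and> A \<inter> B = {} \<and>
     int (card A) \<le> \<lceil>real (card (verts G)) / 2\<rceil> \<and> int (card B) \<le> \<lceil>real (card (verts G)) / 2\<rceil>"

definition cut_size :: "'a graph \<Rightarrow> 'a set \<Rightarrow> 'a set \<Rightarrow> nat" where
  "cut_size G A B = card {e \<in> edges G. \<exists>a\<in>A. \<exists>b\<in>B. e = {a, b}}"

definition optimal_bisection :: "'a graph \<Rightarrow> 'a set \<Rightarrow> 'a set \<Rightarrow> bool" where
  "optimal_bisection G A B \<longleftrightarrow> bisection G A B \<and>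
     (\<forall>A' B'. bisection G A' B' \<longrightarrow> cut_size G A B \<le> cut_size G A' B')"


section \<open>Labeled graphs and expressions\<close>

type_synonym 'a labeled_graph = "'a graph \<times> ('a \<Rightarrow> nat)"

text \<open>Constants carry the name of the vertex they create, so that the value of an
  expression is a concrete graph. The labeling is a total function; its values
  outside the vertex set are irrelevant.\<close>

datatype 'a qexpr =
    Const 'a nat
  | Join nat nat "'a qexpr"
  | Relabel nat nat "'a qexpr"
  | DUnion "'a qexpr" "'a qexpr"

fun qvalue :: "'a qexpr \<Rightarrow> 'a labeled_graph" where
  "qvalue (Const v i) = (({v}, {}), \<lambda>_. i)"
| "qvalue (Join i j \<phi>) = (let ((V, E), l) = qvalue \<phi> in
     ((V, E \<union> {{u, v} | u v. u \<in> V \<and> v \<in> V \<and> l u = i \<and> l v = j}), l))"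
| "qvalue (Relabel i j \<phi>) = (let (H, l) = qvalue \<phi> in
     (H, \<lambda>v. if l v = i then j else l v))"
| "qvalue (DUnion \<phi> \<psi>) = (let ((V, E), l) = qvalue \<phi>; ((V', E'), l') = qvalue \<psi> in
     ((V \<union> V', E \<union> E'), \<lambda>v. if v \<in> V then l v else l' v))"

text \<open>Operands of a disjoint union must use different vertex names.\<close>

fun wf_qexpr :: "nat \<Rightarrow> 'a qexpr \<Rightarrow> bool" where
  "wf_qexpr q (Const v i) \<longleftrightarrow> i \<in> {1..q}"
| "wf_qexpr q (Join i j \<phi>) \<longleftrightarrow> i \<in> {1..q} \<and> j \<in> {1..q} \<and> i \<noteq> j \<and> wf_qexpr q \<phi>"
| "wf_qexpr q (Relabel i j \<phi>) \<longleftrightarrow> i \<in> {1..q} \<and> j \<in> {1..q} \<and> i \<noteq> j \<and> wf_qexpr q \<phi>"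
| "wf_qexpr q (DUnion \<phi> \<psi>) \<longleftrightarrow> wf_qexpr q \<phi> \<and> wf_qexpr q \<psi> \<and>
     verts (fst (qvalue \<phi>)) \<inter> verts (fst (qvalue \<psi>)) = {}"

definition qexpr_for :: "nat \<Rightarrow> 'a qexpr \<Rightarrow> 'a graph \<Rightarrow> bool" where
  "qexpr_for q \<phi> H \<longleftrightarrow> wf_qexpr q \<phi> \<and> (\<exists>l. qvalue \<phi> = (H, l))"

lemma qexpr_labels:
  "wf_qexpr q \<phi> \<Longrightarrow> v \<in> verts (fst (qvalue \<phi>)) \<Longrightarrow> snd (qvalue \<phi>) v \<in> {1..q}"
  by (induction \<phi>) (auto split: prod.splits if_splits)

lemma qexpr_finite_graph:
  "wf_qexpr q \<phi> \<Longrightarrow> finite_graph (fst (qvalue \<phi>))"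
proof (induction \<phi>)
  case (Join i j \<phi>)
  obtain V E l where "qvalue \<phi> = ((V, E), l)" by (metis prod.exhaust)
  with Join show ?case by (auto simp: finite_graph_def card_insert_if)
next
  case (DUnion \<phi> \<psi>)
  obtain V E l where 1: "qvalue \<phi> = ((V, E), l)" by (metis prod.exhaust)
  obtain V' E' l' where 2: "qvalue \<psi> = ((V', E'), l')" by (metis prod.exhaust)
  from DUnion have "finite_graph (V, E)" "finite_graph (V', E')" using 1 2 by simp_all
  with 1 2 show ?case by (auto simp: finite_graph_def)
qed (simp_all add: finite_graph_def case_prod_unfold Let_def)


section \<open>Random access machine\<close>

text \<open>A uniform-cost random access machine with structured control flow. It has registers
  and zero-based arrays of unbounded length, addressed indirectly; all cells hold natural
  numbers. The only arithmetic is addition and truncated subtraction: with unit-cost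
  multiplication, step counts would not be polynomially related to Turing machine time.

  Every assignment, store and evaluation of a branching condition costs one step. The
  expressions in a fixed program have bounded size, so charging for each operator
  would change running times by a constant factor only.\<close>

datatype aexp =
    Num nat
  | Reg nat
  | Load nat aexp
  | Plus aexp aexp
  | Minus aexp aexp

datatype bexp =
    Less aexp aexp
  | Equal aexp aexp
  | Neg bexp
  | Conj bexp bexp

datatype com =
    Skip
  | Assign nat aexp
  | Store nat aexp aexp
  | Seq com com
  | Cond bexp com com
  | While bexp com

type_synonym state = "(nat \<Rightarrow> nat) \<times> (nat \<Rightarrow> nat \<Rightarrow> nat)"

fun aval :: "aexp \<Rightarrow> state \<Rightarrow> nat" where
  "aval (Num k) s = k"
| "aval (Reg x) s = fst s x"
| "aval (Load a e) s = snd s a (aval e s)"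
| "aval (Plus e f) s = aval e s + aval f s"
| "aval (Minus e f) s = aval e s - aval f s"

fun bval :: "bexp \<Rightarrow> state \<Rightarrow> bool" where
  "bval (Less e f) s \<longleftrightarrow> aval e s < aval f s"
| "bval (Equal e f) s \<longleftrightarrow> aval e s = aval f s"
| "bval (Neg b) s \<longleftrightarrow> \<not> bval b s"
| "bval (Conj b c) s \<longleftrightarrow> bval b s \<and> bval c s"

text \<open>\<open>exec c s t s'\<close>: started in \<open>s\<close>, the program \<open>c\<close> halts in \<open>s'\<close> after \<open>t\<close> steps.\<close>

inductive exec :: "com \<Rightarrow> state \<Rightarrow> nat \<Rightarrow> state \<Rightarrow> bool" where
  Skip: "exec Skip s 1 s"
| Assign: "exec (Assign x e) (r, m) 1 (r(x := aval e (r, m)), m)"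
| Store: "exec (Store a e f) (r, m) 1
    (r, m(a := (m a)(aval e (r, m) := aval f (r, m))))"
| Seq: "exec c s t s' \<Longrightarrow> exec d s' t' s'' \<Longrightarrow> exec (Seq c d) s (t + t') s''"
| CondTrue: "bval b s \<Longrightarrow> exec c s t s' \<Longrightarrow> exec (Cond b c d) s (Suc t) s'"
| CondFalse: "\<not> bval b s \<Longrightarrow> exec d s t s' \<Longrightarrow> exec (Cond b c d) s (Suc t) s'"
| WhileFalse: "\<not> bval b s \<Longrightarrow> exec (While b c) s 1 s"
| WhileTrue: "bval b s \<Longrightarrow> exec c s t s' \<Longrightarrow> exec (While b c) s' t' s'' \<Longrightarrow>
    exec (While b c) s (Suc (t + t')) s''"

inductive_cases exec_SkipE: "exec Skip s t s'"
inductive_cases exec_AssignE: "exec (Assign x e) s t s'"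
inductive_cases exec_StoreE: "exec (Store a e f) s t s'"
inductive_cases exec_SeqE: "exec (Seq c d) s t s'"
inductive_cases exec_CondE: "exec (Cond b c d) s t s'"
inductive_cases exec_WhileE: "exec (While b c) s t s'"

lemma exec_deterministic:
  "exec c s t s' \<Longrightarrow> exec c s u s'' \<Longrightarrow> t = u \<and> s' = s''"
proof (induction arbitrary: u s'' rule: exec.induct)
  case (Seq c s t s' d t' s3)
  from Seq.prems show ?case by (rule exec_SeqE) (use Seq.IH in blast)
next
  case (CondTrue b s c t s' d)
  from CondTrue.prems show ?case
    by (rule exec_CondE) (use CondTrue.hyps CondTrue.IH in blast)+
next
  case (CondFalse b s d t s' c)
  from CondFalse.prems show ?case
    by (rule exec_CondE) (use CondFalse.hyps CondFalse.IH in blast)+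
next
  case (WhileFalse b s c)
  from WhileFalse.prems show ?case
    by (rule exec_WhileE) (use WhileFalse.hyps in simp_all)
next
  case (WhileTrue b s c t s' t' s3)
  from WhileTrue.prems show ?case
    by (rule exec_WhileE) (use WhileTrue.hyps WhileTrue.IH in blast)+
qed (auto elim: exec_SkipE exec_AssignE exec_StoreE)


section \<open>Input and output\<close>

text \<open>Expressions are written in postfix notation, three cells per symbol.
  Idle repetitions of joins and relabelings make \<open>length (code \<phi>)\<close> unbounded in terms of
  the number of vertices and of labels, so the time for reading \<open>\<phi>\<close> has to be accounted for
  separately.\<close>

fun code :: "nat qexpr \<Rightarrow> nat list" where
  "code (Const v i) = [0, v, i]"
| "code (Join i j \<phi>) = code \<phi> @ [1, i, j]"
| "code (Relabel i j \<phi>) = code \<phi> @ [2, i, j]"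
| "code (DUnion \<phi> \<psi>) = code \<phi> @ code \<psi> @ [3, 0, 0]"

text \<open>The vertices are \<open>0, \<dots>, n - 1\<close>. Registers 0, 1, 2 hold \<open>n\<close>, \<open>q\<close> and the number of
  cells of the encoded expression. Arrays 0, 1, 2 hold the adjacency matrix in row-major
  order, the characteristic vector of \<open>D\<close>, and the encoded expression. All other cells
  are zero.\<close>

definition input_state :: "nat graph \<Rightarrow> nat set \<Rightarrow> nat \<Rightarrow> nat qexpr \<Rightarrow> state" where
  "input_state G D q \<phi> = (let n = card (verts G) in
     ((\<lambda>_. 0)(0 := n, 1 := q, 2 := length (code \<phi>)),
      (\<lambda>_ _. 0)
        (0 := \<lambda>k. if k < n * n \<and> {k div n, k mod n} \<in> edges G then 1 else 0,
         1 := \<lambda>v. if v \<in> D then 1 else 0,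
         2 := \<lambda>k. if k < length (code \<phi>) then code \<phi> ! k else 0)))"

text \<open>The two parts are read off array 3.\<close>

definition output_side :: "nat graph \<Rightarrow> nat \<Rightarrow> state \<Rightarrow> nat set" where
  "output_side G b s = {v \<in> verts G. snd s 3 v = b}"

end

(* Only the tree of disjoint unions of the expression and the adjacency matrix matter; joins and
   relabelings are skipped.  Vertices with equal labels at a subexpression are twins with respect to
   the vertices of G - D outside it.  So if W is the vertex set of a subexpression, a set A \<subseteq> W
   interacts with the rest only through its signature: |A| and the numbers |A \<inter> N(w)| for w
   outside W.  The signature is determined by how many vertices of each label A contains, hence there
   are at most \<Prod>(s_i + 1) \<le> 2 |W|^q of them, where s_i is the number of vertices labeled i.

   For each S \<subseteq> D, a table for W stores, per signature, one A \<subseteq> W minimizing the cut of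
   S \<union> A.  Tables of disjoint W1, W2 are combined through
     cut(S \<union> x \<union> y) + cut S + 2 e(x, y) = cut(S \<union> x) + cut(S \<union> y).
   With a = |W1| and b = |W2| this takes O(n a^q b^q + n^2) steps, and
   a^(2q) + b^(2q) + a^q b^q \<le> (a + b)^(2q) bounds the total by O(n^(2q+1)) per S.

   Sets are stored as bit masks, signatures as numbers in base 2^n; the latter serve directly as
   array addresses. *)

theory Submission
  imports Defs "HOL-Library.Nat_Bijection" "HOL-Library.FuncSet"
begin

section \<open>Program logic\<close>

definition halts :: "com \<Rightarrow> (nat \<Rightarrow> state \<Rightarrow> bool) \<Rightarrow> state \<Rightarrow> bool" where
  "halts c Q s \<longleftrightarrow> (\<exists>t s'. exec c s t s' \<and> Q t s')"

lemma halts_Skip [simp]: "halts Skip Q = Q 1"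
  unfolding halts_def fun_eq_iff by (metis exec.Skip exec_SkipE)

lemma exec_Assign_iff: "exec (Assign x e) s t s' \<longleftrightarrow> t = 1 \<and> s' = ((fst s)(x := aval e s), snd s)"
  using exec.Assign[of x e "fst s" "snd s"] by (cases s) (auto elim: exec_AssignE)

lemma exec_Store_iff: "exec (Store a e f) s t s' \<longleftrightarrow>
    t = 1 \<and> s' = (fst s, (snd s)(a := (snd s a)(aval e s := aval f s)))"
  using exec.Store[of a e f "fst s" "snd s"] by (cases s) (auto elim: exec_StoreE)

lemma halts_Assign [simp]:
  "halts (Assign x e) Q = (\<lambda>s. Q 1 ((fst s)(x := aval e s), snd s))"
  unfolding halts_def exec_Assign_iff by blast

lemma halts_Store [simp]:
  "halts (Store a e f) Q = (\<lambda>s. Q 1 (fst s, (snd s)(a := (snd s a)(aval e s := aval f s))))"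
  unfolding halts_def exec_Store_iff by blast

lemma halts_Seq: "halts (Seq c d) Q = halts c (\<lambda>t. halts d (\<lambda>t'. Q (t + t')))"
  unfolding halts_def fun_eq_iff by (blast elim: exec_SeqE intro: exec.Seq)

lemma halts_Cond [simp]: "halts (Cond b c d) Q = (\<lambda>s.
    if bval b s then halts c (\<lambda>t. Q (Suc t)) s else halts d (\<lambda>t. Q (Suc t)) s)"
  unfolding halts_def fun_eq_iff by (metis exec.CondTrue exec.CondFalse exec_CondE)

lemma halts_While: "halts (While b c) Q s \<longleftrightarrow>
    (if bval b s then halts c (\<lambda>t. halts (While b c) (\<lambda>t'. Q (Suc (t + t')))) s else Q 1 s)"
  unfolding halts_def by (metis exec.WhileTrue exec.WhileFalse exec_WhileE)

lemma halts_mono: "halts c Q s \<Longrightarrow> (\<And>t s'. Q t s' \<Longrightarrow> Q' t s') \<Longrightarrow> halts c Q' s"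
  unfolding halts_def by blast

lemma halts_SeqI: "halts c Q s \<Longrightarrow> (\<And>t s'. Q t s' \<Longrightarrow> halts d (\<lambda>t'. Q' (t + t')) s') \<Longrightarrow>
    halts (Seq c d) Q' s"
  unfolding halts_Seq by (rule halts_mono)

notation Seq (infixr ";;" 60)

abbreviation If1 :: "bexp \<Rightarrow> com \<Rightarrow> com" where
  "If1 b c \<equiv> Cond b c Skip"

abbreviation Le :: "aexp \<Rightarrow> aexp \<Rightarrow> bexp" where
  "Le e f \<equiv> Neg (Less f e)"

definition For :: "nat \<Rightarrow> aexp \<Rightarrow> aexp \<Rightarrow> com \<Rightarrow> com" where
  "For x a b c = Assign x a ;;
     While (Less (Reg x) b) (c ;; Assign x (Plus (Reg x) (Num 1)))"

lemma halts_For: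
  assumes "aval a s = lo" "lo \<le> hi" "I lo ((fst s)(x := lo), snd s)"
    and I: "\<And>k s. I k s \<Longrightarrow> k \<le> hi \<Longrightarrow> fst s x = k \<and> aval b s = hi"
    and step: "\<And>k s. I k s \<Longrightarrow> lo \<le> k \<Longrightarrow> k < hi \<Longrightarrow>
      halts c (\<lambda>t s'. t \<le> T k \<and> fst s' x = k \<and> I (Suc k) ((fst s')(x := Suc k), snd s')) s"
  shows "halts (For x a b c) (\<lambda>t s'. t \<le> 2 + (\<Sum>k=lo..<hi. T k + 2) \<and> I hi s') s"
proof -
  define L where "L = While (Less (Reg x) b) (c ;; Assign x (Plus (Reg x) (Num 1)))"
  have L: "halts L Q s \<longleftrightarrow> (if fst s x < aval b s
      then halts c (\<lambda>t s'. halts L (\<lambda>t'. Q (t + t' + 2)) ((fst s')(x := Suc (fst s' x)), snd s')) s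
      else Q 1 s)" for Q s
    unfolding L_def by (subst halts_While) (simp add: halts_Seq)
  have "lo \<le> k \<Longrightarrow> k \<le> hi \<Longrightarrow> I k s \<Longrightarrow>
     halts L (\<lambda>t s'. t \<le> 1 + (\<Sum>k=k..<hi. T k + 2) \<and> I hi s') s" for k s
  proof (induction "hi - k" arbitrary: k s)
    case 0
    then show ?case using I[of k s] by (subst L) simp
  next
    case (Suc d)
    have k: "k < hi" using Suc by simp
    have "halts L (\<lambda>t'. (\<lambda>t s'. t \<le> 1 + (\<Sum>k=k..<hi. T k + 2) \<and> I hi s') (t + t' + 2))
        ((fst s')(x := Suc (fst s' x)), snd s')"
      if "t \<le> T k \<and> fst s' x = k \<and> I (Suc k) ((fst s')(x := Suc k), snd s')" for t s'
    proof -
      have "halts L (\<lambda>t s'. t \<le> 1 + (\<Sum>k=Suc k..<hi. T k + 2) \<and> I hi s')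
          ((fst s')(x := Suc (fst s' x)), snd s')"
        using Suc.hyps(1)[of "Suc k"] Suc.hyps(2) Suc.prems k that by simp
      then show ?thesis
        by (rule halts_mono) (use that k in \<open>auto simp: sum.atLeast_Suc_lessThan\<close>)
    qed
    then show ?case
      unfolding L[of _ s] using I[OF Suc.prems(3,2)] k halts_mono[OF step[OF Suc.prems(3,1) k]] by simp
  qed
  from this[OF order_refl assms(2,3)] show ?thesis
    unfolding For_def halts_Seq L_def[symmetric]
    by (simp add: assms(1) halts_mono)
qed

definition frame :: "nat set \<Rightarrow> nat set \<Rightarrow> state \<Rightarrow> state \<Rightarrow> bool" where
  "frame R M s s' \<longleftrightarrow> (\<forall>x. x \<notin> R \<longrightarrow> fst s' x = fst s x) \<and> (\<forall>a. a \<notin> M \<longrightarrow> snd s' a = snd s a)"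

lemma frame_refl [simp]: "frame R M s s"
  by (simp add: frame_def)

lemma frame_reg: "frame R M s s' \<Longrightarrow> x \<notin> R \<Longrightarrow> fst s' x = fst s x"
  and frame_arr: "frame R M s s' \<Longrightarrow> a \<notin> M \<Longrightarrow> snd s' a = snd s a"
  by (simp_all add: frame_def)

lemma frame_trans: "frame R M s s' \<Longrightarrow> frame R' M' s' s'' \<Longrightarrow> R \<subseteq> R'' \<Longrightarrow> R' \<subseteq> R'' \<Longrightarrow>
    M \<subseteq> M'' \<Longrightarrow> M' \<subseteq> M'' \<Longrightarrow> frame R'' M'' s s''"
  unfolding frame_def by (metis subsetD)

lemma frame_upd_reg [simp]: "x \<in> R \<Longrightarrow> frame R M s (r(x := v), m) \<longleftrightarrow> frame R M s (r, m)"
  and frame_upd_arr [simp]: "a \<in> M \<Longrightarrow> frame R M s (r, m(a := f)) \<longleftrightarrow> frame R M s (r, m)"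
  by (auto simp: frame_def)

section \<open>Cuts and signatures\<close>

locale cut_graph =
  fixes n :: nat and adj :: "nat \<Rightarrow> nat \<Rightarrow> bool" and D :: "nat set"
  assumes adj_sym: "adj u w \<longleftrightarrow> adj w u"
begin

definition U :: "nat set" where "U = {..<n} - D"

definition between :: "nat set \<Rightarrow> nat set \<Rightarrow> nat" where
  "between A B = (\<Sum>u\<in>A. \<Sum>w\<in>B. of_bool (adj u w))"

definition cut :: "nat set \<Rightarrow> nat" where
  "cut X = between X ({..<n} - X)"

lemma between_single: "between A {w} = (\<Sum>u\<in>A. if adj u w then 1 else 0)"
  by (auto simp: between_def intro!: sum.cong)

lemma between_commute: "between A B = between B A"
  unfolding between_def by (subst sum.swap) (simp add: adj_sym)

lemma between_Un_left: "finite A \<Longrightarrow> finite B \<Longrightarrow> A \<inter> B = {} \<Longrightarrow>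
    between (A \<union> B) C = between A C + between B C"
  unfolding between_def by (rule sum.union_disjoint)

lemma between_Un_right: "finite A \<Longrightarrow> finite B \<Longrightarrow> A \<inter> B = {} \<Longrightarrow>
    between C (A \<union> B) = between C A + between C B"
  by (metis between_commute between_Un_left)

lemma cut_union:
  assumes "S \<subseteq> {..<n}" "x \<subseteq> {..<n}" "y \<subseteq> {..<n}" "S \<inter> x = {}" "S \<inter> y = {}" "x \<inter> y = {}"
  shows "cut (S \<union> x \<union> y) + (cut S + 2 * between x y) = cut (S \<union> x) + cut (S \<union> y)"
proof -
  define R where "R = {..<n} - (S \<union> x \<union> y)"
  have fin: "finite S" "finite x" "finite y" "finite R"
    using assms finite_subset[OF _ finite_lessThan] by (auto simp: R_def)
  have 1: "{..<n} - S = x \<union> (y \<union> R)" "{..<n} - (S \<union> x) = y \<union> R" "{..<n} - (S \<union> y) = x \<union> R"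
    using assms unfolding R_def by blast+
  have 2: "x \<inter> (y \<union> R) = {}" "y \<inter> R = {}" "x \<inter> R = {}" "(S \<union> x) \<inter> y = {}"
    using assms unfolding R_def by blast+
  show ?thesis
    unfolding cut_def 1 R_def[symmetric]
    using fin assms(4-6) 2
    by (simp add: between_Un_left between_Un_right between_commute[of y x] between_commute[of y S])
qed

definition sim :: "nat set \<Rightarrow> nat set \<Rightarrow> nat set \<Rightarrow> bool" where
  "sim W A A' \<longleftrightarrow> card A = card A' \<and> (\<forall>w\<in>U - W. between A {w} = between A' {w})"

lemma sim_refl [simp]: "sim W A A"
  by (simp add: sim_def)

lemma sim_trans: "sim W A B \<Longrightarrow> sim W B C \<Longrightarrow> sim W A C"
  by (simp add: sim_def)

lemma between_singletons: "between A B = (\<Sum>w\<in>B. between A {w})"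
  by (subst between_commute, subst (2) between_commute) (simp add: between_def)

lemma sim_between: "sim W A A' \<Longrightarrow> R \<subseteq> U - W \<Longrightarrow> between A R = between A' R"
  by (subst (1 2) between_singletons) (auto simp: sim_def intro!: sum.cong)

lemma U_finite: "W \<subseteq> U \<Longrightarrow> finite W"
  by (rule finite_subset[of _ "{..<n}"]) (auto simp: U_def)

lemma sim_union:
  assumes "sim W1 x A" "sim W2 y B" "x \<subseteq> W1" "A \<subseteq> W1" "y \<subseteq> W2" "B \<subseteq> W2"
    "W1 \<inter> W2 = {}" "W1 \<subseteq> U" "W2 \<subseteq> U"
  shows "sim (W1 \<union> W2) (x \<union> y) (A \<union> B)"
proof -
  have fin: "finite x" "finite y" "finite A" "finite B"
    using assms U_finite finite_subset by metis+
  have "x \<inter> y = {}" "A \<inter> B = {}" using assms by auto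
  with assms fin show ?thesis by (simp add: sim_def card_Un_disjoint between_Un_left)
qed

lemma cut_exchange:
  assumes "sim W A A'" "A \<subseteq> W" "A' \<subseteq> W" "W \<subseteq> U" "R \<subseteq> U - W" "S \<subseteq> D" "D \<subseteq> {..<n}"
    and "cut (S \<union> A) \<le> cut (S \<union> A')"
  shows "cut (S \<union> A \<union> R) \<le> cut (S \<union> A' \<union> R)"
proof -
  have "cut (S \<union> A \<union> R) + (cut S + 2 * between A R) = cut (S \<union> A) + cut (S \<union> R)"
    "cut (S \<union> A' \<union> R) + (cut S + 2 * between A' R) = cut (S \<union> A') + cut (S \<union> R)"
    using assms by (intro cut_union; force simp: U_def)+
  with sim_between[OF assms(1,5)] assms(8) show ?thesis by linarith
qed

definition weight :: "nat set \<Rightarrow> nat \<Rightarrow> nat" where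
  "weight W u = 2 ^ (n * n) + (\<Sum>w<n. if w \<notin> W \<and> w \<notin> D \<and> adj u w then 2 ^ (w * n) else 0)"

definition key :: "nat set \<Rightarrow> nat set \<Rightarrow> nat" where
  "key W A = (\<Sum>u\<in>A. weight W u)"

end

lemma digits_unique:
  fixes d d' :: "nat \<Rightarrow> nat"
  assumes "\<forall>w<k. d w < B" "\<forall>w<k. d' w < B" "(\<Sum>w<k. d w * B ^ w) = (\<Sum>w<k. d' w * B ^ w)" "w < k"
  shows "d w = d' w"
  using assms
proof (induction k arbitrary: d d' w)
  case (Suc k)
  have split: "(\<Sum>w<Suc k. f w * B ^ w) = f 0 + B * (\<Sum>w<k. f (Suc w) * B ^ w)" for f :: "nat \<Rightarrow> nat"
    unfolding sum.lessThan_Suc_shift by (simp add: sum_distrib_left algebra_simps)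
  have eq: "d 0 + B * (\<Sum>w<k. d (Suc w) * B ^ w) = d' 0 + B * (\<Sum>w<k. d' (Suc w) * B ^ w)"
    using Suc.prems(3) by (simp only: split)
  have lt: "d 0 < B" "d' 0 < B" using Suc.prems by auto
  have 0: "d 0 = d' 0"
    using arg_cong[OF eq, of "\<lambda>z. z mod B"] lt by simp
  have "(\<Sum>w<k. d (Suc w) * B ^ w) = (\<Sum>w<k. d' (Suc w) * B ^ w)"
    using eq 0 lt by simp
  then have "w < k \<Longrightarrow> d (Suc w) = d' (Suc w)" for w
    using Suc.IH[of "\<lambda>w. d (Suc w)" "\<lambda>w. d' (Suc w)" w] Suc.prems(1,2) by simp
  with 0 Suc.prems(4) show ?case by (cases w) auto
qed simp

lemma prod_Suc_le:
  fixes s :: "'a \<Rightarrow> nat"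
  assumes "finite I" "(\<Sum>i\<in>I. s i) = m" "0 < m"
  shows "(\<Prod>i\<in>I. Suc (s i)) \<le> 2 * m ^ card I"
proof (cases "\<exists>i\<in>I. s i = m")
  case True
  then obtain i where i: "i \<in> I" "s i = m" by blast
  then have "(\<Sum>j\<in>I - {i}. s j) = 0"
    using assms by (simp add: sum_diff1_nat)
  then have "\<forall>j\<in>I - {i}. s j = 0" using assms(1) by simp
  then have "(\<Prod>j\<in>I. Suc (s j)) = Suc m"
    using i assms(1) by (simp add: prod.remove)
  moreover have "card I \<noteq> 0" using i assms(1) by auto
  then have "m ^ 1 \<le> m ^ card I" using assms(3) by (intro power_increasing) auto
  ultimately show ?thesis using assms(3) by simp
next
  case False
  have "Suc (s i) \<le> m" if "i \<in> I" for i
    using member_le_sum[of i I s] that assms False by fastforce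
  then have "(\<Prod>i\<in>I. Suc (s i)) \<le> (\<Prod>i\<in>I. m)" by (intro prod_mono) auto
  then show ?thesis by simp
qed

context cut_graph
begin

lemma key_digits:
  assumes "finite A"
  shows "key W A = (\<Sum>w<Suc n. (if w = n then card A else if w \<in> U - W then between A {w} else 0) * (2 ^ n) ^ w)"
proof -
  have "key W A = card A * 2 ^ (n * n) + (\<Sum>w<n. \<Sum>u\<in>A. if w \<notin> W \<and> w \<notin> D \<and> adj u w then 2 ^ (w * n) else 0)"
    unfolding key_def weight_def by (subst sum.swap) (simp add: sum.distrib)
  also have "(\<Sum>w<n. \<Sum>u\<in>A. if w \<notin> W \<and> w \<notin> D \<and> adj u w then 2 ^ (w * n) else 0)
      = (\<Sum>w<n. (if w \<in> U - W then between A {w} else 0) * (2 ^ n) ^ w :: nat)"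
    by (intro sum.cong refl)
      (auto simp: between_single U_def sum_distrib_left mult.commute
        simp flip: power_mult intro!: sum.cong)
  finally show ?thesis by (simp flip: power_mult)
qed

lemma key_eq_sim:
  assumes "key W A = key W A'" "A \<subseteq> {..<n}" "A' \<subseteq> {..<n}"
  shows "sim W A A'"
proof -
  let ?d = "\<lambda>A w. if w = n then card A else if w \<in> U - W then between A {w} else 0"
  have fin: "finite A" "finite A'" using assms finite_subset by blast+
  have bound: "\<forall>w<Suc n. ?d B w < 2 ^ n" if "B \<subseteq> {..<n}" for B
  proof -
    have "card B \<le> n" using card_mono[OF _ that] by simp
    then have B: "card B < 2 ^ n" using less_exp by (rule le_less_trans)
    have "(\<Sum>u\<in>B. if adj u w then 1 else 0) \<le> card B" for w
      unfolding card_eq_sum by (rule sum_mono) simp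
    then have "between B {w} < 2 ^ n" for w
      unfolding between_single using B by (rule le_less_trans)
    then show ?thesis using B by auto
  qed
  have d: "?d A w = ?d A' w" if "w < Suc n" for w
    using assms key_digits[OF fin(1)] key_digits[OF fin(2)]
    by (intro digits_unique[OF bound bound _ that]) simp_all
  have "between A {w} = between A' {w}" if "w \<in> U - W" for w
    using d[of w] that by (simp add: U_def)
  with d[of n] show ?thesis by (simp add: sim_def)
qed

definition labeling :: "nat \<Rightarrow> nat set \<Rightarrow> bool" where
  "labeling q W \<longleftrightarrow> (\<exists>l. \<forall>u\<in>W. l u \<in> {1..q} \<and>
     (\<forall>u'\<in>W. l u = l u' \<longrightarrow> (\<forall>w\<in>U - W. adj u w \<longleftrightarrow> adj u' w)))"

lemma card_keys:
  assumes "labeling q W" "finite W" "W \<noteq> {}"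
  shows "card (key W ` Pow W) \<le> 2 * card W ^ q"
proof -
  obtain l where l: "\<And>u. u \<in> W \<Longrightarrow> l u \<in> {1..q}"
    and l': "\<And>u u' w. u \<in> W \<Longrightarrow> u' \<in> W \<Longrightarrow> l u = l u' \<Longrightarrow> w \<in> U - W \<Longrightarrow> adj u w \<longleftrightarrow> adj u' w"
    using assms(1) unfolding labeling_def by metis
  define L where "L i = {u \<in> W. l u = i}" for i
  define wt where "wt i = weight W (SOME u. u \<in> L i)" for i
  have wt: "weight W u = wt (l u)" if "u \<in> W" for u
  proof -
    have "u \<in> L (l u)" using that by (simp add: L_def)
    then have "(SOME v. v \<in> L (l u)) \<in> L (l u)" by (rule someI)
    then have "adj u w \<longleftrightarrow> adj (SOME v. v \<in> L (l u)) w" if "w \<in> U - W" for w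
      using l'[of u "SOME v. v \<in> L (l u)"] \<open>u \<in> W\<close> that by (simp add: L_def)
    then show ?thesis unfolding wt_def weight_def by (auto simp: U_def intro!: sum.cong)
  qed
  have "key W A = (\<Sum>i\<in>{1..q}. card (A \<inter> L i) * wt i)" if "A \<subseteq> W" for A
  proof -
    have "finite A" using that assms(2) finite_subset by blast
    then have "key W A = (\<Sum>i\<in>{1..q}. \<Sum>u\<in>{u\<in>A. l u = i}. weight W u)"
      unfolding key_def using that l by (intro sum.group[symmetric]) auto
    also have "\<dots> = (\<Sum>i\<in>{1..q}. \<Sum>u\<in>A \<inter> L i. wt i)"
      using that wt by (intro sum.cong) (auto simp: L_def)
    finally show ?thesis by simp
  qed
  then have "key W ` Pow W \<subseteq>
      (\<lambda>f. \<Sum>i\<in>{1..q}. f i * wt i) ` (PiE {1..q} (\<lambda>i. {..card (L i)}))"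
  proof (intro subsetI, elim imageE, hypsubst)
    fix A assume "A \<in> Pow W"
    then have "A \<subseteq> W" by simp
    have "restrict (\<lambda>i. card (A \<inter> L i)) {1..q} \<in> PiE {1..q} (\<lambda>i. {..card (L i)})"
      using assms(2) by (auto simp: L_def PiE_iff intro!: card_mono)
    moreover have "key W A = (\<Sum>i\<in>{1..q}. restrict (\<lambda>i. card (A \<inter> L i)) {1..q} i * wt i)"
      using \<open>\<And>A. A \<subseteq> W \<Longrightarrow> key W A = _ A\<close>[OF \<open>A \<subseteq> W\<close>] by simp
    ultimately show "key W A \<in> (\<lambda>f. \<Sum>i\<in>{1..q}. f i * wt i) ` (PiE {1..q} (\<lambda>i. {..card (L i)}))"
      by blast
  qed
  then have "card (key W ` Pow W) \<le> card (PiE {1..q} (\<lambda>i. {..card (L i)}))"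
    by (intro surj_card_le finite_PiE) auto
  also have "\<dots> = (\<Prod>i\<in>{1..q}. Suc (card (L i)))" by (simp add: card_PiE)
  also have "\<dots> \<le> 2 * card W ^ card {1..q}"
  proof (rule prod_Suc_le)
    have "(\<Sum>i\<in>{1..q}. \<Sum>u\<in>{u\<in>W. l u = i}. 1) = (\<Sum>u\<in>W. 1)"
      using assms(2) l by (intro sum.group) auto
    then show "(\<Sum>i\<in>{1..q}. card (L i)) = card W" by (simp only: L_def card_eq_sum)
  qed (use assms in \<open>auto simp: card_gt_0_iff\<close>)
  finally show ?thesis by simp
qed

end

lemma halts_For_const:
  assumes "aval a s = lo" "lo \<le> hi" "I lo ((fst s)(x := lo), snd s)"
    and "\<And>k s. I k s \<Longrightarrow> k \<le> hi \<Longrightarrow> fst s x = k \<and> aval b s = hi"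
    and "\<And>k s. I k s \<Longrightarrow> lo \<le> k \<Longrightarrow> k < hi \<Longrightarrow>
      halts c (\<lambda>t s'. t \<le> T \<and> fst s' x = k \<and> I (Suc k) ((fst s')(x := Suc k), snd s')) s"
    and "\<And>t s'. t \<le> 2 + (hi - lo) * (T + 2) \<Longrightarrow> I hi s' \<Longrightarrow> Q t s'"
  shows "halts (For x a b c) Q s"
  by (rule halts_mono[OF halts_For[of a s lo hi I x b c "\<lambda>_. T", OF assms(1-5)]]) (auto intro: assms(6))

lemma halts_sum_loop:
  assumes "fst s 0 = n" "y \<noteq> r" "y \<noteq> 0" "r \<noteq> 0"
    and "\<And>k s'. k < n \<Longrightarrow> frame {y, r} {} s s' \<Longrightarrow> fst s' y = k \<Longrightarrow> (bval b s' \<longleftrightarrow> P k) \<and> (P k \<longrightarrow> aval e s' = f k)"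
    and "\<And>t s'. t \<le> 2 + 4 * n \<Longrightarrow> frame {y, r} {} s s' \<Longrightarrow>
      fst s' r = fst s r + (\<Sum>k<n. if P k then f k else 0) \<Longrightarrow> Q t s'"
  shows "halts (For y (Num 0) (Reg 0) (If1 b (Assign r (Plus (Reg r) e)))) Q s"
proof (rule halts_For_const[where lo = 0 and hi = n and T = 2 and
    I = "\<lambda>k s'. frame {y, r} {} s s' \<and> fst s' y = k \<and> fst s' r = fst s r + (\<Sum>k<k. if P k then f k else 0)"])
  fix k s' assume 1: "frame {y, r} {} s s' \<and> fst s' y = k \<and> fst s' r = fst s r + (\<Sum>k<k. if P k then f k else 0)"
    and "k < n"
  then have "(bval b s' \<longleftrightarrow> P k) \<and> (P k \<longrightarrow> aval e s' = f k)" using assms(5) by blast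
  with 1 assms(2-4) show "halts (If1 b (Assign r (Plus (Reg r) e)))
     (\<lambda>t s''. t \<le> 2 \<and> fst s'' y = k \<and> frame {y, r} {} s ((fst s'')(y := Suc k), snd s'') \<and>
      fst ((fst s'')(y := Suc k), snd s'') y = Suc k \<and>
      fst ((fst s'')(y := Suc k), snd s'') r = fst s r + (\<Sum>k<Suc k. if P k then f k else 0)) s'"
    by simp
qed (use assms in \<open>auto simp: frame_def\<close>)

lemma set_encode_less: "A \<subseteq> {..<k} \<Longrightarrow> set_encode A < 2 ^ k"
proof (induction k arbitrary: A)
  case (Suc k)
  then have "A - {k} \<subseteq> {..<k}" by (auto simp: less_Suc_eq)
  then have "set_encode (A - {k}) < 2 ^ k" by (rule Suc.IH)
  moreover have "finite A" using Suc.prems finite_subset by blast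
  then have "set_encode A \<le> 2 ^ k + set_encode (A - {k})"
    by (cases "k \<in> A") (auto simp: set_encode_def sum.remove)
  ultimately show ?case by simp
qed simp

lemma set_encode_Un: "finite A \<Longrightarrow> finite B \<Longrightarrow> A \<inter> B = {} \<Longrightarrow>
    set_encode (A \<union> B) = set_encode A + set_encode B"
  by (simp add: set_encode_def sum.union_disjoint)

lemma set_encode_restrict_Suc:
  "set_encode (A \<inter> {..<Suc k}) = (if k \<in> A then 2 ^ k else 0) + set_encode (A \<inter> {..<k})"
  by (simp add: lessThan_Suc)

section \<open>Subroutines\<close>

text \<open>
  Register 0 holds \<open>n\<close>. Array 4 holds the powers of two, array 5 the row offsets \<open>v * n\<close> of the
  adjacency matrix. \<open>decode a\<close> unpacks the mask in register 4 into array \<open>a\<close>, and \<open>cut_com\<close> puts the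
  cut of the set in array 15 into register 5. \<open>weight_com\<close> fills array 19 with the contributions of
  single vertices to the signature relative to the set in array 16, and \<open>degree_com\<close> puts into array
  20, for each vertex of the set in array 17, the number of its neighbours in the set in array 18.
\<close>

definition decode :: "nat \<Rightarrow> com" where
  "decode a = (let i = Minus (Reg 0) (Plus (Reg 3) (Num 1)) in
     For 3 (Num 0) (Reg 0)
       (Cond (Less (Reg 4) (Load 4 i))
         (Store a i (Num 0))
         (Store a i (Num 1) ;; Assign 4 (Minus (Reg 4) (Load 4 i)))))"

definition cut_com :: com where
  "cut_com = Assign 5 (Num 0) ;;
     For 6 (Num 0) (Reg 0)
       (If1 (Equal (Load 15 (Reg 6)) (Num 1))
         (For 7 (Num 0) (Reg 0)
           (If1 (Conj (Equal (Load 15 (Reg 7)) (Num 0)) (Equal (Load 0 (Plus (Load 5 (Reg 6)) (Reg 7))) (Num 1)))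
             (Assign 5 (Plus (Reg 5) (Num 1))))))"

definition weight_com :: com where
  "weight_com = For 6 (Num 0) (Reg 0)
     (Assign 20 (Load 4 (Load 5 (Reg 0))) ;;
      For 7 (Num 0) (Reg 0)
        (If1 (Conj (Equal (Load 16 (Reg 7)) (Num 0)) (Conj (Equal (Load 1 (Reg 7)) (Num 0))
            (Equal (Load 0 (Plus (Load 5 (Reg 6)) (Reg 7))) (Num 1))))
          (Assign 20 (Plus (Reg 20) (Load 4 (Load 5 (Reg 7)))))) ;;
      Store 19 (Reg 6) (Reg 20))"

definition degree_com :: com where
  "degree_com = For 6 (Num 0) (Reg 0)
     (Assign 22 (Num 0) ;;
      If1 (Equal (Load 17 (Reg 6)) (Num 1))
        (For 7 (Num 0) (Reg 0)
          (If1 (Conj (Equal (Load 18 (Reg 7)) (Num 1)) (Equal (Load 0 (Plus (Load 5 (Reg 6)) (Reg 7))) (Num 1)))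
            (Assign 22 (Plus (Reg 22) (Num 1))))) ;;
      Store 20 (Reg 6) (Reg 22))"

context cut_graph
begin

definition ready :: "state \<Rightarrow> bool" where
  "ready s \<longleftrightarrow> 0 < n \<and> fst s 0 = n \<and> (\<forall>u<n. \<forall>w<n. snd s 0 (u * n + w) = of_bool (adj u w)) \<and>
     (\<forall>v<n. snd s 1 v = of_bool (v \<in> D)) \<and> (\<forall>k\<le>n * n. snd s 4 k = 2 ^ k) \<and> (\<forall>v\<le>n. snd s 5 v = v * n)"

lemma ready_frame: "ready s \<Longrightarrow> frame R M s s' \<Longrightarrow> 0 \<notin> R \<Longrightarrow> {0, 1, 4, 5} \<inter> M = {} \<Longrightarrow> ready s'"
  by (simp add: ready_def frame_def)

definition chi :: "nat \<Rightarrow> nat set \<Rightarrow> state \<Rightarrow> bool" where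
  "chi a A s \<longleftrightarrow> (\<forall>v<n. snd s a v = of_bool (v \<in> A))"

lemma chi_frame: "chi a A s \<Longrightarrow> frame R M s s' \<Longrightarrow> a \<notin> M \<Longrightarrow> chi a A s'"
  by (simp add: chi_def frame_def)

lemma halts_decode:
  assumes "ready s" "fst s 4 = set_encode A" "A \<subseteq> {..<n}" "a \<notin> {0, 1, 4, 5}"
    and "\<And>t s'. t \<le> 7 * n \<Longrightarrow> chi a A s' \<Longrightarrow> frame {3, 4} {a} s s' \<Longrightarrow> Q t s'"
  shows "halts (decode a) Q s"
  unfolding decode_def Let_def
proof (rule halts_For_const[where lo = 0 and hi = n and T = 3 and
    I = "\<lambda>k s'. frame {3, 4} {a} s s' \<and> fst s' 3 = k \<and> fst s' 4 = set_encode (A \<inter> {..<n - k}) \<and>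
      (\<forall>v. n - k \<le> v \<and> v < n \<longrightarrow> snd s' a v = of_bool (v \<in> A))"], goal_cases)
  case (3)
  then show ?case using assms by (simp add: Int_absorb2)
next
  case (4 k s')
  then show ?case using assms by (simp add: ready_def frame_def)
next
  case (5 k s')
  define j where "j = n - Suc k"
  have j: "n - k = Suc j" "j < n" using 5 by (auto simp: j_def)
  have "frame {3, 4} {a} s s'" using 5(1) by simp
  from ready_frame[OF assms(1) this] have "ready s'" using assms(4) by simp
  moreover have "j \<le> n * n" using j(2) le_square[of n] by linarith
  ultimately have r: "fst s' 0 = n" "snd s' 4 j = 2 ^ j" by (simp_all add: ready_def)
  have "n - (k + 1) = j" "n - Suc k = j" "n - Suc (k - 0) = j" by (simp_all add: j_def)
  moreover have "set_encode (A \<inter> {..<j}) < 2 ^ j" by (intro set_encode_less) auto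
  moreover have "fst s' 3 = k" "fst s' 4 = (if j \<in> A then 2 ^ j else 0) + set_encode (A \<inter> {..<j})"
    "frame {3, 4} {a} s s'"
    using 5(1) by (simp_all add: j(1) flip: set_encode_restrict_Suc)
  moreover have "snd s' a v = of_bool (v \<in> A)" if "j \<le> v" "v < n" "v \<noteq> j" for v
    using 5(1) that by (simp add: j(1))
  ultimately show ?case
    using r assms(4) by (auto simp: halts_Seq)
next
  case (6 t s')
  have "0 < n" using assms(1) by (simp add: ready_def)
  with 6 show ?case by (intro assms(5)) (auto simp: chi_def)
qed (use assms in auto)

lemma halts_cut:
  assumes "ready s" "chi 15 X s" "X \<subseteq> {..<n}"
    and "\<And>t s'. t \<le> 12 * n * n \<Longrightarrow> fst s' 5 = cut X \<Longrightarrow> frame {5, 6, 7} {} s s' \<Longrightarrow> Q t s'"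
  shows "halts cut_com Q s"
proof -
  have n: "0 < n" and s0: "fst s 0 = n" using assms(1) by (auto simp: ready_def)
  let ?f = "\<lambda>u. if u \<in> X then \<Sum>w<n. if w \<notin> X \<and> adj u w then 1 else 0 else (0::nat)"
  have eq: "(\<Sum>u<n. ?f u) = cut X"
  proof -
    have "(\<Sum>u<n. ?f u) = (\<Sum>u\<in>X. \<Sum>w<n. if w \<notin> X \<and> adj u w then 1 else 0)"
      using assms(3) by (simp add: sum.If_cases Int_absorb1 flip: Int_def)
    also have "\<dots> = cut X"
      unfolding cut_def between_def
      by (intro sum.cong refl sum.mono_neutral_cong_right) auto
    finally show ?thesis .
  qed
  show ?thesis
    unfolding cut_com_def halts_Seq halts_Assign
  proof (rule halts_For_const[where lo = 0 and hi = n and T = "4 * n + 3" and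
      I = "\<lambda>k s'. frame {5, 6, 7} {} s s' \<and> fst s' 6 = k \<and> fst s' 5 = (\<Sum>u<k. ?f u)"], goal_cases)
    case (5 k s')
    have fr: "frame {5, 6, 7} {} s s'" using 5 by simp
    have r: "ready s'" "chi 15 X s'" using ready_frame[OF _ fr] chi_frame[OF _ fr] assms by simp_all
    show ?case
    proof (cases "k \<in> X")
      case True
      show ?thesis
        unfolding halts_Cond using True r(2) 5 apply (simp add: chi_def)
        apply (rule halts_sum_loop[where n = n and P = "\<lambda>w. w \<notin> X \<and> adj k w" and f = "\<lambda>_. 1"])
        using 5 r by (auto simp: ready_def chi_def frame_def)
    next
      case False
      then show ?thesis using 5 r by (simp add: chi_def)
    qed
  next
    case (6 t s')
    have "Suc t \<le> 3 + n * (4 * n + 5)" using 6 by (simp add: add.commute)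
    also have "\<dots> \<le> 12 * n * n" using n by (cases n) (auto simp: algebra_simps)
    finally show ?case using 6 eq n by (intro assms(4)) auto
  qed (use s0 in \<open>auto simp: frame_def\<close>)
qed

lemma halts_weight:
  assumes "ready s" "chi 16 W s"
    and "\<And>t s'. t \<le> 12 * n * n \<Longrightarrow> \<forall>u<n. snd s' 19 u = weight W u \<Longrightarrow> frame {6, 7, 20} {19} s s' \<Longrightarrow> Q t s'"
  shows "halts weight_com Q s"
proof -
  have n: "0 < n" and s0: "fst s 0 = n" using assms(1) by (auto simp: ready_def)
  show ?thesis
    unfolding weight_com_def
  proof (rule halts_For_const[where lo = 0 and hi = n and T = "4 * n + 4" and
      I = "\<lambda>k s'. frame {6, 7, 20} {19} s s' \<and> fst s' 6 = k \<and> (\<forall>u<k. snd s' 19 u = weight W u)"], goal_cases)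
    case (5 k s')
    have fr: "frame {6, 7, 20} {19} s s'" using 5 by simp
    have r: "ready s'" "chi 16 W s'" using ready_frame[OF _ fr] chi_frame[OF _ fr] assms by simp_all
    have le: "w < n \<Longrightarrow> w * n \<le> n * n" for w by simp
    show ?case
      unfolding halts_Seq halts_Assign
      apply (rule halts_sum_loop[where n = n and P = "\<lambda>w. w \<notin> W \<and> w \<notin> D \<and> adj k w" and f = "\<lambda>w. 2 ^ (w * n)"])
      using 5 r le by (auto simp: ready_def chi_def frame_def weight_def less_Suc_eq)
  next
    case (6 t s')
    have "t \<le> 2 + n * (4 * n + 6)" using 6 by (simp add: add.commute)
    also have "\<dots> \<le> 12 * n * n" using n by (cases n) (auto simp: algebra_simps)
    finally show ?case using 6 n by (intro assms(3)) auto
  qed (use s0 in \<open>auto simp: frame_def\<close>)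
qed

lemma halts_degree:
  assumes "ready s" "chi 17 Y s" "chi 18 X s" "X \<subseteq> {..<n}" "Y \<subseteq> {..<n}"
    and "\<And>t s'. t \<le> 8 * n + 6 * n * card Y \<Longrightarrow> \<forall>u<n. snd s' 20 u = (if u \<in> Y then between X {u} else 0) \<Longrightarrow>
      frame {6, 7, 22} {20} s s' \<Longrightarrow> Q t s'"
  shows "halts degree_com Q s"
proof -
  have n: "0 < n" and s0: "fst s 0 = n" using assms(1) by (auto simp: ready_def)
  have eq: "(\<Sum>w<n. if w \<in> X \<and> adj u w then 1 else 0) = between X {u}" for u
  proof -
    have "(\<Sum>w<n. if w \<in> X \<and> adj u w then 1 else 0) = (\<Sum>w\<in>X. if adj u w then 1 else (0::nat))"
      using assms(4) by (intro sum.mono_neutral_cong_right) auto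
    then show ?thesis by (simp add: between_single adj_sym[of u])
  qed
  show ?thesis
    unfolding degree_com_def
    apply (rule halts_mono)
     apply (rule halts_For[where lo = 0 and hi = n and T = "\<lambda>u. 4 + (if u \<in> Y then 2 + 4 * n else 0)" and
      I = "\<lambda>k s'. frame {6, 7, 22} {20} s s' \<and> fst s' 6 = k \<and>
        (\<forall>u<k. snd s' 20 u = (if u \<in> Y then between X {u} else 0))"])
  proof (goal_cases)
    case (5 k s')
    have fr: "frame {6, 7, 22} {20} s s'" using 5 by simp
    have r: "ready s'" "chi 17 Y s'" "chi 18 X s'" using ready_frame[OF _ fr] chi_frame[OF _ fr] assms by simp_all
    show ?case
    proof (cases "k \<in> Y")
      case True
      show ?thesis
        unfolding halts_Seq halts_Assign halts_Cond using True r(2) 5 apply (simp add: chi_def)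
        apply (rule halts_sum_loop[where n = n and P = "\<lambda>w. w \<in> X \<and> adj k w" and f = "\<lambda>_. 1"])
        using 5 r True eq[of k] by (auto simp: ready_def chi_def frame_def less_Suc_eq)
    next
      case False
      then show ?thesis using 5 r by (auto simp: chi_def halts_Seq less_Suc_eq)
    qed
  next
    case (6 t s')
    have "{0..<n} \<inter> Y = Y" using assms(5) by auto
    then have "(\<Sum>u=0..<n. 4 + (if u \<in> Y then 2 + 4 * n else 0) + 2) = 6 * n + card Y * (2 + 4 * n)"
      by (simp add: sum.distrib sum.If_cases)
    then have "t \<le> 2 + 6 * n + 2 * card Y + 4 * (n * card Y)" using 6 by (simp add: algebra_simps)
    moreover have "1 * card Y \<le> n * card Y" using n by (intro mult_le_mono1) simp
    ultimately have "t \<le> 8 * n + 6 * n * card Y" using n unfolding mult.assoc by linarith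
    then show ?case using 6 by (intro assms(6)) auto
  qed (use s0 in \<open>auto simp: frame_def\<close>)
qed

end

section \<open>Tables\<close>

text \<open>
  The entries of all tables lie consecutively in arrays 10 (cut) and 11 (mask); register 11 is the
  first free position. The tables of the subexpressions under evaluation form a stack of height
  register 10; arrays 7, 8, 9 hold the mask of the vertex set, the first entry and the end of each
  table. Register 9 is the mask of \<open>S\<close> and register 8 its cut.

  The table under construction starts at register 19. Array 13 holds the keys of its entries and
  array 14 maps keys to entries. Array 14 is never cleared: its answer \<open>p\<close> for a key is trusted only if
  \<open>p\<close> lies in the current table and array 13 confirms the key.
\<close>

definition insert_com :: com where
  "insert_com =
     Assign 23 (Load 14 (Reg 20)) ;;
     Cond (Conj (Le (Reg 19) (Reg 23)) (Conj (Less (Reg 23) (Reg 11)) (Equal (Load 13 (Reg 23)) (Reg 20))))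
       (If1 (Less (Reg 21) (Load 10 (Reg 23)))
         (Store 10 (Reg 23) (Reg 21) ;; Store 11 (Reg 23) (Reg 28)))
       (Store 14 (Reg 20) (Reg 11) ;; Store 13 (Reg 11) (Reg 20) ;; Store 10 (Reg 11) (Reg 21) ;;
        Store 11 (Reg 11) (Reg 28) ;; Assign 11 (Plus (Reg 11) (Num 1)))"

definition pair_com :: com where
  "pair_com =
     Assign 28 (Plus (Load 11 (Reg 17)) (Load 11 (Reg 18))) ;;
     Assign 4 (Reg 28) ;;
     decode 15 ;;
     Assign 20 (Num 0) ;;
     Assign 22 (Num 0) ;;
     For 6 (Num 0) (Reg 0)
       (If1 (Equal (Load 15 (Reg 6)) (Num 1)) (Assign 20 (Plus (Reg 20) (Load 19 (Reg 6))))) ;;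
     For 6 (Num 0) (Reg 0)
       (If1 (Equal (Load 15 (Reg 6)) (Num 1)) (Assign 22 (Plus (Reg 22) (Load 20 (Reg 6))))) ;;
     Assign 21 (Minus (Plus (Load 10 (Reg 17)) (Load 10 (Reg 18))) (Plus (Reg 8) (Plus (Reg 22) (Reg 22)))) ;;
     insert_com"

definition pairs_com :: com where
  "pairs_com =
     For 17 (Load 8 (Reg 10)) (Load 9 (Reg 10))
       (Assign 4 (Load 11 (Reg 17)) ;;
        decode 18 ;;
        degree_com ;;
        For 18 (Load 8 (Plus (Reg 10) (Num 1))) (Load 9 (Plus (Reg 10) (Num 1))) pair_com)"

definition union_com :: com where
  "union_com =
     Assign 10 (Minus (Reg 10) (Num 2)) ;;
     Assign 27 (Plus (Load 7 (Reg 10)) (Load 7 (Plus (Reg 10) (Num 1)))) ;;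
     Assign 4 (Reg 27) ;;
     decode 16 ;;
     Assign 4 (Load 7 (Plus (Reg 10) (Num 1))) ;;
     decode 17 ;;
     weight_com ;;
     Assign 19 (Reg 11) ;;
     pairs_com ;;
     Store 7 (Reg 10) (Reg 27) ;;
     Store 8 (Reg 10) (Reg 19) ;;
     Store 9 (Reg 10) (Reg 11) ;;
     Assign 10 (Plus (Reg 10) (Num 1))"

definition leaf_com :: com where
  "leaf_com =
     Assign 28 (Load 4 (Minus (Reg 16) (Num 1))) ;;
     Assign 4 (Plus (Reg 9) (Reg 28)) ;;
     decode 15 ;;
     cut_com ;;
     Store 10 (Reg 11) (Reg 8) ;;
     Store 11 (Reg 11) (Num 0) ;;
     Store 10 (Plus (Reg 11) (Num 1)) (Reg 5) ;;
     Store 11 (Plus (Reg 11) (Num 1)) (Reg 28) ;;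
     Store 7 (Reg 10) (Reg 28) ;;
     Store 8 (Reg 10) (Reg 11) ;;
     Assign 11 (Plus (Reg 11) (Num 2)) ;;
     Store 9 (Reg 10) (Reg 11) ;;
     Assign 10 (Plus (Reg 10) (Num 1))"

locale dp = cut_graph n adj D for n adj D +
  fixes q :: nat and S :: "nat set"
  assumes S: "S \<subseteq> D" and D: "D \<subseteq> {..<n}" and q: "1 \<le> q"
begin

definition table :: "nat set \<Rightarrow> state \<Rightarrow> nat \<Rightarrow> nat \<Rightarrow> bool" where
  "table W s lo hi \<longleftrightarrow> lo < hi \<and> hi - lo \<le> 2 * card W ^ q \<and>
     (\<forall>p. lo \<le> p \<and> p < hi \<longrightarrow> set_decode (snd s 11 p) \<subseteq> W \<and>
        snd s 10 p = cut (S \<union> set_decode (snd s 11 p))) \<and>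
     (\<forall>A\<subseteq>W. \<exists>p. lo \<le> p \<and> p < hi \<and> sim W (set_decode (snd s 11 p)) A \<and> snd s 10 p \<le> cut (S \<union> A))"

definition building :: "nat set \<Rightarrow> nat \<Rightarrow> nat set set \<Rightarrow> state \<Rightarrow> bool" where
  "building W lo F s \<longleftrightarrow> lo \<le> fst s 11 \<and>
     (\<forall>p. lo \<le> p \<and> p < fst s 11 \<longrightarrow> set_decode (snd s 11 p) \<subseteq> W \<and>
        snd s 10 p = cut (S \<union> set_decode (snd s 11 p)) \<and>
        snd s 13 p = key W (set_decode (snd s 11 p)) \<and> snd s 14 (snd s 13 p) = p) \<and>
     (\<forall>A\<in>F. \<exists>p. lo \<le> p \<and> p < fst s 11 \<and> snd s 13 p = key W A \<and> snd s 10 p \<le> cut (S \<union> A))"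

definition keeps :: "nat \<Rightarrow> state \<Rightarrow> state \<Rightarrow> bool" where
  "keeps b s s' \<longleftrightarrow> (\<forall>p<b. snd s' 10 p = snd s 10 p \<and> snd s' 11 p = snd s 11 p)"

lemma keeps_frame: "frame R M s s' \<Longrightarrow> 10 \<notin> M \<Longrightarrow> 11 \<notin> M \<Longrightarrow> keeps b s s'"
  by (simp add: keeps_def frame_def)

lemma keeps_trans: "keeps b s s' \<Longrightarrow> keeps b' s' s'' \<Longrightarrow> b \<le> b' \<Longrightarrow> keeps b s s''"
  by (simp add: keeps_def)

lemma building_frame:
  assumes "building W lo F s" "frame R M s s'" "11 \<notin> R" "{10, 11, 13, 14} \<inter> M = {}"
  shows "building W lo F s'"
proof -
  have eqs: "fst s' 11 = fst s 11" "snd s' 10 = snd s 10" "snd s' 11 = snd s 11"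
      "snd s' 13 = snd s 13" "snd s' 14 = snd s 14"
    using assms(2-4) by (simp_all add: frame_def)
  from assms(1) show ?thesis unfolding building_def eqs .
qed

lemma building_insert: "building W lo F s \<Longrightarrow> lo \<le> p \<Longrightarrow> p < fst s 11 \<Longrightarrow> snd s 13 p = key W A \<Longrightarrow>
    snd s 10 p \<le> cut (S \<union> A) \<Longrightarrow> building W lo (insert A F) s"
  unfolding building_def by blast

lemma table_keeps:
  assumes "table W s lo hi" "keeps b s s'" "hi \<le> b"
  shows "table W s' lo hi"
proof -
  have "snd s' 10 p = snd s 10 p \<and> snd s' 11 p = snd s 11 p" if "lo \<le> p \<and> p < hi" for p
    using assms(2,3) that by (simp add: keeps_def)
  then have eqs: "(\<forall>p. lo \<le> p \<and> p < hi \<longrightarrow> set_decode (snd s' 11 p) \<subseteq> W \<and>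
      snd s' 10 p = cut (S \<union> set_decode (snd s' 11 p))) \<longleftrightarrow>
    (\<forall>p. lo \<le> p \<and> p < hi \<longrightarrow> set_decode (snd s 11 p) \<subseteq> W \<and>
      snd s 10 p = cut (S \<union> set_decode (snd s 11 p)))"
    "(\<exists>p. lo \<le> p \<and> p < hi \<and> sim W (set_decode (snd s' 11 p)) A \<and> snd s' 10 p \<le> cut (S \<union> A)) \<longleftrightarrow>
    (\<exists>p. lo \<le> p \<and> p < hi \<and> sim W (set_decode (snd s 11 p)) A \<and> snd s 10 p \<le> cut (S \<union> A))" for A
    by metis+
  from assms(1) show ?thesis unfolding table_def eqs .
qed

lemma halts_insert:
  assumes B: "building W lo F s" and r: "fst s 19 = lo" "fst s 20 = key W A" "fst s 21 = cut (S \<union> A)"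
      "fst s 28 = set_encode A" "A \<subseteq> W" "finite A"
    and Q: "\<And>t s'. t \<le> 7 \<Longrightarrow> building W lo (insert A F) s' \<Longrightarrow> keeps lo s s' \<Longrightarrow>
      frame {11, 23} {10, 11, 13, 14} s s' \<Longrightarrow> Q t s'"
  shows "halts insert_com Q s"
proof -
  define p where "p = snd s 14 (key W A)"
  have le: "lo \<le> fst s 11" using B unfolding building_def by blast
  have entry: "set_decode (snd s 11 p') \<subseteq> W" "snd s 10 p' = cut (S \<union> set_decode (snd s 11 p'))"
      "snd s 13 p' = key W (set_decode (snd s 11 p'))" "snd s 14 (key W (set_decode (snd s 11 p'))) = p'"
    if "lo \<le> p'" "p' < fst s 11" for p'
    using B that unfolding building_def by metis+
  have cover: "\<exists>p'. lo \<le> p' \<and> p' < fst s 11 \<and> snd s 13 p' = key W A' \<and> snd s 10 p' \<le> cut (S \<union> A')"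
    if "A' \<in> F" for A' using B that unfolding building_def by metis
  show ?thesis
  proof (cases "lo \<le> p \<and> p < fst s 11 \<and> snd s 13 p = key W A")
    case True
    then have p: "lo \<le> p" "p < fst s 11" "snd s 13 p = key W A" by simp_all
    have same_key: "key W (set_decode (snd s 11 p)) = key W A"
      using entry(3)[OF p(1,2), symmetric] p(3) by (rule trans)
    show ?thesis
    proof (cases "cut (S \<union> A) < snd s 10 p")
      case less: True
      let ?s = "((fst s)(23 := p), (snd s)(10 := (snd s 10)(p := cut (S \<union> A)),
        11 := (snd s 11)(p := set_encode A)))"
      have "Q (Suc (Suc (Suc (Suc (Suc 0))))) ?s"
      proof (rule Q)
        show "building W lo (insert A F) ?s"
          unfolding building_def
        proof (intro conjI ballI)
          show "\<forall>p'. lo \<le> p' \<and> p' < fst ?s 11 \<longrightarrow> set_decode (snd ?s 11 p') \<subseteq> W \<and>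
              snd ?s 10 p' = cut (S \<union> set_decode (snd ?s 11 p')) \<and>
              snd ?s 13 p' = key W (set_decode (snd ?s 11 p')) \<and> snd ?s 14 (snd ?s 13 p') = p'"
            using True r(5,6) entry by (simp add: same_key flip: p_def)
          fix A' assume A': "A' \<in> insert A F"
          show "\<exists>p'. lo \<le> p' \<and> p' < fst ?s 11 \<and> snd ?s 13 p' = key W A' \<and> snd ?s 10 p' \<le> cut (S \<union> A')"
          proof (cases "A' = A")
            case False
            then obtain p' where "lo \<le> p'" "p' < fst s 11" "snd s 13 p' = key W A'" "snd s 10 p' \<le> cut (S \<union> A')"
              using cover A' by blast
            then show ?thesis using less by (intro exI[of _ p']) auto
          qed (use True in auto)
        qed (use le in simp)
      qed (use True in \<open>auto simp: keeps_def frame_def\<close>)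
      with True less r show ?thesis
        by (simp add: insert_com_def halts_Seq flip: p_def)
    next
      case False
      have "Q (Suc (Suc (Suc (Suc 0)))) ((fst s)(23 := p), snd s)"
      proof (rule Q)
        show "building W lo (insert A F) ((fst s)(23 := p), snd s)"
        proof (rule building_frame)
          show "building W lo (insert A F) s"
            using True False by (intro building_insert[OF B, of p]) simp_all
          show "frame {23} {} s ((fst s)(23 := p), snd s)" by (simp add: frame_def)
        qed simp_all
      qed (auto simp: keeps_def frame_def)
      with True False r show ?thesis
        by (simp add: insert_com_def halts_Seq flip: p_def)
    qed
  next
    case False
    have new: "snd s 13 p' \<noteq> key W A" if "lo \<le> p'" "p' < fst s 11" for p'
      using entry[OF that] that False by (auto simp: p_def)
    let ?s = "((fst s)(23 := p, 11 := Suc (fst s 11)),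
      (snd s)(14 := (snd s 14)(key W A := fst s 11), 13 := (snd s 13)(fst s 11 := key W A),
        10 := (snd s 10)(fst s 11 := cut (S \<union> A)), 11 := (snd s 11)(fst s 11 := set_encode A)))"
    have "Q (Suc (Suc (Suc (Suc (Suc (Suc (Suc 0))))))) ?s"
    proof (rule Q)
      show "building W lo (insert A F) ?s"
        unfolding building_def
      proof (intro conjI ballI)
        show "\<forall>p'. lo \<le> p' \<and> p' < fst ?s 11 \<longrightarrow> set_decode (snd ?s 11 p') \<subseteq> W \<and>
            snd ?s 10 p' = cut (S \<union> set_decode (snd ?s 11 p')) \<and>
            snd ?s 13 p' = key W (set_decode (snd ?s 11 p')) \<and> snd ?s 14 (snd ?s 13 p') = p'"
          using r(5,6) entry new by (simp add: less_Suc_eq)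
        fix A' assume A': "A' \<in> insert A F"
        show "\<exists>p'. lo \<le> p' \<and> p' < fst ?s 11 \<and> snd ?s 13 p' = key W A' \<and> snd ?s 10 p' \<le> cut (S \<union> A')"
        proof (cases "A' = A")
          case True
          then show ?thesis using le by (intro exI[of _ "fst s 11"]) simp
        next
          case False
          then obtain p' where "lo \<le> p'" "p' < fst s 11" "snd s 13 p' = key W A'" "snd s 10 p' \<le> cut (S \<union> A')"
            using cover A' by blast
          then show ?thesis by (intro exI[of _ p']) auto
        qed
      qed (use le in simp)
      show "keeps lo s ?s" using le by (auto simp: keeps_def)
      show "frame {11, 23} {10, 11, 13, 14} s ?s" by (simp add: frame_def)
    qed simp
    moreover have "\<not> (lo \<le> p \<and> p < fst s 11 \<and> snd s 13 p = key W A)" by fact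
    ultimately show ?thesis using r
      by (auto simp: insert_com_def halts_Seq simp flip: p_def)
  qed
qed

lemma sum_if_mem: "X \<subseteq> {..<n} \<Longrightarrow> (\<Sum>k<n. if k \<in> X then f k else 0) = (\<Sum>k\<in>X. f k)" for f :: "nat \<Rightarrow> nat"
  by (simp add: Int_absorb1 flip: sum.inter_restrict)

lemma halts_pair:
  assumes s: "ready s" and W: "W1 \<subseteq> U" "W2 \<subseteq> U" "W1 \<inter> W2 = {}" and xy: "x \<subseteq> W1" "y \<subseteq> W2"
    and mem: "snd s 11 (fst s 17) = set_encode x" "snd s 11 (fst s 18) = set_encode y"
      "snd s 10 (fst s 17) = cut (S \<union> x)" "snd s 10 (fst s 18) = cut (S \<union> y)" "fst s 8 = cut S"
    and wt: "\<forall>u<n. snd s 19 u = weight (W1 \<union> W2) u"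
    and dg: "\<forall>u<n. snd s 20 u = (if u \<in> W2 then between x {u} else 0)"
    and B: "building (W1 \<union> W2) (fst s 19) F s"
    and Q: "\<And>t s'. t \<le> 32 * n \<Longrightarrow> building (W1 \<union> W2) (fst s 19) (insert (x \<union> y) F) s' \<Longrightarrow> keeps (fst s 19) s s' \<Longrightarrow>
      frame {3, 4, 6, 11, 20, 21, 22, 23, 28} {10, 11, 13, 14, 15} s s' \<Longrightarrow> Q t s'"
  shows "halts pair_com Q s"
proof -
  have n: "0 < n" using s by (simp add: ready_def)
  have Un: "U \<subseteq> {..<n}" by (auto simp: U_def)
  have sub: "x \<subseteq> {..<n}" "y \<subseteq> {..<n}" "x \<union> y \<subseteq> {..<n}" "S \<subseteq> {..<n}" using xy W Un S D by auto
  have fin: "finite x" "finite y" using sub finite_subset by blast+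
  have disj: "x \<inter> y = {}" "S \<inter> x = {}" "S \<inter> y = {}" using xy W S by (auto simp: U_def)
  have enc: "set_encode (x \<union> y) = set_encode x + set_encode y"
    using set_encode_Un[OF fin disj(1)] .
  have key: "(\<Sum>k<n. if k \<in> x \<union> y then weight (W1 \<union> W2) k else 0) = key (W1 \<union> W2) (x \<union> y)"
    unfolding key_def using sub(3) by (rule sum_if_mem)
  have deg: "(\<Sum>k<n. if k \<in> x \<union> y then if k \<in> W2 then between x {k} else 0 else 0) = between x y"
  proof -
    have "(\<Sum>k<n. if k \<in> x \<union> y then if k \<in> W2 then between x {k} else 0 else 0)
        = (\<Sum>k<n. if k \<in> y then between x {k} else 0)"
      using xy W by (intro sum.cong) auto
    also have "\<dots> = (\<Sum>k\<in>y. between x {k})" using sub(2) by (rule sum_if_mem)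
    finally show ?thesis by (simp add: between_singletons[of x y])
  qed
  have cost: "cut (S \<union> x) + cut (S \<union> y) - (cut S + (between x y + between x y)) = cut (S \<union> (x \<union> y))"
    using cut_union[OF sub(4,1,2) disj(2,3,1)] by (simp add: Un_assoc)
  let ?s0 = "((fst s)(28 := set_encode (x \<union> y), 4 := set_encode (x \<union> y)), snd s)"
  have r0: "ready ?s0" using s by (rule ready_frame[where R = "{4, 28}" and M = "{}"]) (auto simp: frame_def)
  show ?thesis
    unfolding pair_com_def halts_Seq halts_Assign
    apply (simp only: aval.simps mem enc[symmetric] fst_conv snd_conv fun_upd_same)
  proof (rule halts_decode[where A = "x \<union> y"], goal_cases)
    case 1
    then show ?case using r0 .
  next
    case (5 t1 s1)
    let ?s1 = "((fst s1)(20 := 0, 22 := 0), snd s1)"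
    have fr1: "frame {3, 4, 20, 22, 28} {15} s ?s1" using 5(3) by (simp add: frame_def)
    have s1: "ready ?s1" "chi 15 (x \<union> y) ?s1" using ready_frame[OF s fr1] 5(2) by (simp_all add: chi_def)
    have wt1: "\<forall>u<n. snd s1 19 u = weight (W1 \<union> W2) u"
        "\<forall>u<n. snd s1 20 u = (if u \<in> W2 then between x {u} else 0)"
      using wt dg frame_arr[OF fr1, of 19] frame_arr[OF fr1, of 20] by simp_all
    show ?case
    proof (rule halts_sum_loop[where n = n and P = "\<lambda>k. k \<in> x \<union> y" and f = "weight (W1 \<union> W2)"], goal_cases)
      case (5 k s')
      then show ?case using s1(2) wt1(1) by (simp add: chi_def frame_def)
    next
      case (6 t2 s2)
      have fr2: "frame {3, 4, 6, 20, 22, 28} {15} s s2" using fr1 6(2) by (rule frame_trans) auto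
      have s2: "snd s2 15 = snd s1 15" "snd s2 20 = snd s1 20" "fst s2 0 = n" "fst s2 22 = 0"
          "fst s2 20 = key (W1 \<union> W2) (x \<union> y)"
        using 6(2,3) s1(1) key by (simp_all add: frame_def ready_def)
      show ?case
      proof (rule halts_sum_loop[where n = n and P = "\<lambda>k. k \<in> x \<union> y" and
            f = "\<lambda>k. if k \<in> W2 then between x {k} else 0"], goal_cases)
        case (5 k s')
        then show ?case using s1(2) s2(1,2) wt1(2) by (simp add: chi_def frame_def)
      next
        case (6 t3 s3)
        have fr3: "frame {3, 4, 6, 20, 22, 28} {15} s s3" using fr2 6(2) by (rule frame_trans) auto
        have s3: "fst s3 22 = between x y" "fst s3 20 = key (W1 \<union> W2) (x \<union> y)"
          using 6 s2 deg by (simp_all add: frame_def)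
        have s3': "fst s3 28 = set_encode (x \<union> y)"
          using 5(3) \<open>frame {6, 20} {} _ s2\<close> 6(2) by (simp add: frame_def)
        have mem3: "snd s3 10 (fst s3 17) = cut (S \<union> x)" "snd s3 10 (fst s3 18) = cut (S \<union> y)" "fst s3 8 = cut S"
          using mem fr3 by (simp_all add: frame_def)
        let ?s4 = "((fst s3)(21 := cut (S \<union> (x \<union> y))), snd s3)"
        have fr4: "frame {3, 4, 6, 20, 21, 22, 28} {15} s ?s4" using fr3 by (simp add: frame_def)
        have B4: "building (W1 \<union> W2) (fst s 19) F ?s4"
          using B fr4 by (rule building_frame) auto
        have "halts insert_com (\<lambda>t'. Q (1 + (1 + (t1 + (1 + (1 + (t2 + (t3 + (1 + t'))))))))) ?s4"
        proof (rule halts_insert[OF B4, of "x \<union> y"], goal_cases)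
          case (7 t5 s5)
          show ?case
          proof (rule Q)
            show "1 + (1 + (t1 + (1 + (1 + (t2 + (t3 + (1 + t5))))))) \<le> 32 * n"
              using 5(1) \<open>t2 \<le> _\<close> 6(1) 7(1) n by linarith
            show "keeps (fst s 19) s s5"
              by (rule keeps_trans[OF keeps_frame[OF fr4] 7(3)]) auto
            show "frame {3, 4, 6, 11, 20, 21, 22, 23, 28} {10, 11, 13, 14, 15} s s5"
              using fr4 7(4) by (rule frame_trans) auto
          qed (use 7 in simp)
        qed (use fr4 s3 s3' xy fin in \<open>auto simp: frame_def\<close>)
        then show ?case by (simp only: aval.simps mem3 s3 cost)
      qed (use s2 in auto)
    qed (use s1 in \<open>auto simp: ready_def\<close>)
  qed (use sub in auto)
qed

lemma building_card:
  assumes B: "building W lo F s" and W: "labeling q W" "finite W" "W \<noteq> {}"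
  shows "fst s 11 - lo \<le> 2 * card W ^ q"
proof -
  have entry: "set_decode (snd s 11 p) \<subseteq> W" "snd s 13 p = key W (set_decode (snd s 11 p))" "snd s 14 (snd s 13 p) = p"
    if "p \<in> {lo..<fst s 11}" for p
    using B that unfolding building_def atLeastLessThan_iff by blast+
  have "inj_on (snd s 13) {lo..<fst s 11}"
    by (rule inj_on_inverseI[of _ "snd s 14"]) (rule entry(3))
  then have "fst s 11 - lo = card (snd s 13 ` {lo..<fst s 11})"
    by (simp add: card_image)
  also have "\<dots> \<le> card (key W ` Pow W)"
  proof (rule card_mono)
    show "snd s 13 ` {lo..<fst s 11} \<subseteq> key W ` Pow W"
    proof (rule image_subsetI)
      fix p assume p: "p \<in> {lo..<fst s 11}"
      show "snd s 13 p \<in> key W ` Pow W"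
        unfolding entry(2)[OF p] using entry(1)[OF p] by (intro imageI PowI)
    qed
  qed (use W(2) in simp)
  also have "\<dots> \<le> 2 * card W ^ q" by (rule card_keys[OF W])
  finally show ?thesis .
qed

definition pairs :: "state \<Rightarrow> (nat \<times> nat) set \<Rightarrow> nat set set" where
  "pairs s P = (\<lambda>(p, p'). set_decode (snd s 11 p) \<union> set_decode (snd s 11 p')) ` P"

lemma building_table:
  assumes B: "building (W1 \<union> W2) lo (pairs s0 ({lo1..<hi1} \<times> {lo2..<hi2})) s"
    and T: "table W1 s0 lo1 hi1" "table W2 s0 lo2 hi2"
    and W: "W1 \<subseteq> U" "W2 \<subseteq> U" "W1 \<inter> W2 = {}" "W1 \<noteq> {}" "labeling q (W1 \<union> W2)"
  shows "table (W1 \<union> W2) s lo (fst s 11)"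
proof -
  let ?W = "W1 \<union> W2"
  have entry: "set_decode (snd s 11 p) \<subseteq> ?W" "snd s 10 p = cut (S \<union> set_decode (snd s 11 p))"
      "snd s 13 p = key ?W (set_decode (snd s 11 p))" if "lo \<le> p" "p < fst s 11" for p
    using B that unfolding building_def by blast+
  have T1: "set_decode (snd s0 11 p) \<subseteq> W1" "snd s0 10 p = cut (S \<union> set_decode (snd s0 11 p))"
    if "lo1 \<le> p" "p < hi1" for p using T(1) that unfolding table_def by blast+
  have T2: "set_decode (snd s0 11 p) \<subseteq> W2" "snd s0 10 p = cut (S \<union> set_decode (snd s0 11 p))"
    if "lo2 \<le> p" "p < hi2" for p using T(2) that unfolding table_def by blast+
  have Un: "W1 \<subseteq> {..<n}" "W2 \<subseteq> {..<n}" using W by (auto simp: U_def)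
  have cover: "\<exists>p. lo \<le> p \<and> p < fst s 11 \<and> sim ?W (set_decode (snd s 11 p)) A \<and> snd s 10 p \<le> cut (S \<union> A)"
    if A: "A \<subseteq> ?W" for A
  proof -
    have A12: "A \<inter> W1 \<union> A \<inter> W2 = A" using A by blast
    obtain p1 where p1: "lo1 \<le> p1" "p1 < hi1" "sim W1 (set_decode (snd s0 11 p1)) (A \<inter> W1)"
        "snd s0 10 p1 \<le> cut (S \<union> (A \<inter> W1))"
      using T(1) unfolding table_def by (meson inf_le2)
    obtain p2 where p2: "lo2 \<le> p2" "p2 < hi2" "sim W2 (set_decode (snd s0 11 p2)) (A \<inter> W2)"
        "snd s0 10 p2 \<le> cut (S \<union> (A \<inter> W2))"
      using T(2) unfolding table_def by (meson inf_le2)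
    define x where "x = set_decode (snd s0 11 p1)"
    define y where "y = set_decode (snd s0 11 p2)"
    have xy: "x \<subseteq> W1" "y \<subseteq> W2" using T1(1) T2(1) p1 p2 by (auto simp: x_def y_def)
    have "x \<union> y \<in> pairs s0 ({lo1..<hi1} \<times> {lo2..<hi2})"
      using p1 p2 unfolding pairs_def x_def y_def by force
    then obtain p where p: "lo \<le> p" "p < fst s 11" "snd s 13 p = key ?W (x \<union> y)" "snd s 10 p \<le> cut (S \<union> (x \<union> y))"
      using B unfolding building_def by blast
    have "sim ?W (set_decode (snd s 11 p)) (x \<union> y)"
    proof (rule key_eq_sim)
      show "key ?W (set_decode (snd s 11 p)) = key ?W (x \<union> y)"
        using entry(3)[OF p(1,2)] p(3) by (rule subst)
      show "set_decode (snd s 11 p) \<subseteq> {..<n}" using entry(1)[OF p(1,2)] Un by blast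
      show "x \<union> y \<subseteq> {..<n}" using xy Un by blast
    qed
    moreover have "sim ?W (x \<union> y) A"
      using sim_union[OF p1(3) p2(3)] xy W(1-3) A12 by (simp add: x_def y_def)
    ultimately have "sim ?W (set_decode (snd s 11 p)) A" by (rule sim_trans)
    moreover have "snd s 10 p \<le> cut (S \<union> A)"
    proof -
      have x: "sim W1 x (A \<inter> W1)" "cut (S \<union> x) \<le> cut (S \<union> (A \<inter> W1))"
        using p1(3,4) T1(2)[OF p1(1,2)] by (simp_all add: x_def)
      have y: "sim W2 y (A \<inter> W2)" "cut (S \<union> y) \<le> cut (S \<union> (A \<inter> W2))"
        using p2(3,4) T2(2)[OF p2(1,2)] by (simp_all add: y_def)
      have "cut (S \<union> (x \<union> y)) \<le> cut (S \<union> (A \<inter> W1) \<union> y)"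
        unfolding Un_assoc[symmetric]
        by (rule cut_exchange[OF x(1) xy(1) _ W(1) _ S D x(2)]) (use xy W in auto)
      also have "S \<union> (A \<inter> W1) \<union> y = S \<union> y \<union> (A \<inter> W1)" by blast
      also have "cut (S \<union> y \<union> (A \<inter> W1)) \<le> cut (S \<union> (A \<inter> W2) \<union> (A \<inter> W1))"
        by (rule cut_exchange[OF y(1) xy(2) _ W(2) _ S D y(2)]) (use W in auto)
      also have "S \<union> (A \<inter> W2) \<union> (A \<inter> W1) = S \<union> A" using A by blast
      finally show ?thesis using p(4) by linarith
    qed
    ultimately show ?thesis using p(1,2) by blast
  qed
  have "lo < fst s 11" using cover[of "{}"] by auto
  moreover have "fst s 11 - lo \<le> 2 * card ?W ^ q"
    using building_card[OF B W(5)] W(1,2,4) U_finite by simp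
  ultimately show ?thesis
    unfolding table_def using entry(1,2) cover by blast
qed

definition stack :: "nat set list \<Rightarrow> state \<Rightarrow> bool" where
  "stack Ws s \<longleftrightarrow> fst s 10 = length Ws \<and> (\<forall>i<length Ws. snd s 7 i = set_encode (Ws ! i) \<and> Ws ! i \<subseteq> U \<and>
     table (Ws ! i) s (snd s 8 i) (snd s 9 i) \<and> snd s 9 i \<le> fst s 11)"

lemma stack_top:
  assumes "stack (Ws @ [W1, W2]) s"
  shows "fst s 10 = length Ws + 2"
    "snd s 7 (length Ws) = set_encode W1" "snd s 7 (Suc (length Ws)) = set_encode W2"
    "W1 \<subseteq> U" "W2 \<subseteq> U"
    "table W1 s (snd s 8 (length Ws)) (snd s 9 (length Ws))"
    "table W2 s (snd s 8 (Suc (length Ws))) (snd s 9 (Suc (length Ws)))"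
    "snd s 9 (length Ws) \<le> fst s 11" "snd s 9 (Suc (length Ws)) \<le> fst s 11"
proof -
  have top: "fst s 10 = length Ws + 2"
    and elem: "\<And>i. i < length Ws + 2 \<Longrightarrow> snd s 7 i = set_encode ((Ws @ [W1, W2]) ! i) \<and>
      (Ws @ [W1, W2]) ! i \<subseteq> U \<and> table ((Ws @ [W1, W2]) ! i) s (snd s 8 i) (snd s 9 i) \<and> snd s 9 i \<le> fst s 11"
    using assms unfolding stack_def by simp_all
  show "fst s 10 = length Ws + 2"
    "snd s 7 (length Ws) = set_encode W1" "snd s 7 (Suc (length Ws)) = set_encode W2"
    "W1 \<subseteq> U" "W2 \<subseteq> U"
    "table W1 s (snd s 8 (length Ws)) (snd s 9 (length Ws))"
    "table W2 s (snd s 8 (Suc (length Ws))) (snd s 9 (Suc (length Ws)))"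
    "snd s 9 (length Ws) \<le> fst s 11" "snd s 9 (Suc (length Ws)) \<le> fst s 11"
    using top elem[of "length Ws"] elem[of "Suc (length Ws)"] by (simp_all add: nth_append)
qed

lemma stack_push:
  assumes "stack (Ws @ Vs) s" "W \<subseteq> U" "keeps (fst s 11) s s'" "fst s' 10 = Suc (length Ws)"
    "snd s' 7 = (snd s 7)(length Ws := set_encode W)" "snd s' 8 = (snd s 8)(length Ws := lo)"
    "snd s' 9 = (snd s 9)(length Ws := fst s' 11)" "table W s' lo (fst s' 11)" "fst s 11 \<le> fst s' 11"
  shows "stack (Ws @ [W]) s'"
  unfolding stack_def
proof (intro conjI allI impI)
  fix i assume "i < length (Ws @ [W])"
  then consider "i = length Ws" | "i < length Ws" by fastforce
  then have "snd s' 7 i = set_encode ((Ws @ [W]) ! i) \<and> (Ws @ [W]) ! i \<subseteq> U \<and>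
      table ((Ws @ [W]) ! i) s' (snd s' 8 i) (snd s' 9 i) \<and> snd s' 9 i \<le> fst s' 11"
  proof cases
    case 2
    have "(Ws @ Vs) ! i = Ws ! i" using 2 by (simp add: nth_append)
    then have i: "snd s 7 i = set_encode (Ws ! i)" "Ws ! i \<subseteq> U" "table (Ws ! i) s (snd s 8 i) (snd s 9 i)" "snd s 9 i \<le> fst s 11"
      using assms(1) 2 unfolding stack_def by (metis length_append trans_less_add1)+
    then show ?thesis
      using table_keeps[OF i(3) assms(3) i(4)] 2 assms(5-7,9) by (simp add: nth_append)
  qed (use assms in simp)
  then show "snd s' 7 i = set_encode ((Ws @ [W]) ! i)" "(Ws @ [W]) ! i \<subseteq> U"
      "table ((Ws @ [W]) ! i) s' (snd s' 8 i) (snd s' 9 i)" "snd s' 9 i \<le> fst s' 11"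
    by blast+
qed (use assms in simp)

lemma pairs_insert: "pairs s (insert (p, p') P) = insert (set_decode (snd s 11 p) \<union> set_decode (snd s 11 p')) (pairs s P)"
  by (simp add: pairs_def)

lemma halts_pairs:
  assumes s: "ready s" and W: "W1 \<subseteq> U" "W2 \<subseteq> U" "W1 \<inter> W2 = {}" "W1 \<noteq> {}" "W2 \<noteq> {}"
    and c17: "chi 17 W2 s" and wt: "\<forall>u<n. snd s 19 u = weight (W1 \<union> W2) u"
    and r: "fst s 8 = cut S" "fst s 10 = k" "fst s 19 = b" "fst s 11 = b"
    and T: "table W1 s (snd s 8 k) (snd s 9 k)" "table W2 s (snd s 8 (Suc k)) (snd s 9 (Suc k))"
    and hi: "snd s 9 k \<le> b" "snd s 9 (Suc k) \<le> b"
    and Q: "\<And>t s'. t \<le> 190 * (n * (card W1 ^ q * card W2 ^ q)) \<Longrightarrow>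
      building (W1 \<union> W2) b (pairs s ({snd s 8 k..<snd s 9 k} \<times> {snd s 8 (Suc k)..<snd s 9 (Suc k)})) s' \<Longrightarrow>
      keeps b s s' \<Longrightarrow> frame {3, 4, 6, 7, 11, 17, 18, 20, 21, 22, 23, 28} {10, 11, 13, 14, 15, 18, 20} s s' \<Longrightarrow> Q t s'"
  shows "halts pairs_com Q s"
proof -
  let ?lo1 = "snd s 8 k" and ?hi1 = "snd s 9 k" and ?lo2 = "snd s 8 (Suc k)" and ?hi2 = "snd s 9 (Suc k)"
  let ?R = "{3, 4, 6, 7, 11, 17, 18, 20, 21, 22, 23, 28} :: nat set" and ?M = "{10, 11, 13, 14, 15, 18, 20} :: nat set"
  let ?X = "\<lambda>p. set_decode (snd s 11 p)"
  let ?H = "{?lo2..<?hi2}"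
  have n: "0 < n" using s by (simp add: ready_def)
  have Un: "W1 \<subseteq> {..<n}" "W2 \<subseteq> {..<n}" using W by (auto simp: U_def)
  have fin: "finite W1" "finite W2" using W U_finite by blast+
  have sizes: "?lo1 < ?hi1" "?hi1 - ?lo1 \<le> 2 * card W1 ^ q" "?lo2 < ?hi2" "?hi2 - ?lo2 \<le> 2 * card W2 ^ q"
    using T unfolding table_def by blast+
  have X1: "?X p \<subseteq> W1" "snd s 10 p = cut (S \<union> ?X p)" if "?lo1 \<le> p" "p < ?hi1" for p
    using T(1) that unfolding table_def by blast+
  have X2: "?X p \<subseteq> W2" "snd s 10 p = cut (S \<union> ?X p)" if "?lo2 \<le> p" "p < ?hi2" for p
    using T(2) that unfolding table_def by blast+
  have c2: "1 \<le> card W2" "card W2 \<le> card W2 ^ q" "1 \<le> card W2 ^ q" "1 \<le> card W1 ^ q"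
    using fin W(4,5) q by (auto simp: Suc_le_eq card_gt_0_iff intro!: self_le_power)
  show ?thesis
    unfolding pairs_com_def
  proof (rule halts_For_const[where lo = ?lo1 and hi = ?hi1 and T = "92 * (n * card W2 ^ q)" and
      I = "\<lambda>p s'. frame ?R ?M s s' \<and> fst s' 17 = p \<and> keeps b s s' \<and>
        building (W1 \<union> W2) b (pairs s ({?lo1..<p} \<times> ?H)) s'"], goal_cases)
    case 3
    have "building (W1 \<union> W2) b (pairs s ({?lo1..<?lo1} \<times> ?H)) s"
      using r by (auto simp: building_def pairs_def)
    then have "building (W1 \<union> W2) b (pairs s ({?lo1..<?lo1} \<times> ?H)) ((fst s)(17 := ?lo1), snd s)"
      by (rule building_frame[where R = "{17}" and M = "{}"]) (auto simp: frame_def)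
    then show ?case by (simp add: frame_def keeps_def)
  next
    case (4 p s')
    then show ?case using r by (simp add: frame_def)
  next
    case (5 p s1)
    have fr1: "frame ?R ?M s s1" and r1: "fst s1 17 = p" and k1: "keeps b s s1"
      and B1: "building (W1 \<union> W2) b (pairs s ({?lo1..<p} \<times> ?H)) s1" using 5(1) by blast+
    have p: "?lo1 \<le> p" "p < ?hi1" "p < b" using 5(2,3) hi by auto
    define x where "x = ?X p"
    have x: "x \<subseteq> W1" "snd s1 11 p = set_encode x" "snd s1 10 p = cut (S \<union> x)"
      using X1[OF p(1,2)] k1 p(3) by (simp_all add: x_def keeps_def)
    have xn: "x \<subseteq> {..<n}" using x(1) Un by blast
    let ?s1 = "((fst s1)(4 := set_encode x), snd s1)"
    have fr1': "frame ?R ?M s ?s1" using fr1 by simp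
    show ?case
      unfolding halts_Seq halts_Assign
    proof (rule halts_decode[where A = x], goal_cases)
      case 1
      have "frame ?R ?M s ((fst s1)(4 := aval (Load 11 (Reg 17)) s1), snd s1)" using fr1 by simp
      with s show ?case by (rule ready_frame) auto
    next
      case (5 t2 s2)
      have fr12: "frame {3, 4} {18} s1 s2" using 5(3) by (simp add: frame_def)
      have fr2: "frame ?R ?M s s2" using fr1 fr12 by (rule frame_trans) auto
      show ?case
      proof (rule halts_degree[where Y = W2 and X = x], goal_cases)
        case 1
        show ?case using s fr2 by (rule ready_frame) auto
      next
        case 2
        show ?case using c17 fr2 by (rule chi_frame) auto
      next
        case (6 t3 s3)
        have fr13: "frame {3, 4, 6, 7, 22} {18, 20} s1 s3" using fr12 6(3) by (rule frame_trans) auto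
        have fr3: "frame ?R ?M s s3" using fr1 fr13 by (rule frame_trans) auto
        have k3: "keeps b s s3" by (rule keeps_trans[OF k1 keeps_frame[OF fr13]]) auto
        have B3: "building (W1 \<union> W2) b (pairs s ({?lo1..<p} \<times> ?H)) s3"
          using B1 fr13 by (rule building_frame) auto
        let ?P = "\<lambda>p'. {?lo1..<p} \<times> ?H \<union> {p} \<times> {?lo2..<p'}"
        show ?case
        proof (rule halts_For_const[where lo = ?lo2 and hi = ?hi2 and T = "32 * n" and
            I = "\<lambda>p' s'. frame {3, 4, 6, 11, 18, 21, 22, 23, 28, 20} {10, 11, 13, 14, 15} s3 s' \<and> fst s' 18 = p' \<and>
              keeps b s s' \<and> building (W1 \<union> W2) b (pairs s (?P p')) s'"], goal_cases)
          case 1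
          then show ?case using r fr3 by (simp add: frame_def)
        next
          case 3
          have "?P ?lo2 = {?lo1..<p} \<times> ?H" by simp
          then have "building (W1 \<union> W2) b (pairs s (?P ?lo2)) s3" using B3 by (simp only:)
          then have "building (W1 \<union> W2) b (pairs s (?P ?lo2)) ((fst s3)(18 := ?lo2), snd s3)"
            by (rule building_frame[where R = "{18}" and M = "{}"]) (auto simp: frame_def)
          then show ?case using k3 by (simp add: frame_def keeps_def)
        next
          case (4 p' s')
          then show ?case using r fr3 by (simp add: frame_def)
        next
          case (5 p' s4)
          have fr34: "frame {3, 4, 6, 11, 18, 21, 22, 23, 28, 20} {10, 11, 13, 14, 15} s3 s4" and r4: "fst s4 18 = p'"
            and k4: "keeps b s s4" and B4: "building (W1 \<union> W2) b (pairs s (?P p')) s4" using 5(1) by blast+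
          have fr4: "frame ?R ?M s s4" using fr3 fr34 by (rule frame_trans) auto
          have r4': "fst s4 17 = p" "fst s4 19 = b" "fst s4 8 = cut S"
            using r r1 frame_reg[OF fr34, of 17] frame_reg[OF fr13, of 17] frame_reg[OF fr4, of 19]
              frame_reg[OF fr4, of 8] by simp_all
          have a4: "snd s4 19 = snd s 19" "snd s4 20 = snd s3 20"
            using frame_arr[OF fr4, of 19] frame_arr[OF fr34, of 20] by simp_all
          have p': "?lo2 \<le> p'" "p' < ?hi2" "p' < b" using 5(2,3) hi by auto
          have mem: "snd s4 11 p = set_encode x" "snd s4 11 p' = set_encode (?X p')"
              "snd s4 10 p = cut (S \<union> x)" "snd s4 10 p' = cut (S \<union> ?X p')"
            using k4 X1[OF p(1,2)] X2[OF p'(1,2)] p(3) p'(3) by (simp_all add: keeps_def x_def)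
          have "?P (Suc p') = insert (p, p') (?P p')" using p'(1) by auto
          then have next_P: "insert (x \<union> ?X p') (pairs s (?P p')) = pairs s (?P (Suc p'))"
            by (simp only: pairs_insert x_def)
          show ?case
          proof (rule halts_pair[where F = "pairs s (?P p')", OF _ W(1,2,3) x(1) X2(1)[OF p'(1,2)]], goal_cases)
            case 1
            show ?case using s fr4 by (rule ready_frame) auto
          next
            case 9
            show ?case using B4 by (simp only: r4')
          next
            case (10 t5 s5)
            have fr5: "frame {3, 4, 6, 11, 20, 21, 22, 23, 28} {10, 11, 13, 14, 15} s4 s5" by fact
            have "building (W1 \<union> W2) b (pairs s (?P (Suc p'))) s5"
              using 10(2) unfolding r4' next_P .
            then have "building (W1 \<union> W2) b (pairs s (?P (Suc p'))) ((fst s5)(18 := Suc p'), snd s5)"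
              by (rule building_frame[where R = "{18}" and M = "{}"]) (auto simp: frame_def)
            moreover have "keeps b s s5" using keeps_trans[OF k4 10(3)] r4' by simp
            then have "keeps b s ((fst s5)(18 := Suc p'), snd s5)" by (simp add: keeps_def)
            moreover have "frame {3, 4, 6, 11, 18, 21, 22, 23, 28, 20} {10, 11, 13, 14, 15} s3 s5"
              using fr34 fr5 by (rule frame_trans) auto
            moreover have "fst s5 18 = p'" using frame_reg[OF fr5, of 18] r4 by simp
            ultimately show ?case using 10(1) by simp
          qed (use mem r4 r4' a4 wt 6(2) in simp_all)
        next
          case (6 t4 s4)
          have fr34: "frame {3, 4, 6, 11, 18, 21, 22, 23, 28, 20} {10, 11, 13, 14, 15} s3 s4"
            and k4: "keeps b s s4" and B4: "building (W1 \<union> W2) b (pairs s (?P ?hi2)) s4" using 6(2) by blast+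
          have fr4: "frame ?R ?M s s4" using fr3 fr34 by (rule frame_trans) auto
          have r4: "fst s4 17 = p"
            using r1 frame_reg[OF fr34, of 17] frame_reg[OF fr13, of 17] by simp
          have "?P ?hi2 = {?lo1..<Suc p} \<times> ?H" using p(1) by auto
          then have "building (W1 \<union> W2) b (pairs s ({?lo1..<Suc p} \<times> ?H)) s4" using B4 by (simp only:)
          then have B4': "building (W1 \<union> W2) b (pairs s ({?lo1..<Suc p} \<times> ?H)) ((fst s4)(17 := Suc p), snd s4)"
            by (rule building_frame[where R = "{17}" and M = "{}"]) (auto simp: frame_def)
          have time: "1 + (t2 + (t3 + t4)) \<le> 92 * (n * card W2 ^ q)"
          proof -
            let ?c = "n * card W2 ^ q"
            have "n * 1 \<le> ?c" "n * card W2 \<le> ?c" using c2 by (intro mult_le_mono2; simp)+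
            moreover have "(?hi2 - ?lo2) * (32 * n + 2) \<le> 2 * card W2 ^ q * (34 * n)"
              using sizes(4) n by (intro mult_le_mono) auto
            then have "t4 \<le> 2 + 68 * ?c" using 6(1) by (simp add: algebra_simps)
            ultimately show ?thesis using \<open>t2 \<le> _\<close> \<open>t3 \<le> _\<close> n unfolding mult.assoc by linarith
          qed
          show ?case using time fr4 r4 k4 B4' by (simp add: keeps_def)
        qed (use sizes in auto)
      qed (use 5 Un xn in auto)
    qed (use x xn r1 in auto)
  next
    case (6 t s')
    have "(?hi1 - ?lo1) * (92 * (n * card W2 ^ q) + 2) \<le> 2 * card W1 ^ q * (94 * (n * card W2 ^ q))"
      using sizes(2) n c2 by (intro mult_le_mono) auto
    then have "t \<le> 2 + 188 * (n * (card W1 ^ q * card W2 ^ q))" using 6(1) by (simp add: algebra_simps)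
    moreover have "1 * (1 * 1) \<le> n * (card W1 ^ q * card W2 ^ q)"
      using n c2 by (intro mult_le_mono) auto
    ultimately have "t \<le> 190 * (n * (card W1 ^ q * card W2 ^ q))" by linarith
    then show ?case using 6(2) by (intro Q) simp_all
  qed (use r sizes in auto)
qed

definition scratch :: "state \<Rightarrow> state \<Rightarrow> bool" where
  "scratch = frame {3, 4, 5, 6, 7, 10, 11, 17, 18, 19, 20, 21, 22, 23, 27, 28} {7, 8, 9, 10, 11, 13, 14, 15, 16, 17, 18, 19, 20}"

lemma halts_union:
  assumes s: "ready s" and st: "stack (Ws @ [W1, W2]) s" and r8: "fst s 8 = cut S"
    and W: "W1 \<inter> W2 = {}" "W1 \<noteq> {}" "W2 \<noteq> {}" "labeling q (W1 \<union> W2)"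
    and Q: "\<And>t s'. t \<le> 40 * (n * n) + 190 * (n * (card W1 ^ q * card W2 ^ q)) \<Longrightarrow>
      stack (Ws @ [W1 \<union> W2]) s' \<Longrightarrow> scratch s s' \<Longrightarrow> Q t s'"
  shows "halts union_com Q s"
proof -
  let ?k = "length Ws"
  have n: "0 < n" using s by (simp add: ready_def)
  note top = stack_top[OF st]
  have Un: "W1 \<subseteq> {..<n}" "W2 \<subseteq> {..<n}" "W1 \<union> W2 \<subseteq> {..<n}" using top by (auto simp: U_def)
  have fin: "finite W1" "finite W2" using top U_finite by blast+
  have enc: "set_encode (W1 \<union> W2) = set_encode W1 + set_encode W2" by (rule set_encode_Un[OF fin W(1)])
  let ?e = "set_encode (W1 \<union> W2)"
  let ?s0 = "((fst s)(10 := ?k, 27 := ?e, 4 := ?e), snd s)"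
  define tail where "tail = Store 7 (Reg 10) (Reg 27) ;; Store 8 (Reg 10) (Reg 19) ;;
      Store 9 (Reg 10) (Reg 11) ;; Assign 10 (Plus (Reg 10) (Num 1))"
  have "halts (decode 16 ;; Assign 4 (Load 7 (Plus (Reg 10) (Num 1))) ;; decode 17 ;; weight_com ;;
      Assign 19 (Reg 11) ;; pairs_com ;; tail) (\<lambda>t. Q (Suc (Suc (Suc t)))) ?s0"
  proof (rule halts_SeqI, rule halts_decode[where A = "W1 \<union> W2" and Q = "\<lambda>t s'. t \<le> 7 * n \<and>
        chi 16 (W1 \<union> W2) s' \<and> frame {3, 4} {16} ?s0 s'"], goal_cases)
    case 1
    show ?case by (rule ready_frame[OF s, of "{4, 10, 27}" "{}"]) (auto simp: frame_def)
  next
    case (6 t1 s1)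
    have fr1: "frame {3, 4, 10, 27} {16} s s1" using 6 by (simp add: frame_def)
    have c1: "chi 16 (W1 \<union> W2) s1" and t1: "t1 \<le> 7 * n" using 6 by simp_all
    have fr1': "frame {3, 4} {16} ?s0 s1" using 6 by blast
    have r1: "fst s1 10 = ?k" "fst s1 27 = ?e" using frame_reg[OF fr1'] by simp_all
    have a1: "snd s1 7 (Suc ?k) = set_encode W2" using top frame_arr[OF fr1, of 7] by simp
    let ?s1 = "((fst s1)(4 := set_encode W2), snd s1)"
    have fr1': "frame {3, 4, 10, 27} {16} s ?s1" using fr1 by simp
    have "halts (decode 17 ;; weight_com ;; Assign 19 (Reg 11) ;; pairs_com ;; tail) (\<lambda>t. Q (Suc (Suc (Suc (t1 + (1 + t)))))) ?s1"
    proof (rule halts_SeqI, rule halts_decode[where A = W2 and Q = "\<lambda>t s'. t \<le> 7 * n \<and>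
          chi 17 W2 s' \<and> frame {3, 4} {17} ?s1 s'"], goal_cases)
      case 1
      show ?case by (rule ready_frame[OF s fr1']) auto
    next
      case (6 t2 s2)
      have fr12: "frame {3, 4} {17} s1 s2" using 6 by (simp add: frame_def)
      have fr2: "frame {3, 4, 10, 27} {16, 17} s s2" using fr1 fr12 by (rule frame_trans) auto
      have c2: "chi 17 W2 s2" and t2: "t2 \<le> 7 * n" using 6 by simp_all
      show ?case
      proof (rule halts_SeqI, rule halts_weight[where W = "W1 \<union> W2" and Q = "\<lambda>t s'. t \<le> 12 * n * n \<and>
            (\<forall>u<n. snd s' 19 u = weight (W1 \<union> W2) u) \<and> frame {6, 7, 20} {19} s2 s'"], goal_cases)
        case 1
        show ?case by (rule ready_frame[OF s fr2]) auto
      next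
        case 2
        show ?case using c1 fr12 by (rule chi_frame) auto
      next
        case (4 t3 s3)
        let ?s3 = "((fst s3)(19 := aval (Reg 11) s3), snd s3)"
        have fr23: "frame {6, 7, 20} {19} s2 s3" and t3: "t3 \<le> 12 * n * n"
          and wt: "\<forall>u<n. snd s3 19 u = weight (W1 \<union> W2) u" using 4 by blast+
        have fr3: "frame {3, 4, 6, 7, 10, 19, 20, 27} {16, 17, 19} s ?s3"
          using frame_trans[OF fr2 fr23, of "{3, 4, 6, 7, 10, 19, 20, 27}" "{16, 17, 19}"] by simp
        have r3: "fst ?s3 10 = ?k" "fst ?s3 27 = ?e" "fst ?s3 11 = fst s 11" "fst ?s3 19 = fst s 11"
          using r1 frame_reg[OF fr23] frame_reg[OF fr12] frame_reg[OF fr1] by simp_all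
        have a3: "snd ?s3 7 = snd s 7" "snd ?s3 8 = snd s 8" "snd ?s3 9 = snd s 9"
          using frame_arr[OF fr3] by simp_all
        have k3: "keeps (fst s 11) s ?s3" by (rule keeps_frame[OF fr3]) auto
        have "halts (pairs_com ;; tail) (\<lambda>t. Q (Suc (Suc (Suc (t1 + (1 + (t2 + (t3 + (1 + t)))))))) ) ?s3"
        proof (rule halts_SeqI, rule halts_pairs[where k = ?k and b = "fst s 11" and
              Q = "\<lambda>t s'. t \<le> 190 * (n * (card W1 ^ q * card W2 ^ q)) \<and>
                building (W1 \<union> W2) (fst s 11) (pairs ?s3 ({snd ?s3 8 ?k..<snd ?s3 9 ?k} \<times>
                  {snd ?s3 8 (Suc ?k)..<snd ?s3 9 (Suc ?k)})) s' \<and> keeps (fst s 11) ?s3 s' \<and>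
                frame {3, 4, 6, 7, 11, 17, 18, 20, 21, 22, 23, 28} {10, 11, 13, 14, 15, 18, 20} ?s3 s'",
              OF _ top(4,5) W(1-3)], goal_cases)
          case 1
          show ?case by (rule ready_frame[OF s fr3]) auto
        next
          case 2
          have "frame {6, 7, 19, 20} {19} s2 ?s3" using fr23 by (simp add: frame_def)
          with c2 show ?case by (rule chi_frame) auto
        next
          case 3
          then show ?case using wt by simp
        next
          case 4
          then show ?case using r8 frame_reg[OF fr3, of 8] by simp
        next
          case 8
          show ?case unfolding a3 by (rule table_keeps[OF top(6) k3 top(8)])
        next
          case 9
          show ?case unfolding a3 by (rule table_keeps[OF top(7) k3 top(9)])
        next
          case (13 t4 s4)
          have t4: "t4 \<le> 190 * (n * (card W1 ^ q * card W2 ^ q))"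
            and B4: "building (W1 \<union> W2) (fst s 11) (pairs ?s3 ({snd ?s3 8 ?k..<snd ?s3 9 ?k} \<times>
                  {snd ?s3 8 (Suc ?k)..<snd ?s3 9 (Suc ?k)})) s4"
            and k34: "keeps (fst s 11) ?s3 s4"
            and fr34: "frame {3, 4, 6, 7, 11, 17, 18, 20, 21, 22, 23, 28} {10, 11, 13, 14, 15, 18, 20} ?s3 s4"
            using 13 by blast+
          have T4: "table (W1 \<union> W2) s4 (fst s 11) (fst s4 11)"
            using building_table[OF B4[unfolded a3]] W top(4,5)
              table_keeps[OF top(6) k3 top(8)] table_keeps[OF top(7) k3 top(9)] by blast
          have r4: "fst s4 10 = ?k" "fst s4 27 = ?e" "fst s4 19 = fst s 11"
            using r3 frame_reg[OF fr34] by simp_all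
          have a4: "snd s4 7 = snd s 7" "snd s4 8 = snd s 8" "snd s4 9 = snd s 9"
            using a3 frame_arr[OF fr34] by simp_all
          have fr4: "frame {3, 4, 6, 7, 10, 11, 17, 18, 19, 20, 21, 22, 23, 27, 28}
              {10, 11, 13, 14, 15, 16, 17, 18, 19, 20} s s4"
            using fr3 fr34 by (rule frame_trans) auto
          let ?s5 = "((fst s4)(10 := Suc ?k), (snd s4)(7 := (snd s 7)(?k := ?e),
            8 := (snd s 8)(?k := fst s 11), 9 := (snd s 9)(?k := fst s4 11)))"
          have "Q (Suc (Suc (Suc (Suc (Suc (Suc (Suc (Suc (Suc (t1 + (t2 + (t3 + t4)))))))))))) ?s5"
          proof (rule Q)
            have "n * 1 \<le> n * n" using n by (intro mult_le_mono2) simp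
            then show "Suc (Suc (Suc (Suc (Suc (Suc (Suc (Suc (Suc (t1 + (t2 + (t3 + t4)))))))))))
                \<le> 40 * (n * n) + 190 * (n * (card W1 ^ q * card W2 ^ q))"
              using t1 t2 t3 t4 n unfolding mult.assoc by linarith
            show "scratch s ?s5"
              unfolding scratch_def using fr4 by (simp add: frame_def)
            have k45: "keeps (fst s4 11) s4 ?s5" by (simp add: keeps_def)
            show "stack (Ws @ [W1 \<union> W2]) ?s5"
            proof (rule stack_push[OF st])
              show "keeps (fst s 11) s ?s5"
                using keeps_trans[OF k3 k34] by (simp add: keeps_def)
              show "table (W1 \<union> W2) ?s5 (fst s 11) (fst ?s5 11)"
                using table_keeps[OF T4 k45] by simp
              show "fst s 11 \<le> fst ?s5 11" using T4 by (simp add: table_def)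
            qed (use top(4,5) a4 in simp_all)
          qed
          then show ?case using r4 a4 by (simp add: tail_def halts_Seq)
        qed (use r3 a3 top in simp_all)
        then show ?case by (simp add: halts_Seq)
      qed simp_all
    qed (use Un in auto)
    then show ?case using r1 a1 by (simp add: halts_Seq)
  qed (use Un in auto)
  then show ?thesis
    unfolding union_com_def tail_def using top by (simp add: halts_Seq enc)
qed

lemma table_leaf:
  assumes v: "v \<in> U" and s: "snd s 10 p = cut S" "snd s 11 p = 0"
    "snd s 10 (Suc p) = cut (insert v S)" "snd s 11 (Suc p) = 2 ^ v"
  shows "table {v} s p (Suc (Suc p))"
proof -
  have dec: "set_decode (2 ^ v) = {v}"
    using set_encode_inverse[of "{v}"] by simp
  have range: "p' = p \<or> p' = Suc p" if "p \<le> p' \<and> p' < Suc (Suc p)" for p'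
    using that by auto
  show ?thesis
    unfolding table_def
  proof (intro conjI allI impI)
    fix A assume "A \<subseteq> {v}"
    then consider "A = {}" | "A = {v}" by blast
    then show "\<exists>p'\<ge>p. p' < Suc (Suc p) \<and> sim {v} (set_decode (snd s 11 p')) A \<and> snd s 10 p' \<le> cut (S \<union> A)"
    proof cases
      case 1
      then show ?thesis using s by (intro exI[of _ p]) simp
    next
      case 2
      then show ?thesis using s dec by (intro exI[of _ "Suc p"]) simp
    qed
  next
    fix p' assume "p \<le> p' \<and> p' < Suc (Suc p)"
    from range[OF this] show "set_decode (snd s 11 p') \<subseteq> {v}" "snd s 10 p' = cut (S \<union> set_decode (snd s 11 p'))"
      by (elim disjE; simp add: s dec)+
  qed simp_all
qed

lemma halts_leaf:
  assumes s: "ready s" and st: "stack Ws s" and r: "fst s 8 = cut S" "fst s 9 = set_encode S" "fst s 16 = Suc v"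
    and v: "v \<in> U"
    and Q: "\<And>t s'. t \<le> 40 * (n * n) \<Longrightarrow> stack (Ws @ [{v}]) s' \<Longrightarrow> scratch s s' \<Longrightarrow> Q t s'"
  shows "halts leaf_com Q s"
proof -
  let ?k = "length Ws" and ?a = "fst s 11"
  have n: "0 < n" and vn: "v < n" using s v by (auto simp: ready_def U_def)
  have "v \<le> n * n" using vn le_square[of n] by linarith
  then have pow: "snd s 4 v = 2 ^ v" using s by (simp add: ready_def)
  have Sn: "S \<subseteq> {..<n}" using S D by (rule order_trans)
  have finS: "finite S" using Sn by (rule finite_subset) simp
  have vS: "v \<notin> S" using v S by (auto simp: U_def)
  have enc: "set_encode (insert v S) = set_encode S + 2 ^ v" using finS vS by simp
  have len: "fst s 10 = ?k" using st by (simp add: stack_def)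
  let ?s0 = "((fst s)(28 := 2 ^ v, 4 := set_encode (insert v S)), snd s)"
  define tail where "tail =
     Store 10 (Reg 11) (Reg 8) ;;
     Store 11 (Reg 11) (Num 0) ;;
     Store 10 (Plus (Reg 11) (Num 1)) (Reg 5) ;;
     Store 11 (Plus (Reg 11) (Num 1)) (Reg 28) ;;
     Store 7 (Reg 10) (Reg 28) ;;
     Store 8 (Reg 10) (Reg 11) ;;
     Assign 11 (Plus (Reg 11) (Num 2)) ;;
     Store 9 (Reg 10) (Reg 11) ;;
     Assign 10 (Plus (Reg 10) (Num 1))"
  have "halts (decode 15 ;; cut_com ;; tail) (\<lambda>t. Q (t + 2)) ?s0"
  proof (rule halts_SeqI, rule halts_decode[where A = "insert v S" and Q = "\<lambda>t s'. t \<le> 7 * n \<and>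
        chi 15 (insert v S) s' \<and> frame {3, 4} {15} ?s0 s'"], goal_cases)
    case 1
    show ?case by (rule ready_frame[OF s, of "{4, 28}" "{}"]) (auto simp: frame_def)
  next
    case (6 t1 s1)
    have fr01: "frame {3, 4} {15} ?s0 s1" and c1: "chi 15 (insert v S) s1" and t1: "t1 \<le> 7 * n"
      using 6 by blast+
    have fr1: "frame {3, 4, 28} {15} s s1" using fr01 by (simp add: frame_def)
    have r1: "fst s1 28 = 2 ^ v" using frame_reg[OF fr01, of 28] by simp
    show ?case
    proof (rule halts_SeqI, rule halts_cut[where X = "insert v S" and Q = "\<lambda>t s'. t \<le> 12 * n * n \<and>
          fst s' 5 = cut (insert v S) \<and> frame {5, 6, 7} {} s1 s'"], goal_cases)
      case 1
      show ?case by (rule ready_frame[OF s fr1]) auto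
    next
      case (5 t2 s2)
      have fr12: "frame {5, 6, 7} {} s1 s2" and c2: "fst s2 5 = cut (insert v S)" and t2: "t2 \<le> 12 * n * n"
        using 5 by blast+
      have fr2: "frame {3, 4, 5, 6, 7, 28} {15} s s2" using fr1 fr12 by (rule frame_trans) auto
      have r2: "fst s2 28 = 2 ^ v" "fst s2 11 = ?a" "fst s2 10 = ?k" "fst s2 8 = cut S"
        using r1 frame_reg[OF fr12, of 28] r len frame_reg[OF fr2] by simp_all
      have a2: "snd s2 7 = snd s 7" "snd s2 8 = snd s 8" "snd s2 9 = snd s 9" "snd s2 10 = snd s 10" "snd s2 11 = snd s 11"
        using frame_arr[OF fr2] by simp_all
      let ?s3 = "((fst s2)(10 := Suc ?k, 11 := Suc (Suc ?a)), (snd s2)(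
        7 := (snd s 7)(?k := 2 ^ v), 8 := (snd s 8)(?k := ?a), 9 := (snd s 9)(?k := Suc (Suc ?a)),
        10 := (snd s 10)(?a := cut S, Suc ?a := cut (insert v S)), 11 := (snd s 11)(?a := 0, Suc ?a := 2 ^ v)))"
      have "Q (Suc (Suc (Suc (Suc (Suc (Suc (Suc (Suc (Suc (Suc (Suc (t1 + t2)))))))))))) ?s3"
      proof (rule Q)
        have "n * 1 \<le> n * n" using n by (intro mult_le_mono2) simp
        then show "Suc (Suc (Suc (Suc (Suc (Suc (Suc (Suc (Suc (Suc (Suc (t1 + t2))))))))))) \<le> 40 * (n * n)"
          using t1 t2 n unfolding mult.assoc by linarith
        show "scratch s ?s3" unfolding scratch_def using fr2 by (simp add: frame_def)
        show "stack (Ws @ [{v}]) ?s3"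
        proof (rule stack_push[where Vs = "[]"])
          show "table {v} ?s3 ?a (fst ?s3 11)" using table_leaf[OF v, of ?s3 ?a] by simp
          show "fst s 11 \<le> fst ?s3 11" by (simp add: le_Suc_eq)
        qed (use st v in \<open>simp_all add: keeps_def\<close>)
      qed
      moreover have "((fst s2)(11 := Suc (Suc ?a), 10 := Suc ?k), (snd s2)(
        10 := (snd s 10)(?a := cut S, Suc ?a := cut (insert v S)), 11 := (snd s 11)(?a := 0, Suc ?a := 2 ^ v),
        7 := (snd s 7)(?k := 2 ^ v), 8 := (snd s 8)(?k := ?a), 9 := (snd s 9)(?k := Suc (Suc ?a)))) = ?s3"
        by (auto simp: fun_eq_iff)
      ultimately show ?case using r2 a2 c2
        by (simp add: tail_def halts_Seq)
    qed (use c1 Sn vn in auto)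
  qed (use Sn vn in auto)
  then show ?thesis
    unfolding leaf_com_def tail_def using r pow enc by (simp add: halts_Seq)
qed

end

section \<open>Evaluating the expression\<close>

text \<open>The condensed expression: \<open>Suc v\<close> for the vertex \<open>v\<close>, 0 for a disjoint union.\<close>

fun toks :: "nat qexpr \<Rightarrow> nat list" where
  "toks (Const v i) = [Suc v]"
| "toks (Join i j \<phi>) = toks \<phi>"
| "toks (Relabel i j \<phi>) = toks \<phi>"
| "toks (DUnion \<phi> \<psi>) = toks \<phi> @ toks \<psi> @ [0]"

definition qverts :: "'a qexpr \<Rightarrow> 'a set" where
  "qverts \<phi> = verts (fst (qvalue \<phi>))"

lemma qverts_simps [simp]:
  "qverts (Const v i) = {v}" "qverts (Join i j \<phi>) = qverts \<phi>" "qverts (Relabel i j \<phi>) = qverts \<phi>"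
  "qverts (DUnion \<phi> \<psi>) = qverts \<phi> \<union> qverts \<psi>"
  by (simp_all add: qverts_def case_prod_unfold Let_def)

lemma qverts_nonempty: "qverts \<phi> \<noteq> {}"
  by (induction \<phi>) simp_all

definition token_com :: com where
  "token_com =
     Assign 16 (Load 6 (Reg 12)) ;;
     Cond (Equal (Reg 16) (Num 0)) union_com leaf_com ;;
     Assign 12 (Plus (Reg 12) (Num 1))"

definition tokens_com :: com where
  "tokens_com = While (Less (Reg 12) (Reg 13)) token_com"

definition finish_com :: com where
  "finish_com =
     For 17 (Load 8 (Num 0)) (Load 9 (Num 0))
       (Assign 28 (Plus (Load 11 (Reg 17)) (Reg 9)) ;;
        Assign 4 (Reg 28) ;;
        decode 15 ;;
        Assign 20 (Num 0) ;;
        For 6 (Num 0) (Reg 0)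
          (If1 (Equal (Load 15 (Reg 6)) (Num 1)) (Assign 20 (Plus (Reg 20) (Num 1)))) ;;
        If1 (Conj (Conj (Le (Plus (Reg 20) (Reg 20)) (Reg 0)) (Le (Reg 0) (Plus (Plus (Reg 20) (Reg 20)) (Num 1))))
              (Neg (Conj (Less (Num 0) (Reg 24)) (Le (Reg 24) (Plus (Load 10 (Reg 17)) (Num 1))))))
          (Assign 24 (Plus (Load 10 (Reg 17)) (Num 1)) ;; Assign 25 (Reg 28)))"

definition guess_com :: com where
  "guess_com =
     Assign 9 (Load 12 (Reg 14)) ;;
     Assign 4 (Reg 9) ;;
     decode 15 ;;
     cut_com ;;
     Assign 8 (Reg 5) ;;
     Assign 10 (Num 0) ;;
     Assign 11 (Num 0) ;;
     Assign 12 (Num 0) ;;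
     tokens_com ;;
     finish_com"

context dp
begin

text \<open>
  For the value of a subexpression: \<open>M a b\<close> says that later joins connect the vertices that are
  now labeled \<open>a\<close> to those labeled \<open>b\<close>.
\<close>

definition coherent :: "nat set \<Rightarrow> nat set set \<Rightarrow> (nat \<Rightarrow> nat) \<Rightarrow> bool" where
  "coherent V E l \<longleftrightarrow> V \<subseteq> U \<and>
     (\<forall>u\<in>V. \<forall>u'\<in>V. l u = l u' \<longrightarrow> (\<forall>w\<in>U - V. adj u w \<longleftrightarrow> adj u' w)) \<and>
     (\<exists>M. \<forall>u\<in>V. \<forall>w\<in>V. adj u w \<longleftrightarrow> {u, w} \<in> E \<or> M (l u) (l w))"

lemma coherent_adj: "coherent V E l \<Longrightarrow>
    \<exists>M. \<forall>u\<in>V. \<forall>w\<in>V. adj u w \<longleftrightarrow> {u, w} \<in> E \<or> M (l u) (l w)"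
  unfolding coherent_def by (elim conjE)

definition good :: "nat qexpr \<Rightarrow> bool" where
  "good \<phi> \<longleftrightarrow> wf_qexpr q \<phi> \<and> (case qvalue \<phi> of ((V, E), l) \<Rightarrow> coherent V E l)"

lemma good_qverts: "good \<phi> \<Longrightarrow> qverts \<phi> \<subseteq> U"
  by (auto simp: good_def coherent_def qverts_def split: prod.splits)

lemma good_labeling:
  assumes "good \<phi>"
  shows "labeling q (qverts \<phi>)"
proof -
  obtain V E l where v: "qvalue \<phi> = ((V, E), l)" by (metis prod.exhaust)
  have "coherent V E l" "wf_qexpr q \<phi>" using assms by (simp_all add: good_def v)
  moreover have "l u \<in> {1..q}" if "u \<in> V" for u
    using qexpr_labels[OF \<open>wf_qexpr q \<phi>\<close>, of u] that by (simp add: v)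
  ultimately show ?thesis
    unfolding labeling_def coherent_def qverts_def v fst_conv by blast
qed

lemma coherent_Join:
  assumes "coherent V (E \<union> {{u, v} | u v. u \<in> V \<and> v \<in> V \<and> l u = i \<and> l v = j}) l"
  shows "coherent V E l"
proof -
  obtain M where M0: "\<forall>u\<in>V. \<forall>w\<in>V. adj u w \<longleftrightarrow>
      {u, w} \<in> E \<union> {{u, v} | u v. u \<in> V \<and> v \<in> V \<and> l u = i \<and> l v = j} \<or> M (l u) (l w)"
    using coherent_adj[OF assms] by (elim exE)
  note M = bspec[OF bspec[OF M0]]
  have "adj u w \<longleftrightarrow> {u, w} \<in> E \<or> (\<lambda>a b. M a b \<or> a = i \<and> b = j \<or> a = j \<and> b = i) (l u) (l w)"
    if "u \<in> V" "w \<in> V" for u w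
    unfolding M[OF that] using that by (auto simp: doubleton_eq_iff)
  then have "\<exists>M. \<forall>u\<in>V. \<forall>w\<in>V. adj u w \<longleftrightarrow> {u, w} \<in> E \<or> M (l u) (l w)"
    by (intro exI[of _ "\<lambda>a b. M a b \<or> a = i \<and> b = j \<or> a = j \<and> b = i"] ballI)
  with conjunct1[OF assms[unfolded coherent_def]] conjunct1[OF conjunct2[OF assms[unfolded coherent_def]]]
  show ?thesis unfolding coherent_def by (intro conjI)
qed

lemma coherent_Relabel:
  assumes "coherent V E (\<lambda>v. if l v = i then j else l v)"
  shows "coherent V E l"
proof -
  let ?r = "\<lambda>a. if a = i then j else a"
  obtain M where M: "\<And>u w. u \<in> V \<Longrightarrow> w \<in> V \<Longrightarrow> adj u w \<longleftrightarrow> {u, w} \<in> E \<or> M (?r (l u)) (?r (l w))"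
    using assms unfolding coherent_def by blast
  then have "\<exists>M. \<forall>u\<in>V. \<forall>w\<in>V. adj u w \<longleftrightarrow> {u, w} \<in> E \<or> M (l u) (l w)"
    by (intro exI[of _ "\<lambda>a b. M (?r a) (?r b)"]) blast
  moreover have "adj u w \<longleftrightarrow> adj u' w" if "u \<in> V" "u' \<in> V" "l u = l u'" "w \<in> U - V" for u u' w
  proof -
    have "?r (l u) = ?r (l u')" using that(3) by simp
    then show ?thesis using assms that unfolding coherent_def by blast
  qed
  ultimately show ?thesis using assms unfolding coherent_def by blast
qed

lemma coherent_DUnion:
  assumes C: "coherent (V \<union> V') (E \<union> E') (\<lambda>v. if v \<in> V then l v else l' v)"
    and disj: "V \<inter> V' = {}" and E: "\<And>e. e \<in> E \<Longrightarrow> e \<subseteq> V" and E': "\<And>e. e \<in> E' \<Longrightarrow> e \<subseteq> V'"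
  shows "coherent V E l" "coherent V' E' l'"
proof -
  let ?l = "\<lambda>v. if v \<in> V then l v else l' v"
  obtain M where M0: "\<forall>u\<in>V \<union> V'. \<forall>w\<in>V \<union> V'. adj u w \<longleftrightarrow> {u, w} \<in> E \<union> E' \<or> M (?l u) (?l w)"
    using coherent_adj[OF C] by (elim exE)
  have M: "adj u w \<longleftrightarrow> {u, w} \<in> E \<union> E' \<or> M (?l u) (?l w)" if "u \<in> V \<union> V'" "w \<in> V \<union> V'" for u w
    using bspec[OF bspec[OF M0 that(1)] that(2)] .
  have twin: "adj u w \<longleftrightarrow> adj u' w"
    if "u \<in> V \<union> V'" "u' \<in> V \<union> V'" "?l u = ?l u'" "w \<in> U - (V \<union> V')" for u u' w
    using C that unfolding coherent_def by blast
  have VU: "V \<union> V' \<subseteq> U" using C unfolding coherent_def by blast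
  have l: "?l u = l u" if "u \<in> V" for u using that by simp
  have l': "?l u = l' u" if "u \<in> V'" for u using that disj by auto
  have cross: "adj u w \<longleftrightarrow> M (l u) (l' w)" if "u \<in> V" "w \<in> V'" for u w
  proof -
    have "{u, w} \<notin> E \<union> E'" using E[of "{u, w}"] E'[of "{u, w}"] that disj by blast
    then show ?thesis using M[of u w] that unfolding l[OF that(1)] l'[OF that(2)] by blast
  qed
  have cross': "adj u w \<longleftrightarrow> M (l' u) (l w)" if "u \<in> V'" "w \<in> V" for u w
  proof -
    have "{u, w} \<notin> E \<union> E'" using E[of "{u, w}"] E'[of "{u, w}"] that disj by blast
    then show ?thesis using M[of u w] that unfolding l[OF that(2)] l'[OF that(1)] by blast
  qed
  have "adj u w \<longleftrightarrow> {u, w} \<in> E \<or> M (l u) (l w)" if "u \<in> V" "w \<in> V" for u w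
    using M[of u w] that E'[of "{u, w}"] disj unfolding l[OF that(1)] l[OF that(2)] by blast
  moreover have "adj u w \<longleftrightarrow> adj u' w" if "u \<in> V" "u' \<in> V" "l u = l u'" "w \<in> U - V" for u u' w
  proof (cases "w \<in> V'")
    case True
    then show ?thesis by (simp only: cross[OF that(1) True] cross[OF that(2) True] that(3))
  next
    case False
    then show ?thesis using twin[of u u' w] that unfolding l[OF that(1)] l[OF that(2)] by blast
  qed
  ultimately show "coherent V E l" unfolding coherent_def using VU by blast
  have "adj u w \<longleftrightarrow> {u, w} \<in> E' \<or> M (l' u) (l' w)" if "u \<in> V'" "w \<in> V'" for u w
    using M[of u w] that E[of "{u, w}"] disj unfolding l'[OF that(1)] l'[OF that(2)] by blast
  moreover have "adj u w \<longleftrightarrow> adj u' w" if "u \<in> V'" "u' \<in> V'" "l' u = l' u'" "w \<in> U - V'" for u u' w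
  proof (cases "w \<in> V")
    case True
    then show ?thesis by (simp only: cross'[OF that(1) True] cross'[OF that(2) True] that(3))
  next
    case False
    then show ?thesis using twin[of u u' w] that unfolding l'[OF that(1)] l'[OF that(2)] by blast
  qed
  ultimately show "coherent V' E' l'" unfolding coherent_def using VU by blast
qed

lemma good_Join: "good (Join i j \<phi>) \<Longrightarrow> good \<phi>"
  by (auto simp: good_def dest: coherent_Join split: prod.splits)

lemma good_Relabel: "good (Relabel i j \<phi>) \<Longrightarrow> good \<phi>"
  by (auto simp: good_def dest: coherent_Relabel split: prod.splits)

lemma good_DUnion:
  assumes "good (DUnion \<phi> \<psi>)"
  shows "good \<phi>" "good \<psi>" "qverts \<phi> \<inter> qverts \<psi> = {}"
proof -
  obtain V E l where v: "qvalue \<phi> = ((V, E), l)" by (metis prod.exhaust)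
  obtain V' E' l' where v': "qvalue \<psi> = ((V', E'), l')" by (metis prod.exhaust)
  have wf: "wf_qexpr q \<phi>" "wf_qexpr q \<psi>" and disj: "V \<inter> V' = {}"
    and C: "coherent (V \<union> V') (E \<union> E') (\<lambda>v. if v \<in> V then l v else l' v)"
    using assms by (simp_all add: good_def v v')
  have "e \<subseteq> V" if "e \<in> E" for e
    using qexpr_finite_graph[OF wf(1)] that by (simp add: v finite_graph_def)
  moreover have "e \<subseteq> V'" if "e \<in> E'" for e
    using qexpr_finite_graph[OF wf(2)] that by (simp add: v' finite_graph_def)
  ultimately have "coherent V E l" "coherent V' E' l'"
    using coherent_DUnion[OF C disj] by blast+
  then show "good \<phi>" "good \<psi>" using wf by (simp_all add: good_def v v')
  show "qverts \<phi> \<inter> qverts \<psi> = {}" using disj by (simp add: qverts_def v v')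
qed

definition time :: "nat \<Rightarrow> nat" where
  "time m = 44 * (n * n) * (2 * m - 1) + 190 * (n * m ^ (2 * q))"

lemma time_union:
  assumes "1 \<le> a" "1 \<le> b" "1 \<le> n"
  shows "time a + time b + (44 * (n * n) + 190 * (n * (a ^ q * b ^ q))) \<le> time (a + b)"
proof -
  have sup: "x ^ q + y ^ q \<le> (x + y) ^ q" for x y :: nat
  proof -
    obtain k where "q = Suc k" using q by (cases q) auto
    moreover have "x * x ^ k + y * y ^ k \<le> x * (x + y) ^ k + y * (x + y) ^ k"
      by (intro add_mono mult_le_mono2 power_mono) auto
    ultimately show ?thesis by (simp add: algebra_simps)
  qed
  have "a ^ (2 * q) + b ^ (2 * q) + a ^ q * b ^ q \<le> (a ^ q + b ^ q) ^ 2"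
    by (simp add: power2_sum power_mult mult.commute[of 2] )
  also have "\<dots> \<le> ((a + b) ^ q) ^ 2" by (intro power_mono sup) simp
  finally have "n * (a ^ (2 * q) + b ^ (2 * q) + a ^ q * b ^ q) \<le> n * (a + b) ^ (2 * q)"
    by (simp add: power_mult mult.commute[of 2])
  moreover have "(2 * a - 1) + (2 * b - 1) + 1 = 2 * (a + b) - 1" using assms by simp
  then have "44 * (n * n) * (2 * a - 1) + 44 * (n * n) * (2 * b - 1) + 44 * (n * n) = 44 * (n * n) * (2 * (a + b) - 1)"
    by (metis distrib_left mult.right_neutral)
  ultimately show ?thesis unfolding time_def by (simp add: distrib_left)
qed

definition steady :: "state \<Rightarrow> state \<Rightarrow> bool" where
  "steady = frame {3, 4, 5, 6, 7, 10, 11, 12, 16, 17, 18, 19, 20, 21, 22, 23, 27, 28} {7, 8, 9, 10, 11, 13, 14, 15, 16, 17, 18, 19, 20}"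

lemma steady_trans: "steady s s' \<Longrightarrow> steady s' s'' \<Longrightarrow> steady s s''"
  unfolding steady_def by (erule (1) frame_trans) auto

lemma ready_steady: "ready s \<Longrightarrow> steady s s' \<Longrightarrow> ready s'"
  unfolding steady_def by (erule (1) ready_frame) auto

lemma stack_frame: "stack Ws s \<Longrightarrow> frame R M s s' \<Longrightarrow> {10, 11} \<inter> R = {} \<Longrightarrow> {7, 8, 9, 10, 11} \<inter> M = {} \<Longrightarrow> stack Ws s'"
  unfolding stack_def table_def
  by (simp add: frame_reg[of R M s s'] frame_arr[of R M s s'])

lemma token_frames:
  assumes "scratch ((fst s)(16 := k), snd s) s1"
  shows "steady s ((fst s1)(12 := j), snd s1)"
  using assms unfolding scratch_def steady_def by (simp add: frame_def)

text \<open>The last premise is a continuation: it allows induction over an expression that is only a part of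
  the input of a single loop.\<close>

lemma halts_tokens:
  assumes "good \<phi>" "ready s" "stack Ws s" "fst s 8 = cut S" "fst s 9 = set_encode S"
    and "\<And>k. k < length (toks \<phi>) \<Longrightarrow> snd s 6 (fst s 12 + k) = toks \<phi> ! k"
    and "fst s 12 + length (toks \<phi>) \<le> fst s 13"
    and "\<And>t s'. t \<le> time (card (qverts \<phi>)) \<Longrightarrow> stack (Ws @ [qverts \<phi>]) s' \<Longrightarrow> steady s s' \<Longrightarrow>
      fst s' 12 = fst s 12 + length (toks \<phi>) \<Longrightarrow> halts tokens_com (\<lambda>t'. Q (t + t')) s'"
  shows "halts tokens_com Q s"
  using assms
proof (induction \<phi> arbitrary: s Ws Q)
  case (Const v i)
  have "0 < n" using Const.prems(2) by (simp add: ready_def)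
  then have "1 * 1 \<le> n * n" by (intro mult_le_mono) auto
  then have n: "1 \<le> n * n" by simp
  have v: "v \<in> U" using good_qverts[OF Const.prems(1)] by simp
  let ?s = "((fst s)(16 := Suc v), snd s)"
  have fr: "frame {16} {} s ?s" by simp
  have "halts leaf_com (\<lambda>t s'. halts tokens_com (\<lambda>t'. Q (Suc (Suc (Suc (Suc t))) + t')) ((fst s')(12 := Suc (fst s' 12)), snd s')) ?s"
  proof (rule halts_leaf[OF ready_frame[OF Const.prems(2) fr] stack_frame[OF Const.prems(3) fr] _ _ _ v], goal_cases)
    case (8 t s1)
    have 12: "fst s1 12 = fst s 12" using 8(3) by (simp add: scratch_def frame_def)
    have fr1: "frame {12} {} s1 ((fst s1)(12 := Suc (fst s1 12)), snd s1)" by simp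
    show ?case
      unfolding 12
    proof (rule Const.prems(8))
      show "Suc (Suc (Suc (Suc t))) \<le> time (card (qverts (Const v i)))" using 8(1) n by (simp add: time_def)
      show "stack (Ws @ [qverts (Const v i)]) ((fst s1)(12 := Suc (fst s 12)), snd s1)"
        using stack_frame[OF 8(2) fr1] 12 by simp
      show "steady s ((fst s1)(12 := Suc (fst s 12)), snd s1)" using 8(3) by (rule token_frames)
    qed simp
  qed (use Const.prems in simp_all)
  then show ?case
    unfolding tokens_com_def token_com_def
    apply (subst halts_While)
    using Const.prems(6)[of 0] Const.prems(7)
    by (simp add: halts_Seq)
next
  case (Join i j \<phi>)
  show ?case
    by (rule Join.IH[OF good_Join[OF Join.prems(1)] Join.prems(2-5)])
      (use Join.prems(6-8) in \<open>simp_all only: toks.simps qverts_simps\<close>)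
next
  case (Relabel i j \<phi>)
  show ?case
    by (rule Relabel.IH[OF good_Relabel[OF Relabel.prems(1)] Relabel.prems(2-5)])
      (use Relabel.prems(6-8) in \<open>simp_all only: toks.simps qverts_simps\<close>)
next
  case (DUnion \<phi> \<psi>)
  let ?i = "fst s 12" and ?a = "length (toks \<phi>)" and ?b = "length (toks \<psi>)"
  have n0: "0 < n" using DUnion.prems(2) by (simp add: ready_def)
  then have "1 * 1 \<le> n * n" by (intro mult_le_mono) auto
  then have n: "1 \<le> n * n" by simp
  have lab: "labeling q (qverts \<phi> \<union> qverts \<psi>)" using good_labeling[OF DUnion.prems(1)] by simp
  have g: "good \<phi>" "good \<psi>" and disj: "qverts \<phi> \<inter> qverts \<psi> = {}" using good_DUnion[OF DUnion.prems(1)] by blast+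
  have fin: "finite (qverts \<phi>)" "finite (qverts \<psi>)" using g good_qverts U_finite by blast+
  have card: "1 \<le> card (qverts \<phi>)" "1 \<le> card (qverts \<psi>)"
    using fin qverts_nonempty by (auto simp: Suc_le_eq card_gt_0_iff)
  have tok: "snd s 6 (?i + k) = toks \<phi> ! k" if "k < ?a" for k
    using DUnion.prems(6)[of k] that by (simp add: nth_append)
  have tok': "snd s 6 (?i + ?a + k) = toks \<psi> ! k" if "k < ?b" for k
    using DUnion.prems(6)[of "?a + k"] that by (simp add: nth_append add.assoc)
  have tok0: "snd s 6 (?i + ?a + ?b) = 0"
    using DUnion.prems(6)[of "?a + ?b"] by (simp add: nth_append add.assoc)
  have len: "?i + ?a + ?b < fst s 13" using DUnion.prems(7) by simp
  show ?case
  proof (rule DUnion.IH(1)[OF g(1) DUnion.prems(2-5) tok], goal_cases)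
    case 2
    then show ?case using len by simp
  next
    case (3 t1 s1)
    have r1: "fst s1 8 = cut S" "fst s1 9 = set_encode S" "fst s1 13 = fst s 13" "snd s1 6 = snd s 6"
      using 3(3) DUnion.prems(4,5) by (simp_all add: steady_def frame_def)
    show ?case
    proof (rule DUnion.IH(2)[OF g(2) ready_steady[OF DUnion.prems(2) 3(3)] 3(2) r1(1,2)], goal_cases)
      case (1 k)
      then show ?case using tok' 3(4) r1(4) by simp
    next
      case 2
      then show ?case using len 3(4) r1(3) by simp
    next
      case (3 t2 s2)
      have st2: "steady s s2" using \<open>steady s s1\<close> 3(3) by (rule steady_trans)
      have r2: "fst s2 8 = cut S" "fst s2 13 = fst s 13" "snd s2 6 = snd s 6" "fst s2 12 = ?i + ?a + ?b"
        using st2 DUnion.prems(4,5) 3(4) \<open>fst s1 12 = _\<close> by (simp_all add: steady_def frame_def)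
      let ?s2 = "((fst s2)(16 := 0), snd s2)"
      have fr: "frame {16} {} s2 ?s2" by simp
      have stk: "stack (Ws @ [qverts \<phi>, qverts \<psi>]) s2" using 3(2) by simp
      have "halts union_com (\<lambda>t s'. halts tokens_com (\<lambda>t'. Q (t1 + (t2 + (Suc (Suc (Suc (Suc t))) + t')))) ((fst s')(12 := Suc (fst s' 12)), snd s')) ?s2"
      proof (rule halts_union[OF ready_frame[OF ready_steady[OF DUnion.prems(2) st2] fr] stack_frame[OF stk fr] _ disj
            qverts_nonempty qverts_nonempty lab], goal_cases)
        case (6 t s3)
        have 12: "fst s3 12 = fst s2 12" using 6(3) by (simp add: scratch_def frame_def)
        have fr3: "frame {12} {} s3 ((fst s3)(12 := Suc (fst s3 12)), snd s3)" by simp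
        have "halts tokens_com (\<lambda>t'. Q (t1 + (t2 + (Suc (Suc (Suc (Suc t))))) + t')) ((fst s3)(12 := Suc (fst s2 12)), snd s3)"
        proof (rule DUnion.prems(8))
          have "Suc (Suc (Suc (Suc t))) \<le> 44 * (n * n) + 190 * (n * (card (qverts \<phi>) ^ q * card (qverts \<psi>) ^ q))"
            using 6(1) n by linarith
          moreover have "card (qverts (DUnion \<phi> \<psi>)) = card (qverts \<phi>) + card (qverts \<psi>)"
            using fin disj by (simp add: card_Un_disjoint)
          ultimately show "t1 + (t2 + (Suc (Suc (Suc (Suc t))))) \<le> time (card (qverts (DUnion \<phi> \<psi>)))"
            using \<open>t1 \<le> _\<close> \<open>t2 \<le> _\<close> time_union[OF card] n0 by simp
          show "stack (Ws @ [qverts (DUnion \<phi> \<psi>)]) ((fst s3)(12 := Suc (fst s2 12)), snd s3)"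
            using stack_frame[OF 6(2) fr3] 12 by simp
          show "steady s ((fst s3)(12 := Suc (fst s2 12)), snd s3)"
            using st2 token_frames[OF 6(3)] by (rule steady_trans)
        qed (use r2 in simp)
        then show ?case by (simp add: 12 add.assoc)
      qed (use r2 in simp_all)
      then show ?case
        unfolding tokens_com_def token_com_def
        apply (subst halts_While)
        using tok0 len r2 by (simp add: halts_Seq)
    qed
  qed
qed

end

context cut_graph
begin

text \<open>
  Register 24 holds the successor of the smallest cut found so far, 0 if there is none, and register
  25 the mask of the corresponding set. One of the two parts of a bisection has size \<open>n div 2\<close>, so
  only sets of this size are considered.
\<close>

definition best :: "nat set \<Rightarrow> state \<Rightarrow> bool" where
  "best C s \<longleftrightarrow> (\<forall>c\<in>C. 0 < fst s 24 \<and> fst s 24 \<le> Suc c) \<and>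
     (0 < fst s 24 \<longrightarrow> (\<exists>X\<subseteq>{..<n}. fst s 25 = set_encode X \<and> card X = n div 2 \<and> fst s 24 = Suc (cut X)))"

lemma best_frame: "best C s \<Longrightarrow> frame R M s s' \<Longrightarrow> 24 \<notin> R \<Longrightarrow> 25 \<notin> R \<Longrightarrow> best C s'"
  by (simp add: best_def frame_def)

lemma best_dominated:
  assumes "best C s" "\<And>c'. c' \<in> C' \<Longrightarrow> \<exists>c\<in>C. c \<le> c'"
  shows "best C' s"
proof -
  have "0 < fst s 24 \<and> fst s 24 \<le> Suc c'" if "c' \<in> C'" for c'
    using assms(2)[OF that] assms(1) unfolding best_def by fastforce
  then show ?thesis using assms(1) unfolding best_def by blast
qed

lemma best_update:
  assumes "best C s" "X \<subseteq> {..<n}" "card X = n div 2" "\<not> (0 < fst s 24 \<and> fst s 24 \<le> Suc (cut X))"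
    "fst s' 24 = Suc (cut X)" "fst s' 25 = set_encode X"
  shows "best (insert (cut X) C) s'"
proof -
  have "0 < fst s' 24 \<and> fst s' 24 \<le> Suc c" if "c \<in> insert (cut X) C" for c
    using assms(1,4,5) that unfolding best_def by (cases "c = cut X") fastforce+
  moreover have "\<exists>X\<subseteq>{..<n}. fst s' 25 = set_encode X \<and> card X = n div 2 \<and> fst s' 24 = Suc (cut X)"
    using assms(2,3,5,6) by blast
  ultimately show ?thesis unfolding best_def by blast
qed

lemma best_insert: "best C s \<Longrightarrow> 0 < fst s 24 \<and> fst s 24 \<le> Suc c \<Longrightarrow> best (insert c C) s"
  unfolding best_def by blast

definition costs :: "nat set \<Rightarrow> nat set" where
  "costs S = {cut (S \<union> A) |A. A \<subseteq> U \<and> card (S \<union> A) = n div 2}"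

end

context dp
begin

lemma halts_finish:
  assumes s: "ready s" and st: "stack [U] s" and r: "fst s 9 = set_encode S" and b: "best C s" and U: "U \<noteq> {}"
    and Q: "\<And>t s'. t \<le> 44 * (n * card U ^ q) \<Longrightarrow> best (C \<union> costs S) s' \<Longrightarrow>
      frame {3, 4, 6, 17, 20, 24, 25, 28} {15} s s' \<Longrightarrow> Q t s'"
  shows "halts finish_com Q s"
proof -
  have n: "0 < n" using s by (simp add: ready_def)
  let ?lo = "snd s 8 0" and ?hi = "snd s 9 0"
  have T: "table U s ?lo ?hi" using st by (simp add: stack_def)
  let ?X = "\<lambda>p. set_decode (snd s 11 p)"
  let ?R = "{3, 4, 6, 17, 20, 24, 25, 28} :: nat set" and ?M = "{15} :: nat set"
  have entry: "?X p \<subseteq> U" "snd s 10 p = cut (S \<union> ?X p)" if "?lo \<le> p" "p < ?hi" for p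
    using T that unfolding table_def by blast+
  have sizes: "?lo < ?hi" "?hi - ?lo \<le> 2 * card U ^ q" using T unfolding table_def by blast+
  have Sn: "S \<subseteq> {..<n}" using S D by (rule order_trans)
  have finS: "finite S" using Sn by (rule finite_subset) simp
  have fin: "finite U" by (simp add: U_def)
  define F where "F p = {cut (S \<union> ?X p') |p'. ?lo \<le> p' \<and> p' < p \<and> card (S \<union> ?X p') = n div 2}" for p
  have F_Suc: "F (Suc p) = (if card (S \<union> ?X p) = n div 2 then insert (cut (S \<union> ?X p)) (F p) else F p)"
    if "?lo \<le> p" for p
    using that unfolding F_def by (auto simp: less_Suc_eq)
  show ?thesis
    unfolding finish_com_def
  proof (rule halts_For_const[where lo = ?lo and hi = ?hi and T = "19 * n" and
      I = "\<lambda>p s'. frame ?R ?M s s' \<and> fst s' 17 = p \<and> best (C \<union> F p) s'"], goal_cases)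
    case 3
    have "F ?lo = {}" by (auto simp: F_def)
    then have "best (C \<union> F ?lo) s" using b by simp
    then have "best (C \<union> F ?lo) ((fst s)(17 := ?lo), snd s)"
      by (rule best_frame[where R = "{17}" and M = "{}"]) (auto simp: frame_def)
    then show ?case by simp
  next
    case (5 p s1)
    have fr1: "frame ?R ?M s s1" and r1: "fst s1 17 = p" and b1: "best (C \<union> F p) s1" using 5(1) by blast+
    define x where "x = ?X p"
    have xU: "x \<subseteq> U" and vx: "snd s 10 p = cut (S \<union> x)" using entry[OF 5(2,3)] by (simp_all add: x_def)
    have xn: "S \<union> x \<subseteq> {..<n}" using Sn xU by (auto simp: U_def)
    have finx: "finite (S \<union> x)" using xn finite_subset by blast
    have "S \<inter> x = {}" using xU S by (auto simp: U_def)
    then have "set_encode (S \<union> x) = set_encode x + set_encode S"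
      using set_encode_Un[of S x] finx by simp
    then have enc: "snd s1 11 p + fst s1 9 = set_encode (S \<union> x)"
      using frame_arr[OF fr1, of 11] frame_reg[OF fr1, of 9] r by (simp add: x_def)
    have s1: "ready s1" by (rule ready_frame[OF s fr1]) auto
    let ?s1 = "((fst s1)(28 := set_encode (S \<union> x), 4 := set_encode (S \<union> x)), snd s1)"
    have fr1': "frame {4, 28} {} s1 ?s1" by simp
    define tail where "tail = If1 (Conj (Conj (Le (Plus (Reg 20) (Reg 20)) (Reg 0)) (Le (Reg 0) (Plus (Plus (Reg 20) (Reg 20)) (Num 1))))
              (Neg (Conj (Less (Num 0) (Reg 24)) (Le (Reg 24) (Plus (Load 10 (Reg 17)) (Num 1))))))
          (Assign 24 (Plus (Load 10 (Reg 17)) (Num 1)) ;; Assign 25 (Reg 28))"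
    let ?Q = "\<lambda>t s'. t \<le> 19 * n \<and> fst s' 17 = p \<and> frame ?R ?M s ((fst s')(17 := Suc p), snd s') \<and>
        fst ((fst s')(17 := Suc p), snd s') 17 = Suc p \<and> best (C \<union> F (Suc p)) ((fst s')(17 := Suc p), snd s')"
    have "halts (decode 15 ;; Assign 20 (Num 0) ;; For 6 (Num 0) (Reg 0)
          (If1 (Equal (Load 15 (Reg 6)) (Num 1)) (Assign 20 (Plus (Reg 20) (Num 1)))) ;; tail)
        (\<lambda>t. ?Q (Suc (Suc t))) ?s1"
    proof (rule halts_SeqI, rule halts_decode[where A = "S \<union> x" and Q = "\<lambda>t s'. t \<le> 7 * n \<and>
          chi 15 (S \<union> x) s' \<and> frame {3, 4} {15} ?s1 s'"], goal_cases)
      case 1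
      show ?case by (rule ready_frame[OF s1 fr1']) auto
    next
      case (6 t2 s2)
      have t2: "t2 \<le> 7 * n" and c2: "chi 15 (S \<union> x) s2" and fr02: "frame {3, 4} {15} ?s1 s2" using 6 by blast+
      have fr12: "frame {3, 4, 28} {15} s1 s2" using fr02 by (simp add: frame_def)
      have r2: "fst s2 28 = set_encode (S \<union> x)" using frame_reg[OF fr02, of 28] by simp
      have s2: "ready s2" by (rule ready_frame[OF s1 fr12]) auto
      let ?s2 = "((fst s2)(20 := 0), snd s2)"
      have "halts (For 6 (Num 0) (Reg 0) (If1 (Equal (Load 15 (Reg 6)) (Num 1)) (Assign 20 (Plus (Reg 20) (Num 1)))) ;; tail)
          (\<lambda>t. ?Q (Suc (Suc (t2 + (1 + t))))) ?s2"
      proof (rule halts_SeqI, rule halts_sum_loop[where n = n and P = "\<lambda>k. k \<in> S \<union> x" and f = "\<lambda>_. 1" and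
            Q = "\<lambda>t s'. t \<le> 2 + 4 * n \<and> frame {6, 20} {} ?s2 s' \<and> fst s' 20 = card (S \<union> x)"], goal_cases)
        case 1
        then show ?case using s2 by (simp add: ready_def)
      next
        case (5 k s')
        then show ?case using c2 by (simp add: chi_def frame_def)
      next
        case (6 t s')
        have "(\<Sum>k<n. if k \<in> S \<union> x then 1 else 0) = card (S \<union> x)"
          using sum_if_mem[OF xn, of "\<lambda>_. 1"] by simp
        with 6 show ?case by simp
      next
        case (7 t3 s3)
        have t3: "t3 \<le> 2 + 4 * n" and fr03: "frame {6, 20} {} ?s2 s3" and k: "fst s3 20 = card (S \<union> x)" using 7 by blast+
        have fr23: "frame {6, 20} {} s2 s3" using fr03 by (simp add: frame_def)
        have fr13: "frame {3, 4, 6, 20, 28} {15} s1 s3" using fr12 fr23 by (rule frame_trans) auto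
        have fr3: "frame ?R ?M s s3" using fr1 fr13 by (rule frame_trans) auto
        have r3: "fst s3 17 = p" "fst s3 28 = set_encode (S \<union> x)" "fst s3 0 = n" "snd s3 10 p = cut (S \<union> x)"
          using r1 frame_reg[OF fr13, of 17] r2 frame_reg[OF fr23, of 28] frame_reg[OF fr3, of 0] s vx frame_arr[OF fr3, of 10]
          by (simp_all add: ready_def)
        have b3: "best (C \<union> F p) s3" using b1 fr13 by (rule best_frame) auto
        have half: "\<not> n < card (S \<union> x) + card (S \<union> x) \<and> \<not> Suc (card (S \<union> x) + card (S \<union> x)) < n \<longleftrightarrow> card (S \<union> x) = n div 2"
          by linarith
        have time: "Suc (Suc (t2 + (1 + (t3 + Suc (Suc (Suc 0)))))) \<le> 19 * n" using t2 t3 n by linarith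
        have Q: "?Q (Suc (Suc (t2 + (1 + (t3 + t))))) s'"
          if "t \<le> Suc (Suc (Suc 0))" "frame {24, 25} {} s3 s'" "best (C \<union> F (Suc p)) s'" for t s'
        proof -
          have fr: "frame ?R ?M s s'" using fr3 that(2) by (rule frame_trans) auto
          have "best (C \<union> F (Suc p)) ((fst s')(17 := Suc p), snd s')"
            using that(3) by (rule best_frame[where R = "{17}" and M = "{}"]) (auto simp: frame_def)
          then show ?thesis using fr that(1) time frame_reg[OF that(2), of 17] r3(1) by simp
        qed
        show ?case
        proof (cases "card (S \<union> x) = n div 2 \<and> \<not> (0 < fst s3 24 \<and> fst s3 24 \<le> Suc (cut (S \<union> x)))")
          case True
          let ?s4 = "((fst s3)(24 := Suc (cut (S \<union> x)), 25 := set_encode (S \<union> x)), snd s3)"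
          have "best (insert (cut (S \<union> x)) (C \<union> F p)) ?s4"
            using True by (intro best_update[OF b3 xn]) simp_all
          then have "best (C \<union> F (Suc p)) ?s4" using True F_Suc[OF 5(2)] by (simp add: x_def)
          then have "?Q (Suc (Suc (t2 + (1 + (t3 + Suc (Suc (Suc 0))))))) ?s4"
            by (intro Q) simp_all
          moreover have "bval (Conj (Conj (Le (Plus (Reg 20) (Reg 20)) (Reg 0)) (Le (Reg 0) (Plus (Plus (Reg 20) (Reg 20)) (Num 1))))
              (Neg (Conj (Less (Num 0) (Reg 24)) (Le (Reg 24) (Plus (Load 10 (Reg 17)) (Num 1)))))) s3"
            using True half r3 k by auto
          ultimately show ?thesis
            unfolding tail_def halts_Cond halts_Seq halts_Assign halts_Skip using r3 by (simp del: bval.simps)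
        next
          case False
          have "best (C \<union> F (Suc p)) s3"
          proof (cases "card (S \<union> x) = n div 2")
            case True
            then have "best (insert (cut (S \<union> x)) (C \<union> F p)) s3" using False by (intro best_insert[OF b3]) blast
            then show ?thesis using True F_Suc[OF 5(2)] by (simp add: x_def)
          next
            case False
            then show ?thesis using b3 F_Suc[OF 5(2)] by (simp add: x_def)
          qed
          then have "?Q (Suc (Suc (t2 + (1 + (t3 + Suc (Suc 0)))))) s3"
            by (intro Q) simp_all
          moreover have "\<not> bval (Conj (Conj (Le (Plus (Reg 20) (Reg 20)) (Reg 0)) (Le (Reg 0) (Plus (Plus (Reg 20) (Reg 20)) (Num 1))))
              (Neg (Conj (Less (Num 0) (Reg 24)) (Le (Reg 24) (Plus (Load 10 (Reg 17)) (Num 1)))))) s3"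
            using False half r3 k by auto
          ultimately show ?thesis
            unfolding tail_def halts_Cond halts_Seq halts_Assign halts_Skip by (simp del: bval.simps)
        qed
      qed simp_all
      then show ?case unfolding halts_Seq halts_Assign by simp
    qed (use xn in auto)
    then show ?case
      unfolding tail_def halts_Seq halts_Assign using enc r1 by simp
  next
    case (6 t s')
    have fr: "frame ?R ?M s s'" and b': "best (C \<union> F ?hi) s'" using 6(2) by blast+
    show ?case
    proof (rule Q[OF _ _ fr])
      have "1 * 1 \<le> n * card U ^ q"
        using U fin n by (intro mult_le_mono) (auto simp: Suc_le_eq card_gt_0_iff)
      moreover have "(?hi - ?lo) * (19 * n + 2) \<le> 2 * card U ^ q * (21 * n)"
        using n sizes(2) by (intro mult_le_mono) auto
      then have "t \<le> 2 + 42 * (n * card U ^ q)" using 6(1) by (simp add: ac_simps)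
      ultimately show "t \<le> 44 * (n * card U ^ q)" by linarith
      show "best (C \<union> costs S) s'"
      proof (rule best_dominated[OF b'])
        fix c' assume "c' \<in> C \<union> costs S"
        then show "\<exists>c\<in>C \<union> F ?hi. c \<le> c'"
        proof
          assume "c' \<in> costs S"
          then obtain A where A: "A \<subseteq> U" "card (S \<union> A) = n div 2" "c' = cut (S \<union> A)" unfolding costs_def by blast
          obtain p where p: "?lo \<le> p" "p < ?hi" "sim U (?X p) A" "snd s 10 p \<le> cut (S \<union> A)"
            using T A(1) unfolding table_def by blast
          have "finite A" "finite (?X p)" "S \<inter> A = {}" "S \<inter> ?X p = {}"
            using A(1) entry(1)[OF p(1,2)] finite_subset[OF A(1) fin] S by (auto simp: U_def)
          then have "card (S \<union> ?X p) = card (S \<union> A)"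
            using p(3) finS by (simp add: card_Un_disjoint sim_def)
          then have "cut (S \<union> ?X p) \<in> F ?hi"
            unfolding F_def mem_Collect_eq using p(1,2) A(2) by (intro exI[of _ p]) simp
          then show ?thesis using p(4) entry(2)[OF p(1,2)] A(3) by (intro bexI[of _ "cut (S \<union> ?X p)"]) auto
        qed blast
      qed
    qed
  next
    case (4 p s')
    then show ?case by (simp add: frame_def)
  qed (use sizes in auto)
qed

lemma halts_guess:
  assumes s: "ready s" and g: "snd s 12 (fst s 14) = set_encode S" and b: "best C s"
    and \<phi>: "good \<phi>" "qverts \<phi> = U"
    and tok: "\<And>k. k < length (toks \<phi>) \<Longrightarrow> snd s 6 k = toks \<phi> ! k" "fst s 13 = length (toks \<phi>)"
    and Q: "\<And>t s'. t \<le> 400 * n ^ (2 * q + 1) \<Longrightarrow> best (C \<union> costs S) s' \<Longrightarrow>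
      frame {3, 4, 5, 6, 7, 8, 9, 10, 11, 12, 16, 17, 18, 19, 20, 21, 22, 23, 24, 25, 27, 28}
        {7, 8, 9, 10, 11, 13, 14, 15, 16, 17, 18, 19, 20} s s' \<Longrightarrow> Q t s'"
  shows "halts guess_com Q s"
proof -
  let ?R = "{3, 4, 5, 6, 7, 8, 9, 10, 11, 12, 16, 17, 18, 19, 20, 21, 22, 23, 24, 25, 27, 28} :: nat set"
  let ?M = "{7, 8, 9, 10, 11, 13, 14, 15, 16, 17, 18, 19, 20} :: nat set"
  have n: "0 < n" using s by (simp add: ready_def)
  have Sn: "S \<subseteq> {..<n}" using S D by (rule order_trans)
  have fin: "finite U" by (simp add: U_def)
  have U: "U \<noteq> {}" using qverts_nonempty[of \<phi>] \<phi>(2) by simp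
  have cU: "1 \<le> card U" "card U \<le> n"
    using fin U card_mono[of "{..<n}" U] by (auto simp: Suc_le_eq card_gt_0_iff U_def)
  let ?s0 = "((fst s)(9 := set_encode S, 4 := set_encode S), snd s)"
  have fr0: "frame {4, 9} {} s ?s0" by simp
  have "halts (decode 15 ;; cut_com ;; Assign 8 (Reg 5) ;; Assign 10 (Num 0) ;; Assign 11 (Num 0) ;;
     Assign 12 (Num 0) ;; tokens_com ;; finish_com) (\<lambda>t. Q (Suc (Suc t))) ?s0"
  proof (rule halts_SeqI, rule halts_decode[where A = S and Q = "\<lambda>t s'. t \<le> 7 * n \<and>
        chi 15 S s' \<and> frame {3, 4} {15} ?s0 s'"], goal_cases)
    case 1
    show ?case by (rule ready_frame[OF s fr0]) auto
  next
    case (6 t1 s1)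
    have t1: "t1 \<le> 7 * n" and c1: "chi 15 S s1" and fr01: "frame {3, 4} {15} ?s0 s1" using 6 by blast+
    have fr1: "frame {3, 4, 9} {15} s s1" using fr0 fr01 by (rule frame_trans) auto
    have r1: "fst s1 9 = set_encode S" using frame_reg[OF fr01, of 9] by simp
    show ?case
    proof (rule halts_SeqI, rule halts_cut[where X = S and Q = "\<lambda>t s'. t \<le> 12 * n * n \<and>
          fst s' 5 = cut S \<and> frame {5, 6, 7} {} s1 s'"], goal_cases)
      case 1
      show ?case by (rule ready_frame[OF s fr1]) auto
    next
      case (5 t2 s2)
      have t2: "t2 \<le> 12 * n * n" and r2: "fst s2 5 = cut S" and fr12: "frame {5, 6, 7} {} s1 s2" using 5 by blast+
      have fr2: "frame {3, 4, 5, 6, 7, 9} {15} s s2" using fr1 fr12 by (rule frame_trans) auto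
      have r2': "fst s2 9 = set_encode S" using frame_reg[OF fr12, of 9] r1 by simp
      let ?s3 = "((fst s2)(8 := cut S, 10 := 0, 11 := 0, 12 := 0), snd s2)"
      have fr3: "frame {3, 4, 5, 6, 7, 8, 9, 10, 11, 12} {15} s ?s3" using fr2 by (simp add: frame_def)
      have s3: "ready ?s3" by (rule ready_frame[OF s fr3]) auto
      have st3: "stack [] ?s3" by (simp add: stack_def)
      have a3: "snd ?s3 6 = snd s 6" "fst ?s3 13 = fst s 13"
        using frame_arr[OF fr3, of 6] frame_reg[OF fr3, of 13] by simp_all
      have "halts tokens_com (\<lambda>t. halts finish_com (\<lambda>t'. Q (Suc (Suc (Suc (Suc (Suc (Suc (t1 + t2 + (t + t')))))))))) ?s3"
      proof (rule halts_tokens[OF \<phi>(1) s3 st3], goal_cases)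
        case (3 k)
        then show ?case using tok(1)[of k] a3 by simp
      next
        case 4
        then show ?case using tok(2) a3 by simp
      next
        case (5 t4 s4)
        have fr4: "frame {3, 4, 5, 6, 7, 8, 9, 10, 11, 12, 16, 17, 18, 19, 20, 21, 22, 23, 27, 28} ?M s s4"
          using fr3 5(3)[unfolded steady_def] by (rule frame_trans) auto
        have s4: "ready s4" by (rule ready_frame[OF s fr4]) auto
        have r4: "fst s4 9 = set_encode S" using r2' 5(3) by (simp add: steady_def frame_def)
        have b4: "best C s4" using b fr4 by (rule best_frame) auto
        have stop: "\<not> bval (Less (Reg 12) (Reg 13)) s4"
          using 5(3,4) tok(2) a3(2) by (simp add: steady_def frame_def)
        show ?case
          unfolding tokens_com_def
        proof (subst halts_While, simp only: stop if_False, rule halts_finish[OF s4 _ r4 b4 U], goal_cases)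
          case 1
          show ?case using 5(2) by (simp add: \<phi>(2))
        next
          case (2 t5 s5)
          show ?case
          proof (rule Q[OF _ 2(2)])
            show "frame ?R ?M s s5" using fr4 2(3) by (rule frame_trans) auto
            let ?N = "n ^ (2 * q + 1)"
            have pow: "n ^ k \<le> ?N" if "k \<le> 2 * q + 1" for k using n that by (intro power_increasing) auto
            have N: "n \<le> ?N" "n * n \<le> ?N" "n * n * n \<le> ?N" "1 \<le> ?N"
              using pow[of 1] pow[of 2] pow[of 3] pow[of 0] q by (simp_all add: eval_nat_numeral mult.assoc)
            have U2q: "card U ^ (2 * q) \<le> n ^ (2 * q)" "card U ^ q \<le> n ^ q" using cU by (auto intro: power_mono)
            have "n * card U ^ (2 * q) \<le> ?N" using U2q by simp
            moreover have "n * card U ^ q \<le> n ^ (q + 1)" using U2q by simp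
            then have Uq: "n * card U ^ q \<le> ?N" using pow[of "q + 1"] by linarith
            moreover have "n * n * (2 * card U - 1) \<le> n * n * (2 * n)" using cU by (intro mult_le_mono2) linarith
            then have "44 * (n * n) * (2 * card U - 1) \<le> 88 * (n * n * n)" by (simp add: mult.assoc)
            ultimately have "time (card U) \<le> 278 * ?N" unfolding time_def using N by linarith
            then have "t4 \<le> 278 * ?N" using 5(1) \<phi>(2) by simp
            moreover have "t5 \<le> 44 * ?N" using 2(1) Uq by linarith
            ultimately show "Suc (Suc (Suc (Suc (Suc (Suc (t1 + t2 + (t4 + 1 + t5))))))) \<le> 400 * ?N"
              using t1 t2 N unfolding mult.assoc by linarith
          qed
        qed
      qed (use r2' in simp_all)
      then show ?case using r2 by (simp add: halts_Seq add.assoc)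
    qed (use c1 Sn in auto)
  qed (use Sn in auto)
  then show ?thesis
    unfolding guess_com_def halts_Seq halts_Assign using g by simp
qed

end

section \<open>Initialization\<close>

definition rows_com :: com where
  "rows_com = For 6 (Num 0) (Reg 0) (Store 5 (Plus (Reg 6) (Num 1)) (Plus (Load 5 (Reg 6)) (Reg 0)))"

definition powers_com :: com where
  "powers_com = Store 4 (Num 0) (Num 1) ;;
     For 6 (Num 0) (Load 5 (Reg 0)) (Store 4 (Plus (Reg 6) (Num 1)) (Plus (Load 4 (Reg 6)) (Load 4 (Reg 6))))"

definition subsets_com :: com where
  "subsets_com = Assign 15 (Num 1) ;;
     For 6 (Num 0) (Reg 0)
       (If1 (Equal (Load 1 (Reg 6)) (Num 1))
         (For 7 (Num 0) (Reg 15)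
           (Store 12 (Plus (Reg 15) (Reg 7)) (Plus (Load 12 (Reg 7)) (Load 4 (Reg 6)))) ;;
          Assign 15 (Plus (Reg 15) (Reg 15))))"

definition read_com :: com where
  "read_com = While (Less (Reg 26) (Reg 2))
     (Cond (Equal (Load 2 (Reg 26)) (Num 0))
       (Store 6 (Reg 13) (Plus (Load 2 (Plus (Reg 26) (Num 1))) (Num 1)) ;;
        Assign 13 (Plus (Reg 13) (Num 1)))
       (If1 (Equal (Load 2 (Reg 26)) (Num 3))
         (Store 6 (Reg 13) (Num 0) ;; Assign 13 (Plus (Reg 13) (Num 1)))) ;;
      Assign 26 (Plus (Reg 26) (Num 3)))"

definition bisection_com :: com where
  "bisection_com =
     rows_com ;;
     powers_com ;;
     subsets_com ;;
     read_com ;;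
     For 14 (Num 0) (Reg 15) guess_com ;;
     Assign 4 (Reg 25) ;;
     decode 3"

lemma halts_rows:
  assumes "fst s 0 = n" "snd s 5 0 = 0"
    and Q: "\<And>t s'. t \<le> 2 + 3 * n \<Longrightarrow> \<forall>v\<le>n. snd s' 5 v = v * n \<Longrightarrow> frame {6} {5} s s' \<Longrightarrow> Q t s'"
  shows "halts rows_com Q s"
  unfolding rows_com_def
proof (rule halts_For_const[where lo = 0 and hi = n and T = 1 and
    I = "\<lambda>k s'. frame {6} {5} s s' \<and> fst s' 6 = k \<and> (\<forall>v\<le>k. snd s' 5 v = v * n)"], goal_cases)
  case (5 k s')
  then show ?case using assms(1) by (simp add: frame_def le_Suc_eq)
qed (use assms in \<open>auto simp: frame_def\<close>)

lemma halts_powers: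
  assumes "snd s 5 (fst s 0) = m"
    and Q: "\<And>t s'. t \<le> 3 + 3 * m \<Longrightarrow> \<forall>k\<le>m. snd s' 4 k = 2 ^ k \<Longrightarrow> frame {6} {4} s s' \<Longrightarrow> Q t s'"
  shows "halts powers_com Q s"
  unfolding powers_com_def halts_Seq halts_Store
proof (rule halts_For_const[where lo = 0 and hi = m and T = 1 and
    I = "\<lambda>k s'. frame {6} {4} s s' \<and> fst s' 6 = k \<and> (\<forall>v\<le>k. snd s' 4 v = 2 ^ v)"], goal_cases)
  case (5 k s')
  then show ?case by (simp add: le_Suc_eq)
next
  case (6 t s')
  then show ?case by (intro Q) auto
qed (use assms in \<open>auto simp: frame_def\<close>)

context cut_graph
begin

lemma halts_subsets:
  assumes s: "ready s" and D: "D \<subseteq> {..<n}" and z: "snd s 12 0 = 0"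
    and Q: "\<And>t s'. t \<le> 12 * (n * 2 ^ card D) \<Longrightarrow> fst s' 15 = 2 ^ card D \<Longrightarrow>
      snd s' 12 ` {..<2 ^ card D} = set_encode ` Pow D \<Longrightarrow> frame {6, 7, 15} {12} s s' \<Longrightarrow> Q t s'"
  shows "halts subsets_com Q s"
proof -
  have n: "0 < n" and s0: "fst s 0 = n" using s by (simp_all add: ready_def)
  have finD: "finite D" using D by (rule finite_subset) simp
  define Dk where "Dk k = D \<inter> {..<k}" for k
  have Dk_Suc: "Dk (Suc k) = (if k \<in> D then insert k (Dk k) else Dk k)" for k
    by (auto simp: Dk_def less_Suc_eq)
  have Dk: "finite (Dk k)" "k \<notin> Dk k" "card (Dk k) \<le> card D" for k
    using finD by (auto simp: Dk_def intro: card_mono)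
  have pow: "2 ^ card (Dk k) \<le> (2 ^ card D :: nat)" for k using Dk(3) by (intro power_increasing) auto
  have Dn: "Dk n = D" using D by (auto simp: Dk_def)
  show ?thesis
    unfolding subsets_com_def halts_Seq halts_Assign
  proof (rule halts_For_const[where lo = 0 and hi = n and T = "3 * 2 ^ card D + 4" and
      I = "\<lambda>k s'. frame {6, 7, 15} {12} s s' \<and> fst s' 6 = k \<and> fst s' 15 = 2 ^ card (Dk k) \<and>
        snd s' 12 ` {..<2 ^ card (Dk k)} = set_encode ` Pow (Dk k)"], goal_cases)
    case 3
    have "Dk 0 = {}" by (simp add: Dk_def)
    then show ?case using z by (simp add: lessThan_Suc)
  next
    case (4 k s')
    then show ?case using s0 by (simp add: frame_def)
  next
    case (5 k s1)
    have fr1: "frame {6, 7, 15} {12} s s1" and r1: "fst s1 6 = k" "fst s1 15 = 2 ^ card (Dk k)"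
      and im: "snd s1 12 ` {..<2 ^ card (Dk k)} = set_encode ` Pow (Dk k)" using 5(1) by blast+
    have s1: "ready s1" by (rule ready_frame[OF s fr1]) auto
    let ?c = "2 ^ card (Dk k) :: nat"
    show ?case
    proof (cases "k \<in> D")
      case False
      then show ?thesis using fr1 r1 im s1 5(3) Dk_Suc[of k] by (simp add: ready_def)
    next
      case True
      have k4: "snd s1 4 k = 2 ^ k"
      proof -
        have "k \<le> n * n" using 5(3) le_square[of n] by linarith
        then show ?thesis using s1 by (simp add: ready_def)
      qed
      have card: "card (Dk (Suc k)) = Suc (card (Dk k))" using Dk_Suc[of k] True Dk by simp
      have "halts (For 7 (Num 0) (Reg 15) (Store 12 (Plus (Reg 15) (Reg 7)) (Plus (Load 12 (Reg 7)) (Load 4 (Reg 6)))) ;;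
          Assign 15 (Plus (Reg 15) (Reg 15)))
        (\<lambda>t s'. Suc t \<le> 3 * 2 ^ card D + 4 \<and> fst s' 6 = k \<and>
          frame {6, 7, 15} {12} s ((fst s')(6 := Suc k), snd s') \<and> fst ((fst s')(6 := Suc k), snd s') 6 = Suc k \<and>
          fst ((fst s')(6 := Suc k), snd s') 15 = 2 ^ card (Dk (Suc k)) \<and>
          snd ((fst s')(6 := Suc k), snd s') 12 ` {..<2 ^ card (Dk (Suc k))} = set_encode ` Pow (Dk (Suc k))) s1"
        unfolding halts_Seq halts_Assign
      proof (rule halts_For_const[where lo = 0 and hi = ?c and T = 1 and
          I = "\<lambda>j s'. frame {7} {12} s1 s' \<and> fst s' 7 = j \<and> (\<forall>i<?c. snd s' 12 i = snd s1 12 i) \<and>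
            (\<forall>i<j. snd s' 12 (?c + i) = snd s1 12 i + 2 ^ k)"], goal_cases)
        case (4 j s')
        then show ?case using r1 by (simp add: frame_def)
      next
        case (5 j s')
        then show ?case using r1 k4 by (simp add: frame_def less_Suc_eq)
      next
        case (6 t s')
        have a: "snd s' 12 i = snd s1 12 i" "snd s' 12 (?c + i) = snd s1 12 i + 2 ^ k" if "i < ?c" for i
          using 6(2) that by simp_all
        have split: "{..<?c + ?c} = {..<?c} \<union> (+) ?c ` {..<?c}"
          by (simp add: lessThan_atLeast0 ivl_disj_un_two(3))
        have "snd s' 12 ` {..<?c + ?c} = snd s' 12 ` {..<?c} \<union> (\<lambda>i. snd s' 12 (?c + i)) ` {..<?c}"
          unfolding split by (simp add: image_Un image_image)
        also have "snd s' 12 ` {..<?c} = snd s1 12 ` {..<?c}" using a(1) by (intro image_cong) auto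
        also have "(\<lambda>i. snd s' 12 (?c + i)) ` {..<?c} = (\<lambda>e. e + 2 ^ k) ` snd s1 12 ` {..<?c}"
          unfolding image_image using a(2) by (intro image_cong) auto
        also have "\<dots> = (\<lambda>A. set_encode (insert k A)) ` Pow (Dk k)"
          unfolding im image_image
        proof (rule image_cong)
          fix A assume "A \<in> Pow (Dk k)"
          then have "finite A" "k \<notin> A" using Dk(1,2)[of k] finite_subset by blast+
          then show "set_encode A + 2 ^ k = set_encode (insert k A)" by simp
        qed simp
        finally have "snd s' 12 ` {..<?c + ?c} = set_encode ` Pow (Dk (Suc k))"
          unfolding im using Dk_Suc[of k] True by (simp add: Pow_insert image_Un image_image)
        moreover have "t \<le> 2 + 3 * ?c" using 6(1) by simp
        then have "Suc (t + 1) \<le> 3 * 2 ^ card D + 4" using pow[of k] by linarith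
        moreover have "frame {6, 7, 15} {12} s s'" using fr1 conjunct1[OF 6(2)] by (rule frame_trans) auto
        moreover have "fst s' 15 = ?c" "fst s' 6 = k" using 6(2) r1 by (simp_all add: frame_def)
        ultimately show ?case using card by (simp add: mult_2)
      qed (use r1 in simp_all)
      moreover have "bval (Equal (Load 1 (Reg 6)) (Num 1)) s1" using r1 s1 5(3) True by (simp add: ready_def)
      ultimately show ?thesis unfolding halts_Cond by (simp del: bval.simps)
    qed
  next
    case (6 t s')
    show ?case
    proof (rule Q)
      have "n * 1 \<le> n * 2 ^ card D" by (intro mult_le_mono2) simp
      moreover have "t \<le> 2 + (3 * (n * 2 ^ card D) + 6 * n)" using 6(1) by (simp add: algebra_simps)
      ultimately show "1 + t \<le> 12 * (n * 2 ^ card D)" using n by linarith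
    qed (use 6(2) Dn in simp_all)
  qed (use s0 in auto)
qed

end

lemma read_step:
  assumes "fst s 26 < fst s 2" "snd s 2 (fst s 26) = 1 \<or> snd s 2 (fst s 26) = 2"
    "halts read_com (\<lambda>t. Q (Suc (Suc (Suc (Suc (Suc t)))))) ((fst s)(26 := fst s 26 + 3), snd s)"
  shows "halts read_com Q s"
  using assms unfolding read_com_def by (subst halts_While) (auto simp: halts_Seq)

lemma halts_read:
  assumes "\<And>k. k < length (code \<phi>) \<Longrightarrow> snd s 2 (fst s 26 + k) = code \<phi> ! k"
    and "fst s 26 + length (code \<phi>) \<le> fst s 2"
    and "\<And>t s'. t \<le> 2 * length (code \<phi>) \<Longrightarrow> fst s' 26 = fst s 26 + length (code \<phi>) \<Longrightarrow>
      fst s' 13 = fst s 13 + length (toks \<phi>) \<Longrightarrow> \<forall>k<fst s 13. snd s' 6 k = snd s 6 k \<Longrightarrow>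
      \<forall>k<length (toks \<phi>). snd s' 6 (fst s 13 + k) = toks \<phi> ! k \<Longrightarrow> frame {13, 26} {6} s s' \<Longrightarrow>
      halts read_com (\<lambda>t'. Q (t + t')) s'"
  shows "halts read_com Q s"
  using assms
proof (induction \<phi> arbitrary: s Q)
  case (Const v i)
  have c: "snd s 2 (fst s 26) = 0" "snd s 2 (Suc (fst s 26)) = v"
    using Const.prems(1)[of 0] Const.prems(1)[of 1] by simp_all
  let ?s = "((fst s)(13 := Suc (fst s 13), 26 := fst s 26 + 3), (snd s)(6 := (snd s 6)(fst s 13 := Suc v)))"
  have "halts read_com (\<lambda>t'. Q (Suc (Suc (Suc (Suc (Suc 0)))) + t')) ?s"
    by (rule Const.prems(3)) simp_all
  then show ?case
    using Const.prems(2) c unfolding read_com_def by (subst halts_While) (simp add: halts_Seq)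
next
  case (Join i j \<phi>)
  show ?case
  proof (rule Join.IH, goal_cases)
    case (1 k)
    then show ?case using Join.prems(1)[of k] by (simp add: nth_append)
  next
    case 2
    then show ?case using Join.prems(2) by simp
  next
    case (3 t s1)
    have op: "snd s1 2 (fst s1 26) = 1"
      using Join.prems(1)[of "length (code \<phi>)"] 3(2,6) by (simp add: nth_append frame_def)
    have less: "fst s1 26 < fst s1 2" using Join.prems(2) 3(2,6) by (simp add: frame_def)
    have "halts read_com (\<lambda>t'. Q (Suc (Suc (Suc (Suc (Suc t)))) + t')) ((fst s1)(26 := fst s1 26 + 3), snd s1)"
      by (rule Join.prems(3)) (use 3 in simp_all)
    then have rest: "halts read_com (\<lambda>t'. Q (t + Suc (Suc (Suc (Suc (Suc t')))))) ((fst s1)(26 := fst s1 26 + 3), snd s1)"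
      by simp
    show ?case by (rule read_step[OF less _ rest]) (simp add: op)
  qed
next
  case (Relabel i j \<phi>)
  show ?case
  proof (rule Relabel.IH, goal_cases)
    case (1 k)
    then show ?case using Relabel.prems(1)[of k] by (simp add: nth_append)
  next
    case 2
    then show ?case using Relabel.prems(2) by simp
  next
    case (3 t s1)
    have op: "snd s1 2 (fst s1 26) = 2"
      using Relabel.prems(1)[of "length (code \<phi>)"] 3(2,6) by (simp add: nth_append frame_def)
    have less: "fst s1 26 < fst s1 2" using Relabel.prems(2) 3(2,6) by (simp add: frame_def)
    have "halts read_com (\<lambda>t'. Q (Suc (Suc (Suc (Suc (Suc t)))) + t')) ((fst s1)(26 := fst s1 26 + 3), snd s1)"
      by (rule Relabel.prems(3)) (use 3 in simp_all)
    then have rest: "halts read_com (\<lambda>t'. Q (t + Suc (Suc (Suc (Suc (Suc t')))))) ((fst s1)(26 := fst s1 26 + 3), snd s1)"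
      by simp
    show ?case by (rule read_step[OF less _ rest]) (simp add: op)
  qed
next
  case (DUnion \<phi> \<psi>)
  let ?a = "length (code \<phi>)" and ?b = "length (code \<psi>)"
  let ?ta = "length (toks \<phi>)" and ?tb = "length (toks \<psi>)"
  have c1: "snd s 2 (fst s 26 + k) = code \<phi> ! k" if "k < ?a" for k
    using DUnion.prems(1)[of k] that by (simp add: nth_append)
  have c2: "snd s 2 (fst s 26 + ?a + k) = code \<psi> ! k" if "k < ?b" for k
    using DUnion.prems(1)[of "?a + k"] that by (simp add: nth_append add.assoc)
  have c3: "snd s 2 (fst s 26 + ?a + ?b) = 3"
    using DUnion.prems(1)[of "?a + ?b"] by (simp add: nth_append add.assoc)
  show ?case
  proof (rule DUnion.IH(1)[OF c1], goal_cases)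
    case 2
    then show ?case using DUnion.prems(2) by simp
  next
    case (3 t1 s1)
    have fr1: "frame {13, 26} {6} s s1" by fact
    have f1: "\<forall>k<fst s 13. snd s1 6 k = snd s 6 k" "\<forall>k<?ta. snd s1 6 (fst s 13 + k) = toks \<phi> ! k" by fact+
    have r1: "fst s1 26 = fst s 26 + ?a" "fst s1 13 = fst s 13 + ?ta" "snd s1 2 = snd s 2" "fst s1 2 = fst s 2"
      using 3(2,3) frame_arr[OF fr1, of 2] frame_reg[OF fr1, of 2] by simp_all
    show ?case
    proof (rule DUnion.IH(2), goal_cases)
      case (1 k)
      then show ?case using c2 r1 by simp
    next
      case 2
      then show ?case using DUnion.prems(2) r1 by simp
    next
      case (3 t2 s2)
      have fr2: "frame {13, 26} {6} s s2" using fr1 3(6) by (rule frame_trans) auto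
      have f2: "\<forall>k<fst s1 13. snd s2 6 k = snd s1 6 k" "\<forall>k<?tb. snd s2 6 (fst s1 13 + k) = toks \<psi> ! k" by fact+
      have r2: "fst s2 26 = fst s 26 + ?a + ?b" "fst s2 13 = fst s 13 + ?ta + ?tb" "snd s2 2 = snd s 2" "fst s2 2 = fst s 2"
        using 3(2,3) r1 frame_arr[OF fr2, of 2] frame_reg[OF fr2, of 2] by simp_all
      let ?s = "((fst s2)(13 := Suc (fst s2 13), 26 := fst s2 26 + 3), (snd s2)(6 := (snd s2 6)(fst s2 13 := 0)))"
      have "halts read_com (\<lambda>t'. Q (Suc (Suc (Suc (Suc (Suc (Suc (t1 + t2)))))) + t')) ?s"
      proof (rule DUnion.prems(3))
        show "\<forall>k<length (toks (DUnion \<phi> \<psi>)). snd ?s 6 (fst s 13 + k) = toks (DUnion \<phi> \<psi>) ! k"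
        proof (intro allI impI)
          fix k assume "k < length (toks (DUnion \<phi> \<psi>))"
          then have k: "k < ?ta + ?tb + 1" by simp
          show "snd ?s 6 (fst s 13 + k) = toks (DUnion \<phi> \<psi>) ! k"
          proof (cases "k < ?ta")
            case True
            then have "snd s2 6 (fst s 13 + k) = toks \<phi> ! k" using f1(2) f2(1) r1(2) by simp
            then show ?thesis using True r2(2) by (simp add: nth_append)
          next
            case False
            then obtain j where j: "k = ?ta + j" by (auto simp: not_less le_iff_add)
            show ?thesis
            proof (cases "j < ?tb")
              case True
              then have "snd s2 6 (fst s 13 + ?ta + j) = toks \<psi> ! j" using f2(2) r1(2) by simp
              then show ?thesis using True r2(2) by (simp add: nth_append j add.assoc)
            next
              case False
              then have "j = ?tb" using k j by simp
              then show ?thesis using r2(2) by (simp add: nth_append j add.assoc)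
            qed
          qed
        qed
      qed (use 3(1) \<open>t1 \<le> _\<close> r2 f1 f2 r1 fr2 in simp_all)
      moreover have "fst s2 26 < fst s2 2" "snd s2 2 (fst s2 26) = 3" using DUnion.prems(2) r2 c3 by simp_all
      ultimately show ?case
        unfolding read_com_def by (subst halts_While) (simp add: halts_Seq add.assoc)
    qed
  qed
qed

section \<open>Main result\<close>

context cut_graph
begin

lemma cut_card: "X \<subseteq> {..<n} \<Longrightarrow> cut X = card (SIGMA u:X. {w \<in> {..<n} - X. adj u w})"
proof -
  assume X: "X \<subseteq> {..<n}"
  then have "finite X" by (rule finite_subset) simp
  have "(\<Sum>w\<in>{..<n} - X. of_bool (adj u w)) = card {w \<in> {..<n} - X. adj u w}" for u
    by (simp only: card_eq_sum of_bool_def sum.inter_filter[OF finite_Diff[OF finite_lessThan]])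
  then have "cut X = (\<Sum>u\<in>X. card {w \<in> {..<n} - X. adj u w})"
    by (simp only: cut_def between_def)
  also have "\<dots> = card (SIGMA u:X. {w \<in> {..<n} - X. adj u w})"
    using \<open>finite X\<close> by (intro card_SigmaI[symmetric]) auto
  finally show ?thesis .
qed

lemma cut_size_eq:
  assumes E: "\<And>u w. u < n \<Longrightarrow> w < n \<Longrightarrow> adj u w \<longleftrightarrow> {u, w} \<in> edges G" and X: "X \<subseteq> {..<n}"
  shows "cut_size G X ({..<n} - X) = cut X"
proof -
  let ?P = "SIGMA u:X. {w \<in> {..<n} - X. adj u w}"
  have inj: "inj_on (\<lambda>(u, w). {u, w}) ?P"
    by (auto simp: inj_on_def doubleton_eq_iff)
  have im: "(\<lambda>(u, w). {u, w}) ` ?P = {e \<in> edges G. \<exists>a\<in>X. \<exists>b\<in>{..<n} - X. e = {a, b}}"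
    using E X by (auto simp: image_iff)
  show ?thesis
    unfolding cut_size_def cut_card[OF X] im[symmetric] by (rule card_image[OF inj])
qed

lemma cut_size_commute: "cut_size G A B = cut_size G B A" for A B :: "'b set"
proof -
  have swap: "\<exists>a\<in>B. \<exists>b\<in>A. e = {a, b}" if h: "\<exists>a\<in>A. \<exists>b\<in>B. e = {a, b}" for e and A B :: "'b set"
  proof -
    obtain a b where ab: "a \<in> A" "b \<in> B" "e = {a, b}" using h by blast
    from ab(3) have "e = {b, a}" by (simp only: insert_commute)
    with ab(1,2) show ?thesis by (intro bexI)
  qed
  have "(\<exists>a\<in>A. \<exists>b\<in>B. e = {a, b}) \<longleftrightarrow> (\<exists>a\<in>B. \<exists>b\<in>A. e = {a, b})" for e
    by (rule iffI) (erule swap)+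
  then show ?thesis unfolding cut_size_def by (simp only:)
qed

lemma halts_bisection:
  assumes n: "0 < n" and q: "1 \<le> q" and D: "D \<subseteq> {..<n}"
    and \<phi>: "dp.good n adj D q \<phi>" "qverts \<phi> = U"
    and r: "fst s 0 = n" "fst s 2 = length (code \<phi>)" "fst s 13 = 0" "fst s 24 = 0" "fst s 26 = 0"
    and a: "\<forall>u<n. \<forall>w<n. snd s 0 (u * n + w) = of_bool (adj u w)" "\<forall>v<n. snd s 1 v = of_bool (v \<in> D)"
      "\<forall>k<length (code \<phi>). snd s 2 k = code \<phi> ! k" "snd s 5 0 = 0" "snd s 12 0 = 0"
  shows "halts bisection_com (\<lambda>t s'. t \<le> 500 * (2 ^ card D * n ^ (2 * q + 1) + length (code \<phi>)) \<and>
    (\<exists>X\<subseteq>{..<n}. chi 3 X s' \<and> card X = n div 2 \<and>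
      (\<forall>Y\<subseteq>{..<n}. card Y = n div 2 \<longrightarrow> cut X \<le> cut Y))) s"
proof -
  let ?N = "n ^ (2 * q + 1)" and ?d = "2 ^ card D :: nat"
  let ?Q = "\<lambda>t s'. t \<le> 500 * (?d * ?N + length (code \<phi>)) \<and>
    (\<exists>X\<subseteq>{..<n}. chi 3 X s' \<and> card X = n div 2 \<and> (\<forall>Y\<subseteq>{..<n}. card Y = n div 2 \<longrightarrow> cut X \<le> cut Y))"
  have finD: "finite D" using D by (rule finite_subset) simp
  have pow: "n ^ k \<le> ?N" if "k \<le> 2 * q + 1" for k using n that by (intro power_increasing) auto
  have "1 * ?N \<le> ?d * ?N" by (intro mult_le_mono1) simp
  moreover have N: "n \<le> ?N" "n * n \<le> ?N" "1 \<le> ?N"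
    using pow[of 1] pow[of 2] pow[of 0] q by (simp_all add: power2_eq_square)
  ultimately have dN: "n \<le> ?d * ?N" "n * n \<le> ?d * ?N" "1 \<le> ?d * ?N" by linarith+
  have ndN: "n * ?d \<le> ?d * ?N" using N(1) by (subst mult.commute) (rule mult_le_mono2)
  show ?thesis
    unfolding bisection_com_def
  proof (rule halts_SeqI, rule halts_rows[where n = n and Q = "\<lambda>t s'. t \<le> 2 + 3 * n \<and>
        (\<forall>v\<le>n. snd s' 5 v = v * n) \<and> frame {6} {5} s s'"], goal_cases)
    case (4 t1 s1)
    have t1: "t1 \<le> 2 + 3 * n" and rows: "\<forall>v\<le>n. snd s1 5 v = v * n" and fr1: "frame {6} {5} s s1" using 4 by blast+
    show ?case
    proof (rule halts_SeqI, rule halts_powers[where m = "n * n" and Q = "\<lambda>t s'. t \<le> 3 + 3 * (n * n) \<and>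
          (\<forall>k\<le>n * n. snd s' 4 k = 2 ^ k) \<and> frame {6} {4} s1 s'"], goal_cases)
      case 1
      then show ?case using rows r(1) frame_reg[OF fr1, of 0] by simp
    next
      case (3 t2 s2)
      have t2: "t2 \<le> 3 + 3 * (n * n)" and pows: "\<forall>k\<le>n * n. snd s2 4 k = 2 ^ k" and fr12: "frame {6} {4} s1 s2" using 3 by blast+
      have fr2: "frame {6} {4, 5} s s2" using fr1 fr12 by (rule frame_trans) auto
      have s2: "ready s2"
        unfolding ready_def
        using n r(1) a(1,2) rows pows frame_reg[OF fr2, of 0] frame_arr[OF fr2, of 0] frame_arr[OF fr2, of 1] frame_arr[OF fr12, of 5]
        by simp
      show ?case
      proof (rule halts_SeqI, rule halts_subsets[OF s2 D, where Q = "\<lambda>t s'. t \<le> 12 * (n * ?d) \<and>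
            fst s' 15 = ?d \<and> snd s' 12 ` {..<?d} = set_encode ` Pow D \<and> frame {6, 7, 15} {12} s2 s'"], goal_cases)
        case 1
        then show ?case using a(5) frame_arr[OF fr2, of 12] by simp
      next
        case (3 t3 s3)
        have t3: "t3 \<le> 12 * (n * ?d)" and r3: "fst s3 15 = ?d" and subs: "snd s3 12 ` {..<?d} = set_encode ` Pow D"
          and fr23: "frame {6, 7, 15} {12} s2 s3" using 3 by blast+
        have fr3: "frame {6, 7, 15} {4, 5, 12} s s3" using fr2 fr23 by (rule frame_trans) auto
        have s3: "ready s3" by (rule ready_frame[OF s2 fr23]) auto
        have r3': "fst s3 2 = length (code \<phi>)" "fst s3 13 = 0" "fst s3 24 = 0" "fst s3 26 = 0" "snd s3 2 = snd s 2"
          using r frame_reg[OF fr3] frame_arr[OF fr3, of 2] by simp_all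
        have "halts read_com (\<lambda>t4. halts (For 14 (Num 0) (Reg 15) guess_com ;; Assign 4 (Reg 25) ;; decode 3)
            (\<lambda>t5. ?Q (t1 + (t2 + (t3 + (t4 + t5)))))) s3"
        proof (rule halts_read[of \<phi>], goal_cases)
          case (1 k)
          then show ?case using a(3) r3' by simp
        next
          case 2
          then show ?case using r3' by simp
        next
          case (3 t4 s4)
          have fr34: "frame {13, 26} {6} s3 s4" by fact
          have s4: "ready s4" by (rule ready_frame[OF s3 fr34]) auto
          have r4: "fst s4 13 = length (toks \<phi>)" "fst s4 15 = ?d" "fst s4 24 = 0" "snd s4 12 = snd s3 12"
            using 3(3) r3 r3' frame_reg[OF fr34] frame_arr[OF fr34, of 12] by simp_all
          have tok4: "\<And>k. k < length (toks \<phi>) \<Longrightarrow> snd s4 6 k = toks \<phi> ! k" using 3(5) r3' by simp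
          have stop: "\<not> bval (Less (Reg 26) (Reg 2)) s4"
            using 3(2) r3' frame_reg[OF fr34, of 2] by simp
          let ?S = "\<lambda>g. set_decode (snd s4 12 g)"
          have subD: "?S g \<subseteq> D" if "g < ?d" for g
          proof -
            have "snd s4 12 g \<in> set_encode ` Pow D" unfolding r4(4) subs[symmetric] using that by simp
            then obtain A where A: "A \<subseteq> D" "snd s4 12 g = set_encode A" by blast
            then show ?thesis using finite_subset[OF A(1) finD] by simp
          qed
          let ?R = "{3, 4, 5, 6, 7, 8, 9, 10, 11, 12, 14, 16, 17, 18, 19, 20, 21, 22, 23, 24, 25, 27, 28} :: nat set"
          let ?M = "{7, 8, 9, 10, 11, 13, 14, 15, 16, 17, 18, 19, 20} :: nat set"
          show ?case
            unfolding read_com_def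
          proof (subst halts_While, simp only: stop if_False, rule halts_SeqI,
              rule halts_For_const[where lo = 0 and hi = ?d and T = "400 * ?N" and
                I = "\<lambda>g s'. frame ?R ?M s4 s' \<and> fst s' 14 = g \<and> best (\<Union>g'<g. costs (?S g')) s'" and
                Q = "\<lambda>t s'. t \<le> 2 + ?d * (400 * ?N + 2) \<and> frame ?R ?M s4 s' \<and> best (\<Union>g'<?d. costs (?S g')) s'"], goal_cases)
            case 3
            then show ?case using r4(3) by (simp add: best_def)
          next
            case (4 g s')
            then show ?case using r4(2) by (simp add: frame_def)
          next
            case (5 g s5)
            have fr5: "frame ?R ?M s4 s5" and r5: "fst s5 14 = g" and b5: "best (\<Union>g'<g. costs (?S g')) s5" using 5(1) by blast+
            interpret dp n adj D q "?S g" using subD[OF 5(3)] D q by unfold_locales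
            have s5: "ready s5" by (rule ready_frame[OF s4 fr5]) auto
            show ?case
            proof (rule halts_guess[OF s5 _ b5 \<phi>], goal_cases)
              case 1
              then show ?case using r5 frame_arr[OF fr5, of 12] by simp
            next
              case (2 k)
              then show ?case using tok4 frame_arr[OF fr5, of 6] by simp
            next
              case 3
              then show ?case using r4(1) frame_reg[OF fr5, of 13] by simp
            next
              case (4 t s6)
              have fr6: "frame ?R ?M s4 s6" using fr5 4(3) by (rule frame_trans) auto
              have "(\<Union>g'<Suc g. costs (?S g')) = (\<Union>g'<g. costs (?S g')) \<union> costs (?S g)"
                by (auto simp: less_Suc_eq)
              then have "best (\<Union>g'<Suc g. costs (?S g')) s6" using 4(2) by (simp only:)
              then have "best (\<Union>g'<Suc g. costs (?S g')) ((fst s6)(14 := Suc g), snd s6)"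
                by (rule best_frame[where R = "{14}" and M = "{}"]) (auto simp: frame_def)
              moreover have "fst s6 14 = g" using r5 frame_reg[OF 4(3), of 14] by simp
              ultimately show ?case using fr6 4(1) by simp
            qed
          next
            case (7 t5 s5)
            have t5: "t5 \<le> 2 + ?d * (400 * ?N + 2)" and fr5: "frame ?R ?M s4 s5"
              and b5: "best (\<Union>g'<?d. costs (?S g')) s5" using 7 by blast+
            have cover: "cut Y \<in> (\<Union>g'<?d. costs (?S g'))" if Y: "Y \<subseteq> {..<n}" "card Y = n div 2" for Y
            proof -
              have "set_encode (Y \<inter> D) \<in> snd s4 12 ` {..<?d}" unfolding r4(4) subs by blast
              then obtain g where g: "g < ?d" "snd s4 12 g = set_encode (Y \<inter> D)" by auto
              have "?S g = Y \<inter> D" using g(2) finD by simp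
              moreover have "Y \<inter> D \<union> (Y - D) = Y" by blast
              moreover have "Y - D \<subseteq> U" using Y(1) by (auto simp: U_def)
              ultimately have "cut Y \<in> costs (?S g)"
                unfolding costs_def mem_Collect_eq using Y(2) by (intro exI[of _ "Y - D"]) simp
              then show ?thesis using g(1) by blast
            qed
            have "card {..<n div 2} = n div 2" "{..<n div 2} \<subseteq> {..<n}" by auto
            from cover[OF this(2,1)] have "0 < fst s5 24" using b5 unfolding best_def by blast
            then obtain X where X: "X \<subseteq> {..<n}" "fst s5 25 = set_encode X" "card X = n div 2" "fst s5 24 = Suc (cut X)"
              using b5 unfolding best_def by blast
            have opt: "cut X \<le> cut Y" if "Y \<subseteq> {..<n}" "card Y = n div 2" for Y
              using b5 cover[OF that] X(4) unfolding best_def by auto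
            have "frame ?R ?M s4 ((fst s5)(4 := set_encode X), snd s5)" using fr5 by simp
            then have s5: "ready ((fst s5)(4 := set_encode X), snd s5)"
              by (rule ready_frame[OF s4]) auto
            have "halts (decode 3) (\<lambda>t6. ?Q (t1 + (t2 + (t3 + (t4 + (1 + (t5 + (1 + t6)))))))) ((fst s5)(4 := set_encode X), snd s5)"
            proof (rule halts_decode[where A = X, OF s5], goal_cases)
              case (4 t6 s6)
              show ?case
              proof (intro conjI exI[of _ X] allI impI X opt 4(2))
                have "?d * 1 \<le> ?d * ?N" by (intro mult_le_mono2 N(3))
                moreover have "t5 \<le> 2 + (400 * (?d * ?N) + 2 * ?d)" using t5 by (simp add: algebra_simps)
                ultimately have t5': "t5 \<le> 2 + 402 * (?d * ?N)" by linarith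
                have sum: "t1 + (t2 + (t3 + (t4 + (1 + (t5 + (1 + t6)))))) \<le> 500 * (M + L)"
                  if "t1 \<le> 2 + 3 * a" "t2 \<le> 3 + 3 * b" "t3 \<le> 12 * c" "t4 \<le> 2 * L" "t5 \<le> 2 + 402 * M"
                    "t6 \<le> 7 * a" "a \<le> M" "b \<le> M" "c \<le> M" "1 \<le> M" for M L a b c
                  using that by simp
                show "t1 + (t2 + (t3 + (t4 + (1 + (t5 + (1 + t6)))))) \<le> 500 * (?d * ?N + length (code \<phi>))"
                  by (rule sum[OF t1 t2 t3 3(1) t5' 4(1) dN(1,2) ndN dN(3)])
              qed assumption
            qed (use X(1) in simp_all)
            then show ?case unfolding halts_Seq halts_Assign using X(2) by (simp add: add.assoc)
          qed (use r4 in auto)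
        qed
        then show ?case by (simp add: halts_Seq add.assoc)
      qed simp_all
    qed simp_all
  qed (use r a in auto)
qed

end

theorem theorem7:
  "\<exists>(P :: com) (C :: nat). \<forall>(G :: nat graph) (n :: nat) (D :: nat set) (q :: nat) (\<phi> :: nat qexpr).
     finite_graph G \<longrightarrow> verts G = {..<n} \<longrightarrow> D \<subseteq> verts G \<longrightarrow>
     qexpr_for q \<phi> (delete_verts G D) \<longrightarrow>
     (\<exists>t s. exec P (input_state G D q \<phi>) t s \<and>
        optimal_bisection G (output_side G 0 s) (output_side G 1 s) \<and>
        t \<le> C * (2 ^ card D * n ^ (2 * q + 1) * q ^ 3 + length (code \<phi>)))"
proof (rule exI[of _ bisection_com], rule exI[of _ 500], intro allI impI)
  fix G :: "nat graph" and n D q \<phi>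
  assume G: "finite_graph G" "verts G = {..<n}" and D: "D \<subseteq> verts G" and \<phi>: "qexpr_for q \<phi> (delete_verts G D)"
  define adj where "adj u w \<longleftrightarrow> {u, w} \<in> edges G" for u w
  interpret cut_graph n adj D
    by unfold_locales (simp add: adj_def insert_commute)
  obtain l where l: "qvalue \<phi> = (delete_verts G D, l)" and wf: "wf_qexpr q \<phi>"
    using \<phi> unfolding qexpr_for_def by blast
  have V: "qverts \<phi> = U" using l G(2) by (simp add: qverts_def delete_verts_def U_def)
  then obtain v where v: "v \<in> U" using qverts_nonempty[of \<phi>] by blast
  then have n: "0 < n" by (auto simp: U_def)
  have "l v \<in> {1..q}" using qexpr_labels[OF wf, of v] v V l by (simp add: qverts_def)
  then have q: "1 \<le> q" by simp
  interpret dp n adj D q "{}" using D G(2) q by unfold_locales auto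
  have "coherent U (edges (delete_verts G D)) l"
    unfolding coherent_def by (intro conjI exI[of _ "\<lambda>_ _. False"]) (auto simp: adj_def delete_verts_def U_def)
  then have good: "good \<phi>"
    unfolding good_def using wf l G(2) by (simp add: delete_verts_def U_def)
  let ?s = "input_state G D q \<phi>"
  have "fst ?s 0 = n" "fst ?s 2 = length (code \<phi>)" "fst ?s 13 = 0" "fst ?s 24 = 0" "fst ?s 26 = 0"
    "\<forall>v<n. snd ?s 1 v = of_bool (v \<in> D)" "\<forall>k<length (code \<phi>). snd ?s 2 k = code \<phi> ! k" "snd ?s 5 0 = 0" "snd ?s 12 0 = 0"
    using G(2) by (simp_all add: input_state_def Let_def)
  moreover have "\<forall>u<n. \<forall>w<n. snd ?s 0 (u * n + w) = of_bool (adj u w)"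
  proof (intro allI impI)
    fix u w assume "u < n" "w < n"
    moreover have "u * n + w < n * n"
    proof -
      have "Suc u * n \<le> n * n" using \<open>u < n\<close> by (intro mult_le_mono1) simp
      then show ?thesis using \<open>w < n\<close> by simp
    qed
    ultimately show "snd ?s 0 (u * n + w) = of_bool (adj u w)"
      using G(2) by (simp add: input_state_def Let_def adj_def)
  qed
  moreover have "D \<subseteq> {..<n}" using D G(2) by simp
  ultimately have "halts bisection_com (\<lambda>t s'. t \<le> 500 * (2 ^ card D * n ^ (2 * q + 1) + length (code \<phi>)) \<and>
    (\<exists>X\<subseteq>{..<n}. chi 3 X s' \<and> card X = n div 2 \<and>
      (\<forall>Y\<subseteq>{..<n}. card Y = n div 2 \<longrightarrow> cut X \<le> cut Y))) ?s"
    by (intro halts_bisection n q good V)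
  then obtain t s X where run: "exec bisection_com ?s t s"
    and t: "t \<le> 500 * (2 ^ card D * n ^ (2 * q + 1) + length (code \<phi>))"
    and X: "X \<subseteq> {..<n}" "chi 3 X s" "card X = n div 2"
    and opt: "\<And>Y. Y \<subseteq> {..<n} \<Longrightarrow> card Y = n div 2 \<Longrightarrow> cut X \<le> cut Y"
    unfolding halts_def by blast
  have out: "output_side G 0 s = {..<n} - X" "output_side G 1 s = X"
    using X(1,2) G(2) by (auto simp: output_side_def chi_def split: if_splits)
  have half: "int (n div 2) \<le> \<lceil>real n / 2\<rceil>" "int (n - n div 2) = \<lceil>real n / 2\<rceil>"
    by linarith+
  have finX: "finite X" using X(1) by (rule finite_subset) simp
  have size: "cut_size G Y ({..<n} - Y) = cut Y" if "Y \<subseteq> {..<n}" for Y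
    using that by (intro cut_size_eq) (simp_all add: adj_def)
  have cX: "cut_size G ({..<n} - X) X = cut X"
    using size[OF X(1)] by (simp add: cut_size_commute)
  have "optimal_bisection G ({..<n} - X) X"
    unfolding optimal_bisection_def
  proof (intro conjI allI impI)
    show "bisection G ({..<n} - X) X"
      unfolding bisection_def using X(1,3) finX half by (auto simp: G(2) card_Diff_subset)
    fix A B assume AB: "bisection G A B"
    have part: "A \<union> B = {..<n}" "A \<inter> B = {}" using AB G(2) by (simp_all add: bisection_def)
    then have fin: "finite A" "finite B" by (metis finite_Un finite_lessThan)+
    have sum: "card A + card B = n" using part fin by (metis card_Un_disjoint card_lessThan)
    have "int (card A) \<le> int (n - n div 2)" "int (card B) \<le> int (n - n div 2)"
      unfolding half(2) using AB by (simp_all add: bisection_def G(2))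
    then have le: "card A \<le> n - n div 2" "card B \<le> n - n div 2"
      unfolding of_nat_le_iff .
    have cA: "cut_size G A B = cut A"
    proof -
      have "B = {..<n} - A" using part by blast
      then show ?thesis using size[of A] part by blast
    qed
    have cB: "cut_size G A B = cut B"
    proof -
      have "A = {..<n} - B" using part by blast
      then show ?thesis using size[of B] part by (metis cut_size_commute Un_upper2)
    qed
    have "card A = n div 2 \<or> card B = n div 2" using sum le by linarith
    then show "cut_size G ({..<n} - X) X \<le> cut_size G A B"
      unfolding cX using opt[of A] opt[of B] cA cB part(1) by fastforce
  qed
  moreover have "t \<le> 500 * (2 ^ card D * n ^ (2 * q + 1) * q ^ 3 + length (code \<phi>))"
  proof -
    have "2 ^ card D * n ^ (2 * q + 1) * 1 \<le> 2 ^ card D * n ^ (2 * q + 1) * q ^ 3"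
      using q by (intro mult_le_mono2) simp
    then have "2 ^ card D * n ^ (2 * q + 1) + length (code \<phi>) \<le> 2 ^ card D * n ^ (2 * q + 1) * q ^ 3 + length (code \<phi>)"
      by simp
    from mult_le_mono2[OF this, of 500] t show ?thesis by (rule order_trans[rotated])
  qed
  ultimately show "\<exists>t s. exec bisection_com (input_state G D q \<phi>) t s \<and>
      optimal_bisection G (output_side G 0 s) (output_side G 1 s) \<and>
      t \<le> 500 * (2 ^ card D * n ^ (2 * q + 1) * q ^ 3 + length (code \<phi>))"
    using run out by metis
qed

end
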